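(* Let $(M,F)$ be a connected Finsler manifold of dimension at least $3$ with constant flag curvature. Suppose that (for all indices, in all natural coordinates on $TM\setminus 0$) $$\nabla_pD^i_{hkl}=0$$ and $$\frac{\partial R^i_{kl}}{\partial y^m}\dot A^m_{hp}+R^m_{kl}\Gamma^i_{mph}-R^i_{ml}\Gamma^m_{kph}-R^i_{km}\Gamma^m_{lph}=0.$$ Then $(M,F)$ is symmetric.
   Context: Let $M$ be an $n$-dimensional smooth manifold. Local coordinates $(x^i)$ on $M$ induce natural coordinates $(x^i,y^i)$ on $TM$ via $y=y^i\frac{\partial}{\partial x^i}$. Repeated indices are summed. A Finsler structure is a function $F:TM\to[0,\infty)$ that is differentiable (smooth) away from the zero section, satisfies $F(x,\lambda y)=\lambda F(x,y)$ for all $\lambda>0$, and such that the matrix $g_{ij}=\frac12\frac{\partial^2F^2}{\partial y^i\partial y^j}$ is positive-definite at every point of $TM\setminus 0$; $(g^{ij})$ is its inverse. $(M,F)$ is called a Finsler space (Finsler manifold). All tensors below live on $TM\setminus 0$; their indices refer to the pulled-back bundle $\pi^*TM$ and its dual, where $\pi:TM\setminus 0\to M$. Put $N^i_m=\frac14\frac{\partial}{\partial y^m}\Big(g^{is}\big(\frac{\partial g_{sk}}{\partial x^j}+\frac{\partial g_{sj}}{\partial x^k}-\frac{\partial g_{kj}}{\partial x^s}\big)y^jy^k\Big)$ and $\frac{\delta}{\delta x^i}=\frac{\partial}{\partial x^i}-N^m_i\frac{\partial}{\partial y^m}$. The Chern connection $\nabla$ has coefficients $\Gamma^i_{jk}=\frac{g^{is}}2\big(\frac{\delta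 g_{sj}}{\delta x^k}-\frac{\delta g_{jk}}{\delta x^s}+\frac{\delta g_{ks}}{\delta x^j}\big)$. $\nabla_h$, also written as a subscript $|h$, denotes the horizontal covariant derivative along $\frac{\delta}{\delta x^h}$: e.g. $\nabla_hT^i_j=T^i_{j|h}=\frac{\delta T^i_j}{\delta x^h}+T^m_j\Gamma^i_{mh}-T^i_m\Gamma^m_{jh}$, and similarly for other tensor types (one term per index). Notation: $\Gamma^i_{mph}=\frac{\partial}{\partial y^h}\Gamma^i_{mp}$. The hh-curvature is $R^i_{jkl}=\frac{\delta\Gamma^i_{jl}}{\delta x^k}-\frac{\delta\Gamma^i_{jk}}{\delta x^l}+\Gamma^i_{hk}\Gamma^h_{jl}-\Gamma^i_{hl}\Gamma^h_{jk}$. With $\ell^i=y^i/F$, put $R^i_{kl}=\ell^jR^i_{jkl}$. The Cartan tensor is $A_{ijk}=\frac F2\frac{\partial g_{ij}}{\partial y^k}$, $A^i_{jk}=g^{is}A_{sjk}$, and $\dot A^i_{jk}=A^i_{jk|s}\ell^s$. Put $$D^i_{hkl}=y^j\frac{\partial}{\partial y^h}\big[\dot A^i_{jl|k}-\dot A^i_{jk|l}+\dot A^s_{jl}\dot A^i_{sk}-\dot A^s_{jk}\dot A^i_{sl}\big].$$ Flag curvature: a nowhere zero vector field $X$ on an open set $O\subset M$ determines the Riemannian metric $g_{ij}(x,X(x))\,dx^i\otimes dx^j$ on $O$; $X$ is a geodesic vector field if its integral curves are geodesics of $F$. For a nonzero $v_m\in T_mM$ and a two-dimensional subspace $P\subset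 T_mM$ containing $v_m$, take a geodesic vector field $X$ on a neighborhood of $m$ with $X(m)=v_m$; the flag curvature of $M$ at the flag $(P,v_m)$ is the sectional curvature at the plane $P$ of the Riemannian metric associated to $X$. Constant flag curvature means that this number is the same constant $\lambda$ for all flags at all points. A Finsler space is called symmetric if $\nabla_{\delta/\delta x^l}R^i_{jkh}=0$ identically on $TM\setminus 0$ for all indices. *)

theory Defs
  imports "HOL-Analysis.Analysis"
begin

subsection \<open>Smooth maps between Euclidean spaces\<close>

primrec Ck_on :: "nat \<Rightarrow> 'a::euclidean_space set \<Rightarrow> ('a \<Rightarrow> 'b::real_normed_vector) \<Rightarrow> bool" where
  "Ck_on 0 S f \<longleftrightarrow> continuous_on S f"
| "Ck_on (Suc k) S f \<longleftrightarrow>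
     (\<forall>x\<in>S. f differentiable (at x)) \<and> (\<forall>v. Ck_on k S (\<lambda>x. frechet_derivative f (at x) v))"

text \<open>To be used for open \<open>S\<close> only.\<close>

definition smooth_on :: "'a::euclidean_space set \<Rightarrow> ('a \<Rightarrow> 'b::real_normed_vector) \<Rightarrow> bool" where
  "smooth_on S f \<longleftrightarrow> (\<forall>k. Ck_on k S f)"

definition pd :: "'n::finite \<Rightarrow> (real^'n \<Rightarrow> real) \<Rightarrow> real^'n \<Rightarrow> real" where
  "pd i f x = deriv (\<lambda>t. f (x + t *\<^sub>R axis i 1)) 0"


subsection \<open>Smooth manifolds\<close>

text \<open>A chart is a pair of a domain and a coordinate map; the values of the coordinate map
  outside the domain are irrelevant. A smooth structure is a maximal atlas, so quantifying over
  its members is quantifying over all local coordinate systems.\<close>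

type_synonym ('m, 'n) chart = "'m set \<times> ('m \<Rightarrow> real^'n)"

abbreviation dom_ch :: "('m, 'n) chart \<Rightarrow> 'm set" where
  "dom_ch c \<equiv> fst c"

abbreviation map_ch :: "('m, 'n) chart \<Rightarrow> 'm \<Rightarrow> real^'n" where
  "map_ch c \<equiv> snd c"

abbreviation img_ch :: "('m, 'n) chart \<Rightarrow> (real^'n) set" where
  "img_ch c \<equiv> map_ch c ` dom_ch c"

abbreviation inv_ch :: "('m, 'n) chart \<Rightarrow> real^'n \<Rightarrow> 'm" where
  "inv_ch c \<equiv> inv_into (dom_ch c) (map_ch c)"

definition is_chart :: "'m topology \<Rightarrow> ('m, 'n::finite) chart \<Rightarrow> bool" where
  "is_chart M c \<longleftrightarrow> openin M (dom_ch c) \<and> open (img_ch c) \<and>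
     homeomorphic_map (subtopology M (dom_ch c)) (top_of_set (img_ch c)) (map_ch c)"

definition compatible :: "('m, 'n::finite) chart \<Rightarrow> ('m, 'n) chart \<Rightarrow> bool" where
  "compatible c d \<longleftrightarrow>
     smooth_on (map_ch c ` (dom_ch c \<inter> dom_ch d)) (map_ch d \<circ> inv_ch c) \<and>
     smooth_on (map_ch d ` (dom_ch c \<inter> dom_ch d)) (map_ch c \<circ> inv_ch d)"

definition smooth_manifold :: "'m topology \<Rightarrow> ('m, 'n::finite) chart set \<Rightarrow> bool" where
  "smooth_manifold M A \<longleftrightarrow>
     Hausdorff_space M \<and> second_countable M \<and>
     (\<forall>c\<in>A. is_chart M c) \<and> (\<Union>c\<in>A. dom_ch c) = topspace M \<and>
     (\<forall>c\<in>A. \<forall>d\<in>A. compatible c d) \<and>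
     (\<forall>c. is_chart M c \<and> (\<forall>d\<in>A. compatible c d) \<longrightarrow> c \<in> A)"

definition smooth_near :: "'m topology \<Rightarrow> ('m, 'n::finite) chart set \<Rightarrow> 'm \<Rightarrow> ('m \<Rightarrow> real) \<Rightarrow> bool" where
  "smooth_near M A p f \<longleftrightarrow>
     (\<exists>V. openin M V \<and> p \<in> V \<and>
        (\<forall>c\<in>A. smooth_on (map_ch c ` (V \<inter> dom_ch c)) (f \<circ> inv_ch c)))"


subsection \<open>Tangent vectors\<close>

text \<open>A tangent vector at \<open>p\<close> is the derivation \<open>y\<^sup>i \<partial>/\<partial>x\<^sup>i\<close> it induces on the functions that are
  smooth near \<open>p\<close>. It is set to 0 on all other functions, so that the derivations obtained from
  different charts agree as soon as they represent the same tangent vector.\<close>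

type_synonym 'm tangent = "('m \<Rightarrow> real) \<Rightarrow> real"

definition tvec :: "'m topology \<Rightarrow> ('m, 'n::finite) chart set \<Rightarrow> ('m, 'n) chart \<Rightarrow> 'm \<Rightarrow> real^'n \<Rightarrow> 'm tangent" where
  "tvec M A c p y =
     (\<lambda>f. if smooth_near M A p f
          then \<Sum>i\<in>UNIV. y $ i * pd i (f \<circ> inv_ch c) (map_ch c p) else 0)"

definition tangent_space :: "'m topology \<Rightarrow> ('m, 'n::finite) chart set \<Rightarrow> 'm \<Rightarrow> 'm tangent set" where
  "tangent_space M A p = {tvec M A c p y | c y. c \<in> A \<and> p \<in> dom_ch c}"

definition comps :: "('m, 'n::finite) chart \<Rightarrow> 'm tangent \<Rightarrow> real^'n" where
  "comps c v = (\<chi> i. v (\<lambda>q. map_ch c q $ i))"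


subsection \<open>Tensor calculus in natural coordinates\<close>

text \<open>Everything below is expressed in the natural coordinates \<open>(x, y)\<close> over one chart, \<open>L\<close>
  being the coordinate expression of the Finsler function. In the components of a tensor the
  upper index is the first argument and the lower indices follow in their order.\<close>

type_synonym 'n scal = "real^'n \<Rightarrow> real^'n \<Rightarrow> real"

definition dx :: "'n::finite \<Rightarrow> 'n scal \<Rightarrow> 'n scal" where
  "dx i f x y = pd i (\<lambda>x'. f x' y) x"

definition dy :: "'n::finite \<Rightarrow> 'n scal \<Rightarrow> 'n scal" where
  "dy i f x y = pd i (f x) y"

definition gmet :: "'n::finite scal \<Rightarrow> 'n \<Rightarrow> 'n \<Rightarrow> 'n scal" where
  "gmet L i j x y = 1/2 * dy i (dy j (\<lambda>x y. (L x y)\<^sup>2)) x y"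

definition ginv :: "'n::finite scal \<Rightarrow> 'n \<Rightarrow> 'n \<Rightarrow> 'n scal" where
  "ginv L i j x y = matrix_inv (\<chi> a b. gmet L a b x y) $ i $ j"

definition Nconn :: "'n::finite scal \<Rightarrow> 'n \<Rightarrow> 'n \<Rightarrow> 'n scal" where
  "Nconn L i m = (\<lambda>x y. 1/4 * dy m (\<lambda>x y.
     \<Sum>s\<in>UNIV. \<Sum>j\<in>UNIV. \<Sum>k\<in>UNIV. ginv L i s x y *
       (dx j (gmet L s k) x y + dx k (gmet L s j) x y - dx s (gmet L k j) x y) * y $ j * y $ k) x y)"

definition hdel :: "'n::finite scal \<Rightarrow> 'n \<Rightarrow> 'n scal \<Rightarrow> 'n scal" where
  "hdel L i f x y = dx i f x y - (\<Sum>m\<in>UNIV. Nconn L m i x y * dy m f x y)"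

definition Gam :: "'n::finite scal \<Rightarrow> 'n \<Rightarrow> 'n \<Rightarrow> 'n \<Rightarrow> 'n scal" where
  "Gam L i j k x y = (\<Sum>s\<in>UNIV. ginv L i s x y / 2 *
     (hdel L k (gmet L s j) x y - hdel L s (gmet L j k) x y + hdel L j (gmet L k s) x y))"

definition hcov12 :: "'n::finite scal \<Rightarrow> ('n \<Rightarrow> 'n \<Rightarrow> 'n \<Rightarrow> 'n scal) \<Rightarrow> 'n \<Rightarrow> 'n \<Rightarrow> 'n \<Rightarrow> 'n \<Rightarrow> 'n scal" where
  \<comment> \<open>\<open>T\<^sup>i\<^sub>j\<^sub>k\<^sub>|\<^sub>h\<close>, the last index \<open>h\<close> being the direction of differentiation\<close>
  "hcov12 L T i j k h x y = hdel L h (T i j k) x y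
     + (\<Sum>m\<in>UNIV. T m j k x y * Gam L i m h x y)
     - (\<Sum>m\<in>UNIV. T i m k x y * Gam L m j h x y)
     - (\<Sum>m\<in>UNIV. T i j m x y * Gam L m k h x y)"

definition hcov13 :: "'n::finite scal \<Rightarrow> ('n \<Rightarrow> 'n \<Rightarrow> 'n \<Rightarrow> 'n \<Rightarrow> 'n scal) \<Rightarrow> 'n \<Rightarrow> 'n \<Rightarrow> 'n \<Rightarrow> 'n \<Rightarrow> 'n \<Rightarrow> 'n scal" where
  \<comment> \<open>\<open>T\<^sup>i\<^sub>j\<^sub>k\<^sub>l\<^sub>|\<^sub>h\<close>\<close>
  "hcov13 L T i j k l h x y = hdel L h (T i j k l) x y
     + (\<Sum>m\<in>UNIV. T m j k l x y * Gam L i m h x y)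
     - (\<Sum>m\<in>UNIV. T i m k l x y * Gam L m j h x y)
     - (\<Sum>m\<in>UNIV. T i j m l x y * Gam L m k h x y)
     - (\<Sum>m\<in>UNIV. T i j k m x y * Gam L m l h x y)"

definition dGam :: "'n::finite scal \<Rightarrow> 'n \<Rightarrow> 'n \<Rightarrow> 'n \<Rightarrow> 'n \<Rightarrow> 'n scal" where
  "dGam L i m p h = dy h (Gam L i m p)"

definition hhcurv :: "'n::finite scal \<Rightarrow> 'n \<Rightarrow> 'n \<Rightarrow> 'n \<Rightarrow> 'n \<Rightarrow> 'n scal" where
  "hhcurv L i j k l x y = hdel L k (Gam L i j l) x y - hdel L l (Gam L i j k) x y
     + (\<Sum>h\<in>UNIV. Gam L i h k x y * Gam L h j l x y)
     - (\<Sum>h\<in>UNIV. Gam L i h l x y * Gam L h j k x y)"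

definition ell :: "'n::finite scal \<Rightarrow> 'n \<Rightarrow> 'n scal" where
  "ell L i x y = y $ i / L x y"

definition Rcurv :: "'n::finite scal \<Rightarrow> 'n \<Rightarrow> 'n \<Rightarrow> 'n \<Rightarrow> 'n scal" where
  "Rcurv L i k l x y = (\<Sum>j\<in>UNIV. ell L j x y * hhcurv L i j k l x y)"

definition Cartan_low :: "'n::finite scal \<Rightarrow> 'n \<Rightarrow> 'n \<Rightarrow> 'n \<Rightarrow> 'n scal" where
  "Cartan_low L i j k x y = L x y / 2 * dy k (gmet L i j) x y"

definition Cartan :: "'n::finite scal \<Rightarrow> 'n \<Rightarrow> 'n \<Rightarrow> 'n \<Rightarrow> 'n scal" where
  "Cartan L i j k x y = (\<Sum>s\<in>UNIV. ginv L i s x y * Cartan_low L s j k x y)"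

definition Adot :: "'n::finite scal \<Rightarrow> 'n \<Rightarrow> 'n \<Rightarrow> 'n \<Rightarrow> 'n scal" where
  "Adot L i j k x y = (\<Sum>s\<in>UNIV. hcov12 L (Cartan L) i j k s x y * ell L s x y)"

definition Dtensor :: "'n::finite scal \<Rightarrow> 'n \<Rightarrow> 'n \<Rightarrow> 'n \<Rightarrow> 'n \<Rightarrow> 'n scal" where
  "Dtensor L i h k l x y = (\<Sum>j\<in>UNIV. y $ j * dy h (\<lambda>x y.
       hcov12 L (Adot L) i j l k x y - hcov12 L (Adot L) i j k l x y
     + (\<Sum>s\<in>UNIV. Adot L s j l x y * Adot L i s k x y)
     - (\<Sum>s\<in>UNIV. Adot L s j k x y * Adot L i s l x y)) x y)"


subsection \<open>Finsler structures\<close>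

definition local_expr :: "'m topology \<Rightarrow> ('m, 'n::finite) chart set \<Rightarrow> ('m \<Rightarrow> 'm tangent \<Rightarrow> real)
    \<Rightarrow> ('m, 'n) chart \<Rightarrow> 'n scal" where
  "local_expr M A F c x y = F (inv_ch c x) (tvec M A c (inv_ch c x) y)"

text \<open>The values of \<open>F p\<close> outside \<open>tangent_space M A p\<close> play no role.\<close>

definition finsler_structure :: "'m topology \<Rightarrow> ('m, 'n::finite) chart set \<Rightarrow> ('m \<Rightarrow> 'm tangent \<Rightarrow> real) \<Rightarrow> bool" where
  "finsler_structure M A F \<longleftrightarrow>
     (\<forall>p\<in>topspace M. \<forall>v\<in>tangent_space M A p. 0 \<le> F p v) \<and>
     (\<forall>p\<in>topspace M. \<forall>v\<in>tangent_space M A p. \<forall>r>0. F p (\<lambda>f. r * v f) = r * F p v) \<and>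
     (\<forall>c\<in>A. smooth_on {(x, y). x \<in> img_ch c \<and> y \<noteq> 0} (\<lambda>(x, y). local_expr M A F c x y)) \<and>
     (\<forall>c\<in>A. \<forall>x\<in>img_ch c. \<forall>y. y \<noteq> 0 \<longrightarrow>
        (\<forall>u. u \<noteq> 0 \<longrightarrow> 0 < (\<Sum>i\<in>UNIV. \<Sum>j\<in>UNIV. gmet (local_expr M A F c) i j x y * u $ i * u $ j)))"

definition finsler_symmetric :: "'m topology \<Rightarrow> ('m, 'n::finite) chart set \<Rightarrow> ('m \<Rightarrow> 'm tangent \<Rightarrow> real) \<Rightarrow> bool" where
  "finsler_symmetric M A F \<longleftrightarrow>
     (\<forall>c\<in>A. \<forall>x\<in>img_ch c. \<forall>y. y \<noteq> 0 \<longrightarrow>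
        (\<forall>i j k h l. hcov13 (local_expr M A F c) (hhcurv (local_expr M A F c)) i j k h l x y = 0))"


subsection \<open>Sectional curvature of a Riemannian metric\<close>

definition christoffel :: "('n \<Rightarrow> 'n \<Rightarrow> real^'n \<Rightarrow> real) \<Rightarrow> 'n::finite \<Rightarrow> 'n \<Rightarrow> 'n \<Rightarrow> real^'n \<Rightarrow> real" where
  "christoffel h i j k x = (\<Sum>s\<in>UNIV. matrix_inv (\<chi> a b. h a b x) $ i $ s / 2 *
     (pd k (h s j) x - pd s (h j k) x + pd j (h k s) x))"

definition riem_curv :: "('n \<Rightarrow> 'n \<Rightarrow> real^'n \<Rightarrow> real) \<Rightarrow> 'n::finite \<Rightarrow> 'n \<Rightarrow> 'n \<Rightarrow> 'n \<Rightarrow> real^'n \<Rightarrow> real" where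
  \<comment> \<open>convention: \<open>R(\<partial>\<^sub>k, \<partial>\<^sub>l) \<partial>\<^sub>j = R\<^sup>i\<^sub>j\<^sub>k\<^sub>l \<partial>\<^sub>i\<close>\<close>
  "riem_curv h i j k l x = pd k (christoffel h i j l) x - pd l (christoffel h i j k) x
     + (\<Sum>m\<in>UNIV. christoffel h i m k x * christoffel h m j l x)
     - (\<Sum>m\<in>UNIV. christoffel h i m l x * christoffel h m j k x)"

definition riem_inner :: "('n \<Rightarrow> 'n \<Rightarrow> real^'n \<Rightarrow> real) \<Rightarrow> real^'n \<Rightarrow> real^'n::finite \<Rightarrow> real^'n \<Rightarrow> real" where
  "riem_inner h x u w = (\<Sum>i\<in>UNIV. \<Sum>j\<in>UNIV. h i j x * u $ i * w $ j)"

definition sec_quot :: "('n \<Rightarrow> 'n \<Rightarrow> real^'n \<Rightarrow> real) \<Rightarrow> real^'n \<Rightarrow> real^'n::finite \<Rightarrow> real^'n \<Rightarrow> real" where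
  \<comment> \<open>\<open>\<langle>R(u,w)w, u\<rangle> / (|u|\<^sup>2|w|\<^sup>2 - \<langle>u,w\<rangle>\<^sup>2)\<close>\<close>
  "sec_quot h x u w =
     riem_inner h x (\<chi> i. \<Sum>j\<in>UNIV. \<Sum>k\<in>UNIV. \<Sum>l\<in>UNIV. riem_curv h i j k l x * w $ j * u $ k * w $ l) u /
     (riem_inner h x u u * riem_inner h x w w - (riem_inner h x u w)\<^sup>2)"

text \<open>The quotient does not depend on the basis \<open>u, w\<close> of the plane \<open>P\<close>.\<close>

definition has_sectional_curvature ::
    "('n \<Rightarrow> 'n \<Rightarrow> real^'n \<Rightarrow> real) \<Rightarrow> real^'n \<Rightarrow> (real^'n::finite) set \<Rightarrow> real \<Rightarrow> bool" where
  "has_sectional_curvature h x P \<kappa> \<longleftrightarrow>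
     (\<forall>u w. u \<noteq> w \<and> independent {u, w} \<and> span {u, w} = P \<longrightarrow> sec_quot h x u w = \<kappa>)"


subsection \<open>Flag curvature\<close>

definition vector_field_on :: "'m topology \<Rightarrow> ('m, 'n::finite) chart set \<Rightarrow> 'm set \<Rightarrow> ('m \<Rightarrow> 'm tangent) \<Rightarrow> bool" where
  "vector_field_on M A V X \<longleftrightarrow>
     (\<forall>p\<in>V. X p \<in> tangent_space M A p) \<and>
     (\<forall>c\<in>A. smooth_on (map_ch c ` (V \<inter> dom_ch c)) (\<lambda>x. comps c (X (inv_ch c x))))"

text \<open>\<open>\<gamma>\<close> is an integral curve of \<open>X\<close> when the derivation \<open>f \<mapsto> (f \<circ> \<gamma>)'(t)\<close>,
  i.e. the velocity of \<open>\<gamma>\<close>, is \<open>X(\<gamma>(t))\<close>.\<close>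

definition integral_curve :: "'m topology \<Rightarrow> ('m, 'n::finite) chart set \<Rightarrow> 'm set \<Rightarrow> ('m \<Rightarrow> 'm tangent)
    \<Rightarrow> real set \<Rightarrow> (real \<Rightarrow> 'm) \<Rightarrow> bool" where
  "integral_curve M A V X I \<gamma> \<longleftrightarrow>
     open I \<and> is_interval I \<and> continuous_map (top_of_set I) M \<gamma> \<and> \<gamma> ` I \<subseteq> V \<and>
     (\<forall>t\<in>I. \<forall>f. smooth_near M A (\<gamma> t) f \<longrightarrow> ((f \<circ> \<gamma>) has_real_derivative X (\<gamma> t) f) (at t))"

text \<open>Geodesics are the (constant speed) solutions of
  \<open>\<gamma>''\<^sup>i + \<Gamma>\<^sup>i\<^sub>j\<^sub>k(\<gamma>, \<gamma>') \<gamma>'\<^sup>j \<gamma>'\<^sup>k = 0\<close>.\<close>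

definition geodesic :: "'m topology \<Rightarrow> ('m, 'n::finite) chart set \<Rightarrow> ('m \<Rightarrow> 'm tangent \<Rightarrow> real)
    \<Rightarrow> real set \<Rightarrow> (real \<Rightarrow> 'm) \<Rightarrow> bool" where
  "geodesic M A F I \<gamma> \<longleftrightarrow>
     open I \<and> is_interval I \<and> continuous_map (top_of_set I) M \<gamma> \<and>
     (\<forall>c\<in>A. \<forall>t\<in>I. \<gamma> t \<in> dom_ch c \<longrightarrow>
        (let z = map_ch c \<circ> \<gamma>; v = (\<lambda>s. vector_derivative z (at s)) in
           z differentiable (at t) \<and> v t \<noteq> 0 \<and>
           (v has_vector_derivative
              (\<chi> i. - (\<Sum>j\<in>UNIV. \<Sum>k\<in>UNIV. Gam (local_expr M A F c) i j k (z t) (v t) * v t $ j * v t $ k)))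
             (at t)))"

definition geodesic_field_on :: "'m topology \<Rightarrow> ('m, 'n::finite) chart set \<Rightarrow> ('m \<Rightarrow> 'm tangent \<Rightarrow> real)
    \<Rightarrow> 'm set \<Rightarrow> ('m \<Rightarrow> 'm tangent) \<Rightarrow> bool" where
  "geodesic_field_on M A F V X \<longleftrightarrow>
     vector_field_on M A V X \<and> (\<forall>p\<in>V. X p \<noteq> (\<lambda>f. 0)) \<and>
     (\<forall>I \<gamma>. integral_curve M A V X I \<gamma> \<longrightarrow> geodesic M A F I \<gamma>)"

definition field_metric :: "'m topology \<Rightarrow> ('m, 'n::finite) chart set \<Rightarrow> ('m \<Rightarrow> 'm tangent \<Rightarrow> real)
    \<Rightarrow> ('m, 'n) chart \<Rightarrow> ('m \<Rightarrow> 'm tangent) \<Rightarrow> 'n \<Rightarrow> 'n \<Rightarrow> real^'n \<Rightarrow> real" where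
  \<comment> \<open>the coordinate expression \<open>g\<^sub>i\<^sub>j(x, X(x))\<close> in the chart \<open>c\<close>\<close>
  "field_metric M A F c X i j x = gmet (local_expr M A F c) i j x (comps c (X (inv_ch c x)))"

text \<open>A flag at \<open>p\<close> is given by the coordinates, in a chart \<open>c\<close> around \<open>p\<close>, of its flagpole
  and of its plane. Geodesic fields extending the flagpole always exist locally, and the
  sectional curvature below does not depend on the choice of one.\<close>

definition has_flag_curvature :: "'m topology \<Rightarrow> ('m, 'n::finite) chart set \<Rightarrow> ('m \<Rightarrow> 'm tangent \<Rightarrow> real)
    \<Rightarrow> ('m, 'n) chart \<Rightarrow> 'm \<Rightarrow> (real^'n) set \<Rightarrow> real^'n \<Rightarrow> real \<Rightarrow> bool" where
  "has_flag_curvature M A F c p P v \<kappa> \<longleftrightarrow>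
     (\<exists>V X. openin M V \<and> p \<in> V \<and> geodesic_field_on M A F V X \<and> X p = tvec M A c p v \<and>
        has_sectional_curvature (field_metric M A F c X) (map_ch c p) P \<kappa>)"

definition constant_flag_curvature :: "'m topology \<Rightarrow> ('m, 'n::finite) chart set \<Rightarrow> ('m \<Rightarrow> 'm tangent \<Rightarrow> real) \<Rightarrow> bool" where
  "constant_flag_curvature M A F \<longleftrightarrow>
     (\<exists>K0. \<forall>c\<in>A. \<forall>p\<in>dom_ch c. \<forall>P v. subspace P \<and> dim P = 2 \<and> v \<in> P \<and> v \<noteq> 0 \<longrightarrow>
        has_flag_curvature M A F c p P v K0)"

end

theory Submission
  imports Defs
begin

text \<open>
  In a chart, write \<open>N\<close> for the nonlinear connection, \<open>R\<close> for the hh-curvature of the Chern connection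
  \<open>\<Gamma>\<close> and \<open>H\<close> for that of the Berwald connection, whose coefficients are the fibre derivatives
  \<open>\<partial>N\<^sup>i\<^sub>j/\<partial>y\<^sup>k\<close>. The proof rests on two facts.

  First, \<open>D = R - H\<close>. The Berwald connection is \<open>\<Gamma> + Adot\<close> (\<open>Adot_eq\<close>), so that the bracket \<open>B\<close> in the
  definition of \<open>D\<close> is exactly \<open>H - R\<close> (\<open>berwald_curv_decomp\<close>). As \<open>y\<^sup>j Adot\<^sup>i\<^sub>j\<^sub>k = 0\<close> and \<open>y\<close> is
  horizontally parallel, \<open>y\<^sup>j B\<^sup>i\<^sub>j\<^sub>k\<^sub>l = 0\<close>; differentiating this by \<open>y\<^sup>h\<close> gives \<open>D = -B\<close> (\<open>Dtensor_eq\<close>).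
  Hence the assumption \<open>\<nabla>D = 0\<close> says that \<open>\<nabla>R = \<nabla>H\<close>.

  Second, constant flag curvature \<open>K\<close> makes \<open>H\<close> parallel. It determines the curvature of
  the nonlinear connection to be \<open>K (\<delta>\<^sup>i\<^sub>k y\<^sub>l - \<delta>\<^sup>i\<^sub>l y\<^sub>k)\<close>, and \<open>H\<close> is the fibre derivative of it, that is
  \<open>H\<^sup>i\<^sub>j\<^sub>k\<^sub>l = K (\<delta>\<^sup>i\<^sub>k g\<^sub>j\<^sub>l - \<delta>\<^sup>i\<^sub>l g\<^sub>j\<^sub>k)\<close>. The metric is horizontally parallel and \<open>K\<close> is a constant, so
  \<open>\<nabla>H = 0\<close> (\<open>hcov13_hhcurv_eq_0\<close>).

  The flag curvature is defined through the Riemannian metric \<open>g(x, X(x))\<close> of a geodesic field \<open>X\<close>. Its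
  Levi-Civita connection contracts with \<open>X\<close> to \<open>N\<close>, and its curvature contracted twice with \<open>X\<close> is
  the Jacobi endomorphism of the Finsler metric (\<open>riem_curv_field_eq_jacobi\<close>). So
  the quadratic form of this endomorphism is known; being self-adjoint, it is determined by that form
  (\<open>jacobi_of_quadratic\<close>), and the Bianchi identity leads from there to the curvature of \<open>N\<close>
  (\<open>curv3_of_jacobi\<close>). Being a geodesic field is a property of integral curves, hence their existence
  has to be established on the way (\<open>picard_local\<close>, \<open>geodesic_field_in_chart\<close>).
\<close>

section \<open>Smooth functions and the symmetry of second derivatives\<close>

lemma frechet_derivative_eqI:
  "(f has_derivative f') (at x) \<Longrightarrow> frechet_derivative f (at x) = f'"
  by (rule frechet_derivative_at[symmetric])

lemma frechet_derivative_cong_on: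
  assumes "open S" "\<And>x. x \<in> S \<Longrightarrow> f x = g x" "x \<in> S"
  shows "frechet_derivative f (at x) = frechet_derivative g (at x)"
proof -
  have "(f has_derivative D) (at x) \<longleftrightarrow> (g has_derivative D) (at x)" for D
    using has_derivative_transform_within_open[OF _ assms(1,3), of f D UNIV g]
      has_derivative_transform_within_open[OF _ assms(1,3), of g D UNIV f] assms(2) by auto
  then show ?thesis by (simp add: frechet_derivative_def)
qed

lemma Ck_on_cong:
  assumes "open S"
  shows "Ck_on k S f \<Longrightarrow> (\<And>x. x \<in> S \<Longrightarrow> f x = g x) \<Longrightarrow> Ck_on k S g"
proof (induction k arbitrary: f g)
  case 0
  have "continuous_on S g \<longleftrightarrow> continuous_on S f"
    by (rule continuous_on_cong[OF refl]) (rule 0(2)[symmetric])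
  then show ?case using 0(1) by simp
next
  case (Suc k)
  have D: "(g has_derivative frechet_derivative f (at x)) (at x)" if "x \<in> S" for x
  proof (rule has_derivative_transform_within_open[OF _ assms that Suc.prems(2)])
    show "(f has_derivative frechet_derivative f (at x)) (at x)"
      using Suc.prems(1) that unfolding Ck_on.simps(2) frechet_derivative_works by blast
  qed
  have "Ck_on k S (\<lambda>x. frechet_derivative g (at x) v)" for v
  proof (rule Suc.IH)
    show "Ck_on k S (\<lambda>x. frechet_derivative f (at x) v)" using Suc.prems by simp
    show "frechet_derivative f (at x) v = frechet_derivative g (at x) v" if "x \<in> S" for x
      using frechet_derivative_eqI[OF D[OF that]] by simp
  qed
  moreover have "g differentiable (at x)" if "x \<in> S" for x
    using D[OF that] by (rule differentiableI)
  ultimately show ?case by simp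
qed

lemma Ck_on_SucI:
  assumes "open S" "\<And>x. x \<in> S \<Longrightarrow> (f has_derivative f' x) (at x)"
    and "\<And>v. Ck_on k S (\<lambda>x. f' x v)"
  shows "Ck_on (Suc k) S f"
proof -
  have "Ck_on k S (\<lambda>x. frechet_derivative f (at x) v)" for v
    by (rule Ck_on_cong[OF assms(1) assms(3)[of v]])
      (simp add: frechet_derivative_eqI[OF assms(2)])
  moreover have "f differentiable (at x)" if "x \<in> S" for x
    using assms(2)[OF that] by (rule differentiableI)
  ultimately show ?thesis by simp
qed

lemma Ck_on_SucD:
  assumes "Ck_on (Suc k) S f"
  shows "x \<in> S \<Longrightarrow> (f has_derivative frechet_derivative f (at x)) (at x)"
    and "Ck_on k S (\<lambda>x. frechet_derivative f (at x) v)"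
  using assms unfolding Ck_on.simps(2) frechet_derivative_works by blast+

lemma Ck_on_Suc_imp: "Ck_on (Suc k) S f \<Longrightarrow> Ck_on k S f"
proof (induction k arbitrary: f)
  case 0
  then show ?case
    by (simp add: continuous_at_imp_continuous_on differentiable_imp_continuous_within)
next
  case (Suc k)
  have "Ck_on k S (\<lambda>x. frechet_derivative f (at x) v)" for v
    by (rule Suc.IH, rule Ck_on_SucD(2)[OF Suc.prems])
  moreover have "\<forall>x\<in>S. f differentiable (at x)"
    using Suc.prems unfolding Ck_on.simps(2) by blast
  ultimately show ?case unfolding Ck_on.simps(2) by blast
qed

lemma Ck_on_const: "Ck_on k S (\<lambda>x. c)"
  by (induction k arbitrary: c) auto

lemma Ck_on_add:
  assumes "open S"
  shows "Ck_on k S f \<Longrightarrow> Ck_on k S g \<Longrightarrow> Ck_on k S (\<lambda>x. f x + g x)"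
proof (induction k arbitrary: f g)
  case 0
  then show ?case by (simp add: continuous_on_add)
next
  case (Suc k)
  note D = Ck_on_SucD[OF Suc.prems(1)] Ck_on_SucD[OF Suc.prems(2)]
  show ?case
    by (rule Ck_on_SucI[OF assms has_derivative_add[OF D(1) D(3)] Suc.IH[OF D(2) D(4)]])
qed

lemma Ck_on_mult:
  fixes f g :: "'a::euclidean_space \<Rightarrow> real"
  assumes "open S"
  shows "Ck_on k S f \<Longrightarrow> Ck_on k S g \<Longrightarrow> Ck_on k S (\<lambda>x. f x * g x)"
proof (induction k arbitrary: f g)
  case 0
  then show ?case by (simp add: continuous_on_mult)
next
  case (Suc k)
  note D = Ck_on_SucD[OF Suc.prems(1)] Ck_on_SucD[OF Suc.prems(2)]
  show ?case
    by (rule Ck_on_SucI[OF assms has_derivative_mult[OF D(1) D(3)]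
        Ck_on_add[OF assms Suc.IH[OF Ck_on_Suc_imp[OF Suc.prems(1)] D(4)]
          Suc.IH[OF D(2) Ck_on_Suc_imp[OF Suc.prems(2)]]]])
qed

lemma Ck_on_inverse:
  fixes f :: "'a::euclidean_space \<Rightarrow> real"
  assumes "open S" "\<And>x. x \<in> S \<Longrightarrow> f x \<noteq> 0"
  shows "Ck_on k S f \<Longrightarrow> Ck_on k S (\<lambda>x. inverse (f x))"
proof (induction k)
  case 0
  then show ?case using assms by (simp add: continuous_on_inverse)
next
  case (Suc k)
  note D = Ck_on_SucD[OF Suc.prems]
  have "Ck_on k S (\<lambda>x. inverse (f x))" by (rule Suc.IH[OF Ck_on_Suc_imp[OF Suc.prems]])
  then have "Ck_on k S (\<lambda>x. (-1) * (inverse (f x) * frechet_derivative f (at x) v * inverse (f x)))" for v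
    by (intro Ck_on_mult assms(1) Ck_on_const D(2))
  then have "Ck_on k S (\<lambda>x. - (inverse (f x) * frechet_derivative f (at x) v * inverse (f x)))" for v
    by simp
  then show ?case
    using Ck_on_SucI[OF assms(1) Deriv.has_derivative_inverse[OF assms(2) D(1)]] by blast
qed

lemma Ck_on_bounded_linear_compose:
  assumes "open S" "bounded_linear h"
  shows "Ck_on k S f \<Longrightarrow> Ck_on k S (\<lambda>x. h (f x))"
proof (induction k arbitrary: f)
  case 0
  then show ?case using assms by (auto intro: bounded_linear.continuous_on)
next
  case (Suc k)
  note D = Ck_on_SucD[OF Suc.prems]
  show ?case
    by (rule Ck_on_SucI[OF assms(1) bounded_linear.has_derivative[OF assms(2) D(1)] Suc.IH[OF D(2)]])
qed

lemma Ck_on_bounded_linear: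
  assumes f: "bounded_linear f"
  shows "Ck_on k S f"
proof (cases k)
  case (Suc j)
  have "frechet_derivative f (at x) = f" for x
    by (rule frechet_derivative_eqI[OF bounded_linear_imp_has_derivative[OF f]])
  then show ?thesis using f Suc by (auto simp: Ck_on_const bounded_linear_imp_differentiable)
qed (use f in \<open>auto intro: linear_continuous_on\<close>)

lemma smooth_on_cong:
  "smooth_on S f \<Longrightarrow> open S \<Longrightarrow> (\<And>x. x \<in> S \<Longrightarrow> f x = g x) \<Longrightarrow> smooth_on S g"
  unfolding smooth_on_def using Ck_on_cong by metis

lemma smooth_on_imp_Ck_on: "smooth_on S f \<Longrightarrow> Ck_on k S f"
  unfolding smooth_on_def by blast

lemma smooth_on_imp_has_derivative:
  "smooth_on S f \<Longrightarrow> x \<in> S \<Longrightarrow> (f has_derivative frechet_derivative f (at x)) (at x)"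
  by (rule Ck_on_SucD(1)[OF smooth_on_imp_Ck_on])

lemma smooth_on_imp_differentiable: "smooth_on S f \<Longrightarrow> x \<in> S \<Longrightarrow> f differentiable (at x)"
  by (rule differentiableI[OF smooth_on_imp_has_derivative])

lemma smooth_on_imp_continuous_on: "smooth_on S f \<Longrightarrow> continuous_on S f"
  using smooth_on_imp_Ck_on[of S f 0] by simp

lemma smooth_on_frechet: "smooth_on S f \<Longrightarrow> smooth_on S (\<lambda>x. frechet_derivative f (at x) v)"
  unfolding smooth_on_def using Ck_on_SucD(2) by blast

lemma smooth_on_const: "smooth_on S (\<lambda>x. c)"
  by (simp add: smooth_on_def Ck_on_const)

lemma smooth_on_add: "open S \<Longrightarrow> smooth_on S f \<Longrightarrow> smooth_on S g \<Longrightarrow> smooth_on S (\<lambda>x. f x + g x)"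
  by (simp add: smooth_on_def Ck_on_add)

lemma smooth_on_mult:
  fixes f g :: "'a::euclidean_space \<Rightarrow> real"
  shows "open S \<Longrightarrow> smooth_on S f \<Longrightarrow> smooth_on S g \<Longrightarrow> smooth_on S (\<lambda>x. f x * g x)"
  by (simp add: smooth_on_def Ck_on_mult)

lemma smooth_on_inverse:
  fixes f :: "'a::euclidean_space \<Rightarrow> real"
  shows "open S \<Longrightarrow> (\<And>x. x \<in> S \<Longrightarrow> f x \<noteq> 0) \<Longrightarrow> smooth_on S f \<Longrightarrow> smooth_on S (\<lambda>x. inverse (f x))"
  by (simp add: smooth_on_def Ck_on_inverse)

lemma smooth_on_bounded_linear: "bounded_linear f \<Longrightarrow> smooth_on S f"
  by (simp add: smooth_on_def Ck_on_bounded_linear)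

lemma smooth_on_bounded_linear_compose:
  "open S \<Longrightarrow> bounded_linear h \<Longrightarrow> smooth_on S f \<Longrightarrow> smooth_on S (\<lambda>x. h (f x))"
  by (simp add: smooth_on_def Ck_on_bounded_linear_compose)

text \<open>Two applications of the one-dimensional mean value theorem turn the mixed second difference
  of \<open>f\<close> over a parallelogram into a mixed second derivative at some point of it. The difference is
  symmetric in \<open>u\<close> and \<open>v\<close>, the derivative is taken first along \<open>u\<close> and then along \<open>v\<close>; this is
  the source of the symmetry of second derivatives.\<close>

lemma second_difference_mean_value:
  fixes f :: "'a::euclidean_space \<Rightarrow> real"
  assumes sm: "smooth_on S f" and "h > 0"
    and sub: "\<And>s t. 0 \<le> s \<Longrightarrow> s \<le> h \<Longrightarrow> 0 \<le> t \<Longrightarrow> t \<le> h \<Longrightarrow> x + s *\<^sub>R u + t *\<^sub>R v \<in> S"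
  shows "\<exists>s t. 0 \<le> s \<and> s \<le> h \<and> 0 \<le> t \<and> t \<le> h \<and>
    f (x + h *\<^sub>R u + h *\<^sub>R v) - f (x + h *\<^sub>R u) - f (x + h *\<^sub>R v) + f x
    = h * h * frechet_derivative (\<lambda>z. frechet_derivative f (at z) u) (at (x + s *\<^sub>R u + t *\<^sub>R v)) v"
proof -
  let ?D = "\<lambda>z. frechet_derivative f (at z) u"
  have arc: "a + h *\<^sub>R v + b = a + b + h *\<^sub>R v" for a b :: 'a by (simp add: add_ac)
  note hd = smooth_on_imp_has_derivative
  have line: "((\<lambda>s. x0 + s *\<^sub>R w) has_derivative (\<lambda>c. c *\<^sub>R w)) (at s0)" for x0 w :: 'a and s0
    by (auto intro!: derivative_eq_intros)
  have chain: "((\<lambda>s. g (x0 + s *\<^sub>R w)) has_derivative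
      (\<lambda>c. frechet_derivative g (at (x0 + s0 *\<^sub>R w)) (c *\<^sub>R w))) (at s0)"
    if "smooth_on S g" "x0 + s0 *\<^sub>R w \<in> S" for g :: "'a \<Rightarrow> real" and x0 w s0
    using has_derivative_compose[OF line hd[OF that]] .
  have lin: "frechet_derivative g (at z) (c *\<^sub>R w) = c * frechet_derivative g (at z) w"
    if "smooth_on S g" "z \<in> S" for g :: "'a \<Rightarrow> real" and z w c
    using linear_frechet_derivative[OF smooth_on_imp_differentiable[OF that]]
    by (simp add: linear_cmul)
  define \<phi> where "\<phi> s = f (x + s *\<^sub>R u + h *\<^sub>R v) - f (x + s *\<^sub>R u)" for s
  have d1: "(\<phi> has_derivative (\<lambda>c. c * (?D (x + s *\<^sub>R u + h *\<^sub>R v) - ?D (x + s *\<^sub>R u)))) (at s)"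
    if "0 \<le> s" "s \<le> h" for s
  proof -
    have m: "x + s *\<^sub>R u + h *\<^sub>R v \<in> S" "x + s *\<^sub>R u \<in> S"
      using sub[of s h] sub[of s 0] that assms by auto
    have 1: "((\<lambda>s. f (x + s *\<^sub>R u + h *\<^sub>R v)) has_derivative
        (\<lambda>c. frechet_derivative f (at (x + s *\<^sub>R u + h *\<^sub>R v)) (c *\<^sub>R u))) (at s)"
      using chain[OF sm, of "x + h *\<^sub>R v" s u] m(1) by (simp only: arc)
    have 2: "((\<lambda>s. f (x + s *\<^sub>R u)) has_derivative
        (\<lambda>c. frechet_derivative f (at (x + s *\<^sub>R u)) (c *\<^sub>R u))) (at s)"
      by (rule chain[OF sm m(2)])
    show ?thesis unfolding \<phi>_def
      using has_derivative_diff[OF 1 2] by (simp add: lin[OF sm] m right_diff_distrib)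
  qed
  have "\<exists>s\<in>{0<..<h}. \<phi> h - \<phi> 0 = (h - 0) * (?D (x + s *\<^sub>R u + h *\<^sub>R v) - ?D (x + s *\<^sub>R u))"
    by (rule mvt_simple[OF assms(2)], rule has_derivative_at_withinI[OF d1]) auto
  then obtain s where s: "0 < s" "s < h"
    "\<phi> h - \<phi> 0 = h * (?D (x + s *\<^sub>R u + h *\<^sub>R v) - ?D (x + s *\<^sub>R u))" by auto
  define \<psi> where "\<psi> t = ?D (x + s *\<^sub>R u + t *\<^sub>R v)" for t
  note smD = smooth_on_frechet[OF sm, of u]
  have d2: "(\<psi> has_derivative (\<lambda>c. c * frechet_derivative ?D (at (x + s *\<^sub>R u + t *\<^sub>R v)) v)) (at t)"
    if "0 \<le> t" "t \<le> h" for t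
  proof -
    have m: "x + s *\<^sub>R u + t *\<^sub>R v \<in> S" using sub s that by simp
    have "((\<lambda>t. ?D (x + s *\<^sub>R u + t *\<^sub>R v)) has_derivative
        (\<lambda>c. frechet_derivative ?D (at (x + s *\<^sub>R u + t *\<^sub>R v)) (c *\<^sub>R v))) (at t)"
      by (rule chain[OF smD m])
    then show ?thesis unfolding \<psi>_def by (simp add: lin[OF smD] m)
  qed
  have "\<exists>t\<in>{0<..<h}. \<psi> h - \<psi> 0 = (h - 0) * frechet_derivative ?D (at (x + s *\<^sub>R u + t *\<^sub>R v)) v"
    by (rule mvt_simple[OF assms(2)], rule has_derivative_at_withinI[OF d2]) auto
  then obtain t where t: "0 < t" "t < h"
    "\<psi> h - \<psi> 0 = h * frechet_derivative ?D (at (x + s *\<^sub>R u + t *\<^sub>R v)) v" by auto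
  show ?thesis using s t unfolding \<phi>_def \<psi>_def
    by (intro exI[of _ s] exI[of _ t]) (auto simp: algebra_simps)
qed

text \<open>If the two mixed derivatives differed at \<open>x\<close>, they would by continuity stay apart on a small
  parallelogram; but each of them attains the same value, the mixed second difference divided by
  the squared side, somewhere on it.\<close>

lemma frechet_derivative_commute:
  fixes f :: "'a::euclidean_space \<Rightarrow> real"
  assumes "open S" and sm: "smooth_on S f" and "x \<in> S"
  shows "frechet_derivative (\<lambda>z. frechet_derivative f (at z) u) (at x) v
       = frechet_derivative (\<lambda>z. frechet_derivative f (at z) v) (at x) u" (is "?A x = ?B x")
proof (rule ccontr)
  assume ne: "?A x \<noteq> ?B x"
  define e where "e = dist (?A x) (?B x) / 2"
  have e: "e > 0" using ne by (simp add: e_def)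
  have arc: "a + b + c = a + c + b" for a b c :: 'a by (simp add: add_ac)
  have cont: "isCont ?A x" "isCont ?B x"
    using smooth_on_imp_continuous_on[OF smooth_on_frechet[OF smooth_on_frechet[OF sm]]] assms
    by (auto simp: continuous_on_eq_continuous_at)
  obtain d1 where d1: "d1 > 0" "\<And>z. dist z x < d1 \<Longrightarrow> dist (?A z) (?A x) < e"
    using cont(1) e unfolding continuous_at_eps_delta by blast
  obtain d2 where d2: "d2 > 0" "\<And>z. dist z x < d2 \<Longrightarrow> dist (?B z) (?B x) < e"
    using cont(2) e unfolding continuous_at_eps_delta by blast
  obtain r where r: "r > 0" "ball x r \<subseteq> S" using assms open_contains_ball by metis
  define m where "m = min r (min d1 d2)"
  define h where "h = m / (2 * (norm u + norm v + 1))"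
  have m: "m > 0" using d1(1) d2(1) r by (simp add: m_def)
  have c: "2 * (norm u + norm v + 1) > 0" by (simp add: add_nonneg_pos)
  have h: "h > 0" using m c unfolding h_def by (rule divide_pos_pos)
  have near: "dist (x + s *\<^sub>R u + t *\<^sub>R v) x < m" if "0 \<le> s" "s \<le> h" "0 \<le> t" "t \<le> h" for s t
  proof -
    have "dist (x + s *\<^sub>R u + t *\<^sub>R v) x = norm (s *\<^sub>R u + t *\<^sub>R v)"
      by (simp add: dist_norm add.assoc)
    also have "\<dots> \<le> s * norm u + t * norm v"
      using that norm_triangle_ineq[of "s *\<^sub>R u" "t *\<^sub>R v"] by simp
    also have "\<dots> \<le> h * norm u + h * norm v"
      using that by (intro add_mono mult_right_mono) auto
    also have "\<dots> < h * (2 * (norm u + norm v + 1))"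
      using mult_strict_left_mono[OF _ h, of "norm u + norm v" "2 * (norm u + norm v + 1)"]
        norm_ge_zero[of u] norm_ge_zero[of v] by (simp add: distrib_left)
    also have "\<dots> = m" unfolding h_def using c by simp
    finally show ?thesis .
  qed
  have inS: "x + s *\<^sub>R u + t *\<^sub>R v \<in> S" if "0 \<le> s" "s \<le> h" "0 \<le> t" "t \<le> h" for s t
    using near[OF that] r by (auto simp: m_def dist_commute)
  have inS': "x + s *\<^sub>R v + t *\<^sub>R u \<in> S" if "0 \<le> s" "s \<le> h" "0 \<le> t" "t \<le> h" for s t
    unfolding arc[of x "s *\<^sub>R v"] using that by (intro inS)
  define \<Delta> where "\<Delta> = f (x + h *\<^sub>R u + h *\<^sub>R v) - f (x + h *\<^sub>R u) - f (x + h *\<^sub>R v) + f x"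
  have "\<exists>s t. 0 \<le> s \<and> s \<le> h \<and> 0 \<le> t \<and> t \<le> h \<and> \<Delta> = h * h * ?A (x + s *\<^sub>R u + t *\<^sub>R v)"
    unfolding \<Delta>_def by (rule second_difference_mean_value[OF sm h inS])
  then obtain s t where 1: "0 \<le> s" "s \<le> h" "0 \<le> t" "t \<le> h" "\<Delta> = h * h * ?A (x + s *\<^sub>R u + t *\<^sub>R v)"
    by (elim exE conjE)
  have hh: "x + h *\<^sub>R u + h *\<^sub>R v = x + h *\<^sub>R v + h *\<^sub>R u" by (rule arc) 
  have \<Delta>': "\<Delta> = f (x + h *\<^sub>R v + h *\<^sub>R u) - f (x + h *\<^sub>R v) - f (x + h *\<^sub>R u) + f x"
    unfolding \<Delta>_def hh by simp
  have "\<exists>s t. 0 \<le> s \<and> s \<le> h \<and> 0 \<le> t \<and> t \<le> h \<and> \<Delta> = h * h * ?B (x + s *\<^sub>R v + t *\<^sub>R u)"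
    unfolding \<Delta>' by (rule second_difference_mean_value[OF sm h inS'])
  then obtain s' t' where 2: "0 \<le> s'" "s' \<le> h" "0 \<le> t'" "t' \<le> h" "\<Delta> = h * h * ?B (x + s' *\<^sub>R v + t' *\<^sub>R u)"
    by (elim exE conjE)
  have sw: "x + s' *\<^sub>R v + t' *\<^sub>R u = x + t' *\<^sub>R u + s' *\<^sub>R v"
    by (rule arc)
  have eq: "?A (x + s *\<^sub>R u + t *\<^sub>R v) = ?B (x + t' *\<^sub>R u + s' *\<^sub>R v)"
    using 1(5) 2(5) h unfolding sw by simp
  have "dist (?A (x + s *\<^sub>R u + t *\<^sub>R v)) (?A x) < e"
    by (rule d1(2)) (use near[OF 1(1-4)] in \<open>simp add: m_def\<close>)
  moreover have "dist (?A (x + s *\<^sub>R u + t *\<^sub>R v)) (?B x) < e"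
    unfolding eq by (rule d2(2)) (use near[OF 2(3,4,1,2)] in \<open>simp add: m_def\<close>)
  moreover have "dist (?A x) (?B x) = 2 * e" by (simp only: e_def)
  moreover note dist_triangle3[of "?A x" "?B x" "?A (x + s *\<^sub>R u + t *\<^sub>R v)"]
  ultimately show False by linarith
qed

section \<open>Differentiation of scalars on phase space\<close>

definition smooth_scal :: "((real^'n::finite) \<times> (real^'n)) set \<Rightarrow> 'n scal \<Rightarrow> bool" where
  "smooth_scal U f \<longleftrightarrow> smooth_on U (\<lambda>(x, y). f x y)"

text \<open>The operators \<open>dx i\<close>, \<open>dy i\<close> and \<open>hdel L i\<close> all differentiate along a vector field \<open>V\<close> on phase
  space. The predicate isolates this common feature, so that linearity, the product rule and locality
  are derived once. It says nothing about functions that are not smooth on \<open>U\<close>.\<close>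

definition directional :: "((real^'n::finite) \<times> (real^'n)) set \<Rightarrow> ('n scal \<Rightarrow> 'n scal) \<Rightarrow>
    (real^'n \<Rightarrow> real^'n \<Rightarrow> (real^'n) \<times> (real^'n)) \<Rightarrow> bool" where
  "directional U D V \<longleftrightarrow> (\<forall>f x y. smooth_scal U f \<longrightarrow> (x, y) \<in> U \<longrightarrow>
     D f x y = frechet_derivative (\<lambda>(x, y). f x y) (at (x, y)) (V x y))"

text \<open>The partial derivatives \<open>pd\<close>, and with them \<open>dx\<close> and \<open>dy\<close>, are defined by one-variable
  derivatives along lines. For smooth functions they are values of the total derivative, for which the
  calculus is available.\<close>

lemma deriv_along_line:
  fixes f :: "'a::euclidean_space \<Rightarrow> real"
  assumes "smooth_on S f" "p \<in> S"
  shows "deriv (\<lambda>t. f (p + t *\<^sub>R v)) 0 = frechet_derivative f (at p) v"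
proof -
  have line: "((\<lambda>t. p + t *\<^sub>R v) has_derivative (\<lambda>c. c *\<^sub>R v)) (at 0)"
    by (auto intro!: derivative_eq_intros)
  have p: "(f has_derivative frechet_derivative f (at p)) (at (p + 0 *\<^sub>R v))"
    using smooth_on_imp_has_derivative[OF assms] by simp
  have "((\<lambda>t. f (p + t *\<^sub>R v)) has_derivative (\<lambda>c. frechet_derivative f (at p) (c *\<^sub>R v))) (at 0)"
    using has_derivative_compose[OF line p] .
  also have "(\<lambda>c. frechet_derivative f (at p) (c *\<^sub>R v)) = (\<lambda>c. frechet_derivative f (at p) v * c)"
    using linear_frechet_derivative[OF smooth_on_imp_differentiable[OF assms]]
    by (auto simp: linear_cmul)
  finally have "((\<lambda>t. f (p + t *\<^sub>R v)) has_field_derivative frechet_derivative f (at p) v) (at 0)"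
    by (simp add: has_field_derivative_def)
  then show ?thesis by (rule DERIV_imp_deriv)
qed

lemma directional_dx:
  fixes i :: "'n::finite"
  shows "directional U (dx i) (\<lambda>x y. (axis i 1, 0))"
  unfolding directional_def smooth_scal_def
proof (intro allI impI)
  fix f :: "'n scal" and x y assume f: "smooth_on U (\<lambda>(x, y). f x y)" "(x, y) \<in> U"
  show "dx i f x y = frechet_derivative (\<lambda>(x, y). f x y) (at (x, y)) (axis i 1, 0)"
    using deriv_along_line[OF f, of "(axis i 1, 0)"] by (simp add: dx_def pd_def)
qed

lemma directional_dy:
  fixes i :: "'n::finite"
  shows "directional U (dy i) (\<lambda>x y. (0, axis i 1))"
  unfolding directional_def smooth_scal_def
proof (intro allI impI)
  fix f :: "'n scal" and x y assume f: "smooth_on U (\<lambda>(x, y). f x y)" "(x, y) \<in> U"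
  show "dy i f x y = frechet_derivative (\<lambda>(x, y). f x y) (at (x, y)) (0, axis i 1)"
    using deriv_along_line[OF f, of "(0, axis i 1)"] by (simp add: dy_def pd_def)
qed

lemma directional_hdel:
  fixes i :: "'n::finite"
  shows "directional U (hdel L i) (\<lambda>x y. (axis i 1, - (\<Sum>m\<in>UNIV. Nconn L m i x y *\<^sub>R axis m 1)))"
  unfolding directional_def
proof (intro allI impI)
  fix f :: "'n scal" and x y assume f: "smooth_scal U f" "(x, y) \<in> U"
  let ?f' = "frechet_derivative (\<lambda>(x, y). f x y) (at (x, y))"
  have lin: "linear ?f'"
    using f by (intro linear_frechet_derivative smooth_on_imp_differentiable[of U])
      (auto simp: smooth_scal_def)
  have eq: "(axis i 1, - (\<Sum>m\<in>UNIV. Nconn L m i x y *\<^sub>R axis m 1)) =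
      (axis i 1, 0) - (\<Sum>m\<in>UNIV. Nconn L m i x y *\<^sub>R (0, axis m 1))"
    by (auto simp: prod_eq_iff fst_sum snd_sum)
  have "?f' (axis i 1, - (\<Sum>m\<in>UNIV. Nconn L m i x y *\<^sub>R axis m 1)) =
      ?f' (axis i 1, 0) - (\<Sum>m\<in>UNIV. Nconn L m i x y * ?f' (0, axis m 1))"
    unfolding eq by (simp only: linear_diff[OF lin] linear_sum[OF lin] linear_cmul[OF lin] real_scaleR_def)
  then show "hdel L i f x y = ?f' (axis i 1, - (\<Sum>m\<in>UNIV. Nconn L m i x y *\<^sub>R axis m 1))"
    using f directional_dx[of U i] directional_dy[of U] by (simp add: hdel_def directional_def)
qed

locale phase_domain =
  fixes U :: "((real^'n::finite) \<times> (real^'n)) set"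
  assumes open_U: "open U"
begin

abbreviation sm :: "'n scal \<Rightarrow> bool" where "sm \<equiv> smooth_scal U"

lemma sm_cong: "sm f \<Longrightarrow> (\<And>x y. (x, y) \<in> U \<Longrightarrow> f x y = g x y) \<Longrightarrow> sm g"
  unfolding smooth_scal_def by (erule smooth_on_cong[OF _ open_U]) auto

lemma sm_const [simp, intro]: "sm (\<lambda>x y. c)"
  by (simp add: smooth_scal_def split_def smooth_on_const)

lemma sm_add [simp, intro]: "sm f \<Longrightarrow> sm g \<Longrightarrow> sm (\<lambda>x y. f x y + g x y)"
  using smooth_on_add[OF open_U] by (auto simp: smooth_scal_def split_def)

lemma sm_mult [simp, intro]: "sm f \<Longrightarrow> sm g \<Longrightarrow> sm (\<lambda>x y. f x y * g x y)"
  using smooth_on_mult[OF open_U] by (auto simp: smooth_scal_def split_def)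

lemma sm_minus [simp, intro]: "sm f \<Longrightarrow> sm (\<lambda>x y. - f x y)"
  using sm_mult[OF sm_const[of "-1"], of f] by simp

lemma sm_diff [simp, intro]: "sm f \<Longrightarrow> sm g \<Longrightarrow> sm (\<lambda>x y. f x y - g x y)"
  using sm_add[of f "\<lambda>x y. - g x y"] by auto

lemma sm_divide_const [simp, intro]: "sm f \<Longrightarrow> sm (\<lambda>x y. f x y / c)"
  using sm_mult[OF _ sm_const[of "inverse c"], of f] by (simp add: field_simps)

lemma sm_inverse:
  assumes "sm f" "\<And>x y. (x, y) \<in> U \<Longrightarrow> f x y \<noteq> 0"
  shows "sm (\<lambda>x y. inverse (f x y))"
  using smooth_on_inverse[OF open_U, of "\<lambda>(x, y). f x y"] assms
  by (auto simp: smooth_scal_def split_def)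

lemma sm_divide:
  assumes "sm f" "sm g" "\<And>x y. (x, y) \<in> U \<Longrightarrow> g x y \<noteq> 0"
  shows "sm (\<lambda>x y. f x y / g x y)"
  using sm_mult[OF assms(1) sm_inverse[OF assms(2,3)]] by (simp add: field_simps)

lemma sm_power2 [simp, intro]: "sm f \<Longrightarrow> sm (\<lambda>x y. (f x y)\<^sup>2)"
  by (simp add: power2_eq_square)

lemma sm_sum [simp, intro]:
  assumes "\<And>k. k \<in> A \<Longrightarrow> sm (f k)"
  shows "sm (\<lambda>x y. \<Sum>k\<in>A. f k x y)"
  using assms
proof (induction A rule: infinite_finite_induct)
  case (insert a A)
  then show ?case using sm_add[of "f a" "\<lambda>x y. \<Sum>k\<in>A. f k x y"] by simp
qed auto

lemma sm_prod:
  assumes "\<And>k. k \<in> A \<Longrightarrow> sm (f k)"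
  shows "sm (\<lambda>x y. \<Prod>k\<in>A. f k x y)"
  using assms
proof (induction A rule: infinite_finite_induct)
  case (insert a A)
  then show ?case using sm_mult[of "f a" "\<lambda>x y. \<Prod>k\<in>A. f k x y"] by simp
qed auto

lemma sm_fibre_coord [simp, intro]: "sm (\<lambda>x y. y $ k)"
  unfolding smooth_scal_def split_def
  by (intro smooth_on_bounded_linear bounded_linear_compose[OF bounded_linear_vec_nth bounded_linear_snd])

lemma sm_directional_const:
  assumes "directional U D (\<lambda>x y. v)" "sm f"
  shows "sm (D f)"
  unfolding smooth_scal_def
  by (rule smooth_on_cong[OF smooth_on_frechet[OF assms(2)[unfolded smooth_scal_def], of v] open_U])
    (use assms in \<open>auto simp: directional_def\<close>)

lemmas sm_dx [simp, intro] = sm_directional_const[OF directional_dx]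
lemmas sm_dy [simp, intro] = sm_directional_const[OF directional_dy]

context
  fixes D :: "'n scal \<Rightarrow> 'n scal" and V
  assumes D: "directional U D V"
begin

lemma directional_has_derivative:
  assumes "sm f" "(x, y) \<in> U"
  shows "((\<lambda>(x, y). f x y) has_derivative frechet_derivative (\<lambda>(x, y). f x y) (at (x, y))) (at (x, y))"
  using smooth_on_imp_has_derivative assms unfolding smooth_scal_def by blast

lemma directional_eqI:
  assumes "sm f" "(x, y) \<in> U" "((\<lambda>(x, y). f x y) has_derivative f') (at (x, y))"
  shows "D f x y = f' (V x y)"
  using D assms by (simp add: directional_def frechet_derivative_eqI)

lemma directional_cong:
  assumes "sm f" "\<And>x y. (x, y) \<in> U \<Longrightarrow> f x y = g x y" "(x, y) \<in> U"
  shows "D f x y = D g x y"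
proof -
  have "frechet_derivative (\<lambda>(x, y). f x y) (at (x, y)) = frechet_derivative (\<lambda>(x, y). g x y) (at (x, y))"
    using assms by (intro frechet_derivative_cong_on[OF open_U]) auto
  then show ?thesis using D assms sm_cong[OF assms(1,2)] by (simp add: directional_def)
qed

lemma directional_const:
  assumes "(x, y) \<in> U"
  shows "D (\<lambda>x y. c) x y = 0"
  using directional_eqI[OF sm_const assms, of c "\<lambda>_. 0"] by (simp add: split_def)

lemma directional_add:
  assumes "sm f" "sm g" "(x, y) \<in> U"
  shows "D (\<lambda>x y. f x y + g x y) x y = D f x y + D g x y"
  using directional_eqI[OF sm_add[OF assms(1,2)] assms(3)]
    has_derivative_add[OF directional_has_derivative[OF assms(1,3)] directional_has_derivative[OF assms(2,3)]]
    D assms by (auto simp: directional_def split_def)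

lemma directional_mult:
  assumes "sm f" "sm g" "(x, y) \<in> U"
  shows "D (\<lambda>x y. f x y * g x y) x y = D f x y * g x y + f x y * D g x y"
  using directional_eqI[OF sm_mult[OF assms(1,2)] assms(3)]
    has_derivative_mult[OF directional_has_derivative[OF assms(1,3)] directional_has_derivative[OF assms(2,3)]]
    D assms by (auto simp: directional_def split_def)

lemma directional_minus:
  assumes "sm f" "(x, y) \<in> U"
  shows "D (\<lambda>x y. - f x y) x y = - D f x y"
  using directional_mult[OF sm_const[of "-1"] assms] directional_const[OF assms(2)] by simp

lemma directional_diff:
  assumes "sm f" "sm g" "(x, y) \<in> U"
  shows "D (\<lambda>x y. f x y - g x y) x y = D f x y - D g x y"
  using directional_add[OF assms(1) sm_minus[OF assms(2)] assms(3)] directional_minus[OF assms(2,3)] by simp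

lemma directional_divide_const:
  assumes "sm f" "(x, y) \<in> U"
  shows "D (\<lambda>x y. f x y / c) x y = D f x y / c"
  using directional_mult[OF sm_const[of "inverse c"] assms] directional_const[OF assms(2)]
  by (simp add: field_simps)

lemma directional_sum:
  assumes "\<And>k. k \<in> A \<Longrightarrow> sm (f k)" "(x, y) \<in> U"
  shows "D (\<lambda>x y. \<Sum>k\<in>A. f k x y) x y = (\<Sum>k\<in>A. D (f k) x y)"
  using assms(1)
proof (induction A rule: infinite_finite_induct)
  case (insert a A)
  then show ?case using directional_add[of "f a" "\<lambda>x y. \<Sum>k\<in>A. f k x y", OF _ _ assms(2)] by auto
qed (auto simp: directional_const[OF assms(2)])

lemma directional_fibre_coord:
  assumes "(x, y) \<in> U"
  shows "D (\<lambda>x y. y $ k) x y = snd (V x y) $ k"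
  using directional_eqI[OF sm_fibre_coord assms, of k "\<lambda>v. snd v $ k"]
  by (auto simp: split_def intro!: bounded_linear_imp_has_derivative
      bounded_linear_compose[OF bounded_linear_vec_nth bounded_linear_snd])

end

lemmas directional_rules = directional_const directional_add directional_mult directional_minus
  directional_diff directional_divide_const directional_sum

lemmas dx_rules [simp] = directional_rules[OF directional_dx]
lemmas dy_rules [simp] = directional_rules[OF directional_dy]
lemmas hdel_rules [simp] = directional_rules[OF directional_hdel]
lemmas dx_cong = directional_cong[OF directional_dx]
lemmas dy_cong = directional_cong[OF directional_dy]
lemmas hdel_cong = directional_cong[OF directional_hdel]

lemma dx_fibre_coord [simp]: "(x, y) \<in> U \<Longrightarrow> dx i (\<lambda>x y. y $ k) x y = 0"
  by (simp add: directional_fibre_coord[OF directional_dx])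

lemma dy_fibre_coord [simp]: "(x, y) \<in> U \<Longrightarrow> dy i (\<lambda>x y. y $ k) x y = (if i = k then 1 else 0)"
  by (simp add: directional_fibre_coord[OF directional_dy] axis_def)

lemma hdel_fibre_coord [simp]: "(x, y) \<in> U \<Longrightarrow> hdel L i (\<lambda>x y. y $ k) x y = - Nconn L k i x y"
  by (simp add: hdel_def if_distrib cong: if_cong)

text \<open>For two constant directions only: \<open>hdel L k\<close> and \<open>hdel L l\<close> differentiate along variable
  directions, and their commutator is the curvature of the nonlinear connection.\<close>

lemma directional_commute:
  assumes D: "directional U D (\<lambda>x y. v)" and E: "directional U E (\<lambda>x y. w)"
    and f: "sm f" and xy: "(x, y) \<in> U"
  shows "D (E f) x y = E (D f) x y"
proof -
  let ?f = "\<lambda>(x, y). f x y"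
  have 1: "frechet_derivative (\<lambda>(x, y). E f x y) (at (x, y)) = 
      frechet_derivative (\<lambda>p. frechet_derivative ?f (at p) w) (at (x, y))"
    using E f xy by (intro frechet_derivative_cong_on[OF open_U]) (auto simp: directional_def)
  have 2: "frechet_derivative (\<lambda>(x, y). D f x y) (at (x, y)) = 
      frechet_derivative (\<lambda>p. frechet_derivative ?f (at p) v) (at (x, y))"
    using D f xy by (intro frechet_derivative_cong_on[OF open_U]) (auto simp: directional_def)
  have "D (E f) x y = frechet_derivative (\<lambda>(x, y). E f x y) (at (x, y)) v"
    using D sm_directional_const[OF E f] xy by (simp add: directional_def)
  also have "\<dots> = frechet_derivative (\<lambda>(x, y). D f x y) (at (x, y)) w"
    unfolding 1 2 using f xy
    by (intro frechet_derivative_commute[OF open_U]) (auto simp: smooth_scal_def)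
  also have "\<dots> = E (D f) x y"
    using E sm_directional_const[OF D f] xy by (simp add: directional_def)
  finally show ?thesis .
qed

lemmas dx_dx = directional_commute[OF directional_dx directional_dx]
lemmas dx_dy = directional_commute[OF directional_dx directional_dy]
lemmas dy_dy = directional_commute[OF directional_dy directional_dy]

end

section \<open>Homogeneity, the spray and the nonlinear connection\<close>

text \<open>The coordinate expression of a Finsler function over one chart with image \<open>W\<close>. All tensor
  identities below are local and only use these properties.\<close>

locale finsler_chart =
  fixes L :: "'n::finite scal" and W :: "(real^'n) set"
  assumes open_W: "open W"
    and smooth_L: "smooth_on {(x, y). x \<in> W \<and> y \<noteq> 0} (\<lambda>(x, y). L x y)"
    and homogeneous_L: "\<And>x y r. x \<in> W \<Longrightarrow> y \<noteq> 0 \<Longrightarrow> r > 0 \<Longrightarrow> L x (r *\<^sub>R y) = r * L x y"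
    and gmet_pos: "\<And>x y u. x \<in> W \<Longrightarrow> y \<noteq> 0 \<Longrightarrow> u \<noteq> 0 \<Longrightarrow>
        0 < (\<Sum>i\<in>UNIV. \<Sum>j\<in>UNIV. gmet L i j x y * u $ i * u $ j)"
begin

definition U :: "((real^'n) \<times> (real^'n)) set" where "U = {(x, y). x \<in> W \<and> y \<noteq> 0}"

lemma mem_U: "(x, y) \<in> U \<longleftrightarrow> x \<in> W \<and> y \<noteq> 0"
  by (simp add: U_def)

sublocale phase_domain U
proof
  have "U = W \<times> (- {0})" by (auto simp: U_def)
  moreover have "open (- {0 :: real^'n})" by (simp add: open_Compl)
  ultimately show "open U" using open_W by (simp add: open_Times del: open_delete)
qed

abbreviation energy :: "'n scal" where "energy \<equiv> \<lambda>x y. (L x y)\<^sup>2"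

text \<open>The covector \<open>y\<^sub>i = g\<^sub>i\<^sub>j y\<^sup>j\<close>, introduced as half the fibre derivative of \<open>L\<^sup>2\<close> so that its
  homogeneity and \<open>\<partial>y\<^sub>j/\<partial>y\<^sup>i = g\<^sub>i\<^sub>j\<close> come for free.\<close>

definition ylow :: "'n \<Rightarrow> 'n scal" where
  "ylow i x y = 1/2 * dy i energy x y"

lemma sm_L [simp]: "sm L"
  using smooth_L by (simp add: smooth_scal_def U_def)

lemma ylow_eq: "ylow i = (\<lambda>x y. 1/2 * dy i energy x y)"
  by (intro ext) (simp add: ylow_def)

lemma gmet_eq: "gmet L i j = (\<lambda>x y. 1/2 * dy i (dy j energy) x y)"
  by (intro ext) (simp add: gmet_def)

lemma sm_ylow [simp]: "sm (ylow i)" by (simp add: ylow_eq)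

lemma sm_gmet [simp]: "sm (gmet L i j)" by (simp add: gmet_eq)

lemma gmet_sym: "(x, y) \<in> U \<Longrightarrow> gmet L i j x y = gmet L j i x y"
  by (simp add: gmet_def dy_dy[of energy])

lemma dy_ylow: "(x, y) \<in> U \<Longrightarrow> dy i (ylow j) x y = gmet L i j x y"
  by (simp add: ylow_eq gmet_def)

lemma dy_gmet_sym: 
  assumes "(x, y) \<in> U" 
  shows "dy k (gmet L i j) x y = dy i (gmet L k j) x y" "dy k (gmet L i j) x y = dy k (gmet L j i) x y"
proof -
  show "dy k (gmet L i j) x y = dy i (gmet L k j) x y"
    using assms by (simp add: gmet_eq dy_dy[of "dy j energy" _ _ k i])
  show "dy k (gmet L i j) x y = dy k (gmet L j i) x y"
    by (rule dy_cong) (use assms gmet_sym in auto)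
qed

lemma dx_gmet_sym:
  assumes "(x, y) \<in> U" 
  shows "dx k (gmet L i j) x y = dx k (gmet L j i) x y"
  by (rule dx_cong) (use assms gmet_sym in auto)

lemma hdel_gmet_sym:
  assumes "(x, y) \<in> U" 
  shows "hdel L k (gmet L i j) x y = hdel L k (gmet L j i) x y"
  by (rule hdel_cong) (use assms gmet_sym in auto)

text \<open>Positive homogeneity of degree \<open>d\<close> in \<open>y\<close> in the infinitesimal form of Euler's relation. In this
  form it passes to derivatives and products by mere calculation.\<close>

definition homog :: "real \<Rightarrow> 'n scal \<Rightarrow> bool" where
  "homog d f \<longleftrightarrow> sm f \<and> (\<forall>(x, y)\<in>U. (\<Sum>k\<in>UNIV. y $ k * dy k f x y) = d * f x y)"

lemma homogD: "homog d f \<Longrightarrow> (x, y) \<in> U \<Longrightarrow> (\<Sum>k\<in>UNIV. y $ k * dy k f x y) = d * f x y"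
  by (auto simp: homog_def)

lemma homog_dy:
  assumes "homog d f"
  shows "homog (d - 1) (dy j f)"
  unfolding homog_def
proof (intro conjI ballI, goal_cases)
  have [simp]: "sm f" using assms by (simp add: homog_def)
  case 1 show ?case by simp
  case (2 p)
  then obtain x y where p: "p = (x, y)" and xy: "(x, y) \<in> U" by (cases p) auto
  have "dy j (\<lambda>x y. \<Sum>k\<in>UNIV. y $ k * dy k f x y) x y = dy j (\<lambda>x y. d * f x y) x y"
    by (rule dy_cong) (use xy homogD[OF assms] in auto)
  moreover have "dy j (\<lambda>x y. \<Sum>k\<in>UNIV. y $ k * dy k f x y) x y
      = dy j f x y + (\<Sum>k\<in>UNIV. y $ k * dy k (dy j f) x y)"
    using xy by (simp add: sum.distrib dy_dy[of f _ _ j] if_distrib[where f="\<lambda>c. c * _"] cong: if_cong)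
  ultimately show ?case unfolding p using xy by (simp add: algebra_simps)
qed

lemma homog_dx:
  assumes "homog d f"
  shows "homog d (dx j f)"
  unfolding homog_def
proof (intro conjI ballI, goal_cases)
  have [simp]: "sm f" using assms by (simp add: homog_def)
  case 1 show ?case by simp
  case (2 p)
  then obtain x y where p: "p = (x, y)" and xy: "(x, y) \<in> U" by (cases p) auto
  have "dx j (\<lambda>x y. \<Sum>k\<in>UNIV. y $ k * dy k f x y) x y = dx j (\<lambda>x y. d * f x y) x y"
    by (rule dx_cong) (use xy homogD[OF assms] in auto)
  moreover have "dx j (\<lambda>x y. \<Sum>k\<in>UNIV. y $ k * dy k f x y) x y
      = (\<Sum>k\<in>UNIV. y $ k * dy k (dx j f) x y)"
    using xy by (simp add: dx_dy[of f _ _ j])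
  ultimately show ?case unfolding p using xy by simp
qed

lemma homog_mult:
  assumes "homog d f" "homog e h"
  shows "homog (d + e) (\<lambda>x y. f x y * h x y)"
  unfolding homog_def
proof (intro conjI ballI, goal_cases)
  have [simp]: "sm f" "sm h" using assms by (auto simp: homog_def)
  case 1 show ?case by simp
  case (2 p)
  then obtain x y where p: "p = (x, y)" and xy: "(x, y) \<in> U" by (cases p) auto
  have "(\<Sum>k\<in>UNIV. y $ k * dy k (\<lambda>x y. f x y * h x y) x y)
      = (\<Sum>k\<in>UNIV. y $ k * dy k f x y) * h x y + f x y * (\<Sum>k\<in>UNIV. y $ k * dy k h x y)"
    using xy by (simp add: sum.distrib algebra_simps sum_distrib_left)
  then show ?case unfolding p using homogD[OF assms(1) xy] homogD[OF assms(2) xy]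
    by (simp add: algebra_simps)
qed

lemma homog_diff:
  assumes "homog d f" "homog d h"
  shows "homog d (\<lambda>x y. f x y - h x y)"
proof -
  have "sm f" "sm h" using assms by (auto simp: homog_def)
  then show ?thesis
    unfolding homog_def using homogD[OF assms(1)] homogD[OF assms(2)]
    by (auto simp: right_diff_distrib sum_subtractf)
qed

lemma homog_sum:
  assumes "\<And>k. homog d (f k)"
  shows "homog d (\<lambda>x y. \<Sum>k\<in>A. f k x y)"
proof -
  have [simp]: "sm (f k)" for k using assms by (simp add: homog_def)
  have "(\<Sum>k\<in>UNIV. y $ k * (\<Sum>m\<in>A. dy k (f m) x y)) = d * (\<Sum>k\<in>A. f k x y)" if "(x, y) \<in> U" for x y
    unfolding sum_distrib_left using homogD[OF assms that] by (subst sum.swap) simp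
  then show ?thesis by (auto simp: homog_def)
qed

lemma homog_const: "homog 0 (\<lambda>x y. c)"
  by (auto simp: homog_def)

lemma homog_fibre_coord: "homog 1 (\<lambda>x y. y $ k)"
  by (auto simp: homog_def if_distrib cong: if_cong)

lemma homog_energy: "homog 2 energy"
  unfolding homog_def
proof (intro conjI ballI, goal_cases)
  case 1 show ?case by simp
  case (2 p)
  then obtain x y where p: "p = (x, y)" and xy: "(x, y) \<in> U" by (cases p) auto
  have E: "smooth_on U (\<lambda>(x, y). energy x y)"
    using sm_power2[OF sm_L] by (simp add: smooth_scal_def)
  let ?f' = "frechet_derivative (\<lambda>(x, y). energy x y) (at (x, y))"
  have lin: "linear ?f'" by (intro linear_frechet_derivative smooth_on_imp_differentiable[OF E xy])
  have "deriv (\<lambda>t. energy x (y + t *\<^sub>R y)) 0 = ?f' (0, y)"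
    using deriv_along_line[OF E xy, of "(0, y)"] by simp
  also have "(0, y) = (\<Sum>k\<in>UNIV. y $ k *\<^sub>R (0 :: real^'n, axis k 1))"
    by (auto simp: prod_eq_iff fst_sum snd_sum vec_eq_iff axis_def if_distrib cong: if_cong)
  also have "?f' \<dots> = (\<Sum>k\<in>UNIV. y $ k * dy k energy x y)"
    using directional_dy[of U] xy E
    by (simp add: linear_sum[OF lin] linear_cmul[OF lin] directional_def smooth_scal_def del: scaleR_Pair)
  finally have 1: "deriv (\<lambda>t. energy x (y + t *\<^sub>R y)) 0 = (\<Sum>k\<in>UNIV. y $ k * dy k energy x y)" .
  have "((\<lambda>t. (1 + t)\<^sup>2 * energy x y) has_field_derivative 2 * energy x y) (at 0)"
    by (auto intro!: derivative_eq_intros)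
  moreover have "energy x (y + t *\<^sub>R y) = (1 + t)\<^sup>2 * energy x y" if "t \<in> {-1<..}" for t
    using homogeneous_L[of x y "1 + t"] xy that by (auto simp: mem_U power_mult_distrib scaleR_add_left)
  ultimately have "((\<lambda>t. energy x (y + t *\<^sub>R y)) has_field_derivative 2 * energy x y) (at 0)"
    using has_field_derivative_transform_within_open[of "\<lambda>t. (1 + t)\<^sup>2 * energy x y" "2 * energy x y" 0 "{-1<..}"]
    by auto
  with 1 show ?case unfolding p by (simp add: DERIV_imp_deriv)
qed

lemma homog_ylow: "homog 1 (ylow i)"
  using homog_mult[OF homog_const[of "1/2"] homog_dy[OF homog_energy]] by (simp add: ylow_eq)

lemma homog_gmet: "homog 0 (gmet L i j)"
  using homog_mult[OF homog_const[of "1/2"] homog_dy[OF homog_dy[OF homog_energy]]] by (simp add: gmet_eq)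

lemma gmet_radial: 
  assumes "(x, y) \<in> U"
  shows "(\<Sum>j\<in>UNIV. gmet L i j x y * y $ j) = ylow i x y"
    "(\<Sum>j\<in>UNIV. gmet L j i x y * y $ j) = ylow i x y"
proof -
  show *: "(\<Sum>j\<in>UNIV. gmet L j i x y * y $ j) = ylow i x y"
    using homogD[OF homog_ylow assms, of i] assms by (simp add: dy_ylow mult.commute)
  show "(\<Sum>j\<in>UNIV. gmet L i j x y * y $ j) = ylow i x y"
    using * by (simp only: gmet_sym[OF assms, of i])
qed

lemma dy_gmet_radial:
  assumes "(x, y) \<in> U"
  shows "(\<Sum>k\<in>UNIV. y $ k * dy k (gmet L i j) x y) = 0"
    "(\<Sum>k\<in>UNIV. y $ k * dy i (gmet L k j) x y) = 0"
    "(\<Sum>k\<in>UNIV. y $ k * dy i (gmet L j k) x y) = 0"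
proof -
  show *: "(\<Sum>k\<in>UNIV. y $ k * dy k (gmet L i j) x y) = 0" for i j
    using homogD[OF homog_gmet assms] by simp
  show **: "(\<Sum>k\<in>UNIV. y $ k * dy i (gmet L k j) x y) = 0" for i j
    using *[of i j] by (simp only: dy_gmet_sym(1)[OF assms, of _ i j])
  show "(\<Sum>k\<in>UNIV. y $ k * dy i (gmet L j k) x y) = 0"
    using **[of i j] by (simp only: dy_gmet_sym(2)[OF assms, of i _ j])
qed

lemma ylow_radial:
  assumes "(x, y) \<in> U"
  shows "(\<Sum>i\<in>UNIV. ylow i x y * y $ i) = energy x y"
  using homogD[OF homog_energy assms] assms by (simp add: ylow_def sum_divide_distrib[symmetric] mult.commute)

lemma energy_pos:
  assumes "(x, y) \<in> U"
  shows "energy x y > 0"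
proof -
  have "energy x y = (\<Sum>i\<in>UNIV. \<Sum>j\<in>UNIV. gmet L i j x y * y $ i * y $ j)"
    unfolding ylow_radial[OF assms, symmetric] gmet_radial(1)[OF assms, symmetric]
    by (simp add: sum_distrib_left sum_distrib_right mult_ac)
  then show ?thesis using gmet_pos[of x y y] assms by (simp add: mem_U)
qed

lemma L_nonzero: "(x, y) \<in> U \<Longrightarrow> L x y \<noteq> 0"
  using energy_pos by fastforce

text \<open>Two vectors agree if their lowered components do, because the metric is positive definite. Identities
  between tensors with an upper index are proved by lowering that index first.\<close>

lemma gmet_cancel:
  assumes xy: "(x, y) \<in> U"
    and "\<And>p. (\<Sum>i\<in>UNIV. gmet L p i x y * a i) = (\<Sum>i\<in>UNIV. gmet L p i x y * b i)"
  shows "a i = b i"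
proof (rule ccontr)
  assume ne: "a i \<noteq> b i"
  let ?u = "\<chi> i. a i - b i"
  have "?u $ i \<noteq> 0" using ne by simp
  then have "?u \<noteq> 0" by (metis zero_index)
  then have "0 < (\<Sum>p\<in>UNIV. \<Sum>i\<in>UNIV. gmet L p i x y * ?u $ p * ?u $ i)"
    using gmet_pos[of x y ?u] xy by (simp add: mem_U)
  also have "\<dots> = (\<Sum>p\<in>UNIV. ?u $ p * ((\<Sum>i\<in>UNIV. gmet L p i x y * a i) - (\<Sum>i\<in>UNIV. gmet L p i x y * b i)))"
    by (simp add: sum_distrib_left right_diff_distrib sum_subtractf[symmetric] algebra_simps)
  also have "\<dots> = 0" by (simp add: assms(2))
  finally show False by simp
qed

lemma gmet_matrix_invertible:
  assumes xy: "(x, y) \<in> U"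
  shows "invertible (\<chi> a b. gmet L a b x y)"
proof -
  have "v = 0" if "(\<chi> a b. gmet L a b x y) *v v = 0" for v
  proof -
    have "(\<Sum>i\<in>UNIV. gmet L p i x y * v $ i) = (\<Sum>i\<in>UNIV. gmet L p i x y * 0)" for p
      using arg_cong[OF that, of "\<lambda>w. w $ p"] by (simp add: matrix_vector_mult_def)
    from gmet_cancel[OF xy this] show ?thesis by (simp add: vec_eq_iff)
  qed
  then show ?thesis
    by (simp add: invertible_left_inverse matrix_left_invertible_ker)
qed

lemma gmet_ginv:
  assumes xy: "(x, y) \<in> U"
  shows "(\<Sum>i\<in>UNIV. gmet L p i x y * ginv L i s x y) = (if p = s then 1 else 0)"
    "(\<Sum>i\<in>UNIV. ginv L p i x y * gmet L i s x y) = (if p = s then 1 else 0)"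
proof -
  let ?G = "\<chi> a b. gmet L a b x y"
  have inv: "?G ** matrix_inv ?G = mat 1" "matrix_inv ?G ** ?G = mat 1"
    using someI_ex[OF gmet_matrix_invertible[OF xy, unfolded invertible_def]]
    by (simp_all add: matrix_inv_def)
  show "(\<Sum>i\<in>UNIV. gmet L p i x y * ginv L i s x y) = (if p = s then 1 else 0)"
    using arg_cong[OF inv(1), of "\<lambda>A. A $ p $ s"] by (simp add: matrix_matrix_mult_def mat_def ginv_def)
  show "(\<Sum>i\<in>UNIV. ginv L p i x y * gmet L i s x y) = (if p = s then 1 else 0)"
    using arg_cong[OF inv(2), of "\<lambda>A. A $ p $ s"] by (simp add: matrix_matrix_mult_def mat_def ginv_def)
qed

lemma lower_ginv:
  assumes xy: "(x, y) \<in> U"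
  shows "(\<Sum>i\<in>UNIV. gmet L p i x y * (\<Sum>s\<in>UNIV. ginv L i s x y * a s)) = a p"
proof -
  have "(\<Sum>i\<in>UNIV. gmet L p i x y * (\<Sum>s\<in>UNIV. ginv L i s x y * a s))
      = (\<Sum>s\<in>UNIV. (\<Sum>i\<in>UNIV. gmet L p i x y * ginv L i s x y) * a s)"
    unfolding sum_distrib_left sum_distrib_right mult.assoc by (rule sum.swap)
  then show ?thesis by (simp add: gmet_ginv[OF xy] if_distrib[where f="\<lambda>c. c * _"] cong: if_cong)
qed

lemma sm_det:
  assumes "\<And>i j. sm (\<lambda>x y. M i j x y)"
  shows "sm (\<lambda>x y. det (\<chi> i j. M i j x y))"
  unfolding det_def by (intro sm_sum sm_mult sm_const sm_prod) (simp add: assms)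

text \<open>By Cramer's rule the entries of the inverse matrix are quotients of determinants, hence of
  polynomials in the entries of the metric.\<close>

lemma sm_ginv [simp]: "sm (ginv L i s)"
proof (rule sm_cong)
  let ?G = "\<lambda>x y. \<chi> a b. gmet L a b x y"
  let ?B = "\<lambda>x y. \<chi> a b. (if b = i then if a = s then 1 else 0 else gmet L a b x y)"
  have nz: "det (?G x y) \<noteq> 0" if "(x, y) \<in> U" for x y
    using gmet_matrix_invertible[OF that] by (simp add: invertible_det_nz)
  have "sm (\<lambda>x y. if b = i then if a = s then 1 else 0 else gmet L a b x y)" for a b
    by (cases "b = i") auto
  then show "sm (\<lambda>x y. det (?B x y) / det (?G x y))"
    using nz by (intro sm_divide sm_det) auto
  show "det (?B x y) / det (?G x y) = ginv L i s x y" if xy: "(x, y) \<in> U" for x y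
  proof -
    have "?G x y *v (\<chi> k. ginv L k s x y) = axis s 1"
      using gmet_ginv(1)[OF xy] by (simp add: vec_eq_iff matrix_vector_mult_def axis_def)
    then have "ginv L i s x y = det (\<chi> a b. if b = i then axis s 1 $ a else ?G x y $ a $ b) / det (?G x y)"
      using cramer[OF nz[OF xy], of "\<chi> k. ginv L k s x y" "axis s 1"] by (simp add: vec_eq_iff)
    also have "(\<chi> a b. if b = i then axis s 1 $ a else ?G x y $ a $ b) = ?B x y"
      by (simp add: vec_eq_iff axis_def)
    finally show ?thesis by simp
  qed
qed

definition spray_low :: "'n \<Rightarrow> 'n scal" where
  "spray_low s x y = (\<Sum>j\<in>UNIV. \<Sum>k\<in>UNIV.
     (dx j (gmet L s k) x y + dx k (gmet L s j) x y - dx s (gmet L k j) x y) * y $ j * y $ k)"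

text \<open>The spray coefficients, normalised such that \<open>N\<^sup>i\<^sub>m = 1/4 \<partial>S\<^sup>i/\<partial>y\<^sup>m\<close>.\<close>

definition spray :: "'n \<Rightarrow> 'n scal" where
  "spray i x y = (\<Sum>s\<in>UNIV. ginv L i s x y * spray_low s x y)"

lemma Nconn_spray: "Nconn L i m = (\<lambda>x y. 1/4 * dy m (spray i) x y)"
  unfolding Nconn_def spray_def[abs_def] spray_low_def
  by (simp add: sum_distrib_left mult.assoc)

lemma sm_spray_low [simp]: "sm (spray_low s)"
  unfolding spray_low_def[abs_def] by simp

lemma sm_spray [simp]: "sm (spray i)"
  unfolding spray_def[abs_def] by simp

lemma sm_Nconn [simp]: "sm (Nconn L i m)"
  unfolding Nconn_spray by simp

lemma sm_hdel [simp]: "sm f \<Longrightarrow> sm (hdel L i f)"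
  unfolding hdel_def[abs_def] by simp

lemma sm_Gam [simp]: "sm (Gam L i j k)"
  unfolding Gam_def[abs_def] by simp

text \<open>Euler's relations contract the derivatives of the metric with \<open>y\<close> to derivatives of \<open>y\<^sub>s\<close> and of
  \<open>L\<^sup>2\<close>; this is the Euler-Lagrange form of the geodesic equation.\<close>

lemma spray_low_eq:
  assumes "(x, y) \<in> U"
  shows "spray_low s x y = 2 * (\<Sum>j\<in>UNIV. y $ j * dx j (ylow s) x y) - dx s energy x y"
proof -
  have 1: "dx j (ylow s) x y = (\<Sum>k\<in>UNIV. dx j (gmet L s k) x y * y $ k)" for j s
  proof -
    have "dx j (ylow s) x y = dx j (\<lambda>x y. \<Sum>k\<in>UNIV. gmet L s k x y * y $ k) x y"
      by (rule dx_cong) (use assms gmet_radial in auto)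
    then show ?thesis using assms by simp
  qed
  have "dx s energy x y = dx s (\<lambda>x y. \<Sum>j\<in>UNIV. ylow j x y * y $ j) x y"
    by (rule dx_cong) (use assms ylow_radial in auto)
  also have "\<dots> = (\<Sum>j\<in>UNIV. \<Sum>k\<in>UNIV. dx s (gmet L k j) x y * y $ j * y $ k)"
    using assms unfolding dx_gmet_sym[OF assms, of _ _] 
    by (simp add: 1 sum_distrib_right dx_gmet_sym[OF assms, of s _ ] sum_distrib_left mult_ac)
  finally have 2: "dx s energy x y = (\<Sum>j\<in>UNIV. \<Sum>k\<in>UNIV. dx s (gmet L k j) x y * y $ j * y $ k)" .
  have 3: "(\<Sum>j\<in>UNIV. \<Sum>k\<in>UNIV. dx j (gmet L s k) x y * y $ j * y $ k) = (\<Sum>j\<in>UNIV. y $ j * dx j (ylow s) x y)"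
    by (simp add: 1 sum_distrib_left mult_ac)
  have 4: "(\<Sum>j\<in>UNIV. \<Sum>k\<in>UNIV. dx k (gmet L s j) x y * y $ j * y $ k) = (\<Sum>j\<in>UNIV. y $ j * dx j (ylow s) x y)"
    unfolding 3[symmetric] by (subst sum.swap) (simp add: mult_ac)
  show ?thesis
    by (simp add: spray_low_def left_diff_distrib distrib_right sum.distrib sum_subtractf 2 3 4)
qed

lemma homog_spray_low: "homog 2 (spray_low s)"
proof -
  have "homog 2 (\<lambda>x y. 2 * (\<Sum>j\<in>UNIV. y $ j * dx j (ylow s) x y) - dx s energy x y)"
  proof (rule homog_diff[OF _ homog_dx[OF homog_energy]])
    show "homog 2 (\<lambda>x y. 2 * (\<Sum>j\<in>UNIV. y $ j * dx j (ylow s) x y))"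
      using homog_mult[OF homog_const[of 2] homog_sum[OF homog_mult[OF homog_fibre_coord homog_dx[OF homog_ylow]]],
        of "\<lambda>j. j" "\<lambda>j. j" "\<lambda>_. s" UNIV] by simp
  qed
  then have h: "(\<Sum>k\<in>UNIV. y $ k * dy k (\<lambda>x y. 2 * (\<Sum>j\<in>UNIV. y $ j * dx j (ylow s) x y) - dx s energy x y) x y)
      = 2 * spray_low s x y" if "(x, y) \<in> U" for x y
    unfolding spray_low_eq[OF that] using that by (rule homogD)
  have "dy k (spray_low s) x y = dy k (\<lambda>x y. 2 * (\<Sum>j\<in>UNIV. y $ j * dx j (ylow s) x y) - dx s energy x y) x y"
    if "(x, y) \<in> U" for k x y
    by (rule dy_cong) (use that spray_low_eq in auto)
  with h show ?thesis by (auto simp: homog_def)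
qed

lemma dy_spray_low:
  assumes xy: "(x, y) \<in> U"
  shows "dy m (spray_low p) x y = 2 * dx m (ylow p) x y + 2 * (\<Sum>j\<in>UNIV. y $ j * dx j (gmet L m p) x y)
    - 2 * dx p (ylow m) x y"
proof -
  have 1: "dy m (dx j (ylow p)) x y = dx j (gmet L m p) x y" for j
  proof -
    have "dy m (dx j (ylow p)) x y = dx j (dy m (ylow p)) x y" using xy by (simp add: dx_dy)
    also have "\<dots> = dx j (gmet L m p) x y" by (rule dx_cong) (use xy dy_ylow in auto)
    finally show ?thesis .
  qed
  have 2: "dy m (dx p energy) x y = 2 * dx p (ylow m) x y"
    using xy by (simp add: dx_dy[symmetric] ylow_eq)
  have "dy m (spray_low p) x y = dy m (\<lambda>x y. 2 * (\<Sum>j\<in>UNIV. y $ j * dx j (ylow p) x y) - dx p energy x y) x y"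
    by (rule dy_cong) (use xy spray_low_eq in auto)
  also have "\<dots> = 2 * dx m (ylow p) x y + 2 * (\<Sum>j\<in>UNIV. y $ j * dx j (gmet L m p) x y) - 2 * dx p (ylow m) x y"
    using xy by (simp add: 1 2 sum.distrib if_distrib[where f="\<lambda>c. c * _"] cong: if_cong)
  finally show ?thesis .
qed

lemma lower_spray:
  "(x, y) \<in> U \<Longrightarrow> (\<Sum>i\<in>UNIV. gmet L p i x y * spray i x y) = spray_low p x y"
  unfolding spray_def by (rule lower_ginv)

lemma lower_dy_spray:
  assumes xy: "(x, y) \<in> U"
  shows "(\<Sum>i\<in>UNIV. gmet L p i x y * dy m (spray i) x y)
    = dy m (spray_low p) x y - (\<Sum>i\<in>UNIV. dy m (gmet L p i) x y * spray i x y)"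
proof -
  have "dy m (spray_low p) x y = dy m (\<lambda>x y. \<Sum>i\<in>UNIV. gmet L p i x y * spray i x y) x y"
    by (rule dy_cong) (use xy lower_spray in auto)
  then show ?thesis using xy by (simp add: sum.distrib)
qed

lemma homog_spray: "homog 2 (spray i)"
proof -
  have "(\<Sum>k\<in>UNIV. y $ k * dy k (spray i) x y) = 2 * spray i x y" if xy: "(x, y) \<in> U" for x y
  proof (rule gmet_cancel[OF xy])
    fix p
    have "(\<Sum>i\<in>UNIV. gmet L p i x y * (\<Sum>k\<in>UNIV. y $ k * dy k (spray i) x y))
        = (\<Sum>k\<in>UNIV. y $ k * (\<Sum>i\<in>UNIV. gmet L p i x y * dy k (spray i) x y))"
      unfolding sum_distrib_left by (subst sum.swap) (simp add: mult_ac)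
    also have "\<dots> = 2 * spray_low p x y - (\<Sum>k\<in>UNIV. y $ k * (\<Sum>i\<in>UNIV. dy k (gmet L p i) x y * spray i x y))"
      using homogD[OF homog_spray_low xy] by (simp add: lower_dy_spray[OF xy] right_diff_distrib sum_subtractf)
    also have "(\<Sum>k\<in>UNIV. y $ k * (\<Sum>i\<in>UNIV. dy k (gmet L p i) x y * spray i x y))
        = (\<Sum>i\<in>UNIV. (\<Sum>k\<in>UNIV. y $ k * dy k (gmet L p i) x y) * spray i x y)"
      unfolding sum_distrib_left sum_distrib_right by (subst sum.swap) (simp add: mult_ac)
    also have "\<dots> = 0" by (simp add: dy_gmet_radial[OF xy])
    finally show "(\<Sum>i\<in>UNIV. gmet L p i x y * (\<Sum>k\<in>UNIV. y $ k * dy k (spray i) x y))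
        = (\<Sum>i\<in>UNIV. gmet L p i x y * (2 * spray i x y))"
      using lower_spray[OF xy, of p] by (simp add: sum_distrib_left mult.left_commute flip: sum_distrib_left)
  qed
  then show ?thesis by (auto simp: homog_def)
qed

lemma Nconn_radial:
  "(x, y) \<in> U \<Longrightarrow> (\<Sum>m\<in>UNIV. y $ m * Nconn L i m x y) = 1/2 * spray i x y"
  using homogD[OF homog_spray, of x y i] by (simp add: Nconn_spray sum_divide_distrib[symmetric])

lemma homog_Nconn: "homog 1 (Nconn L i m)"
  unfolding Nconn_spray using homog_mult[OF homog_const[of "1/4"] homog_dy[OF homog_spray]] by simp

lemma lower_Gam:
  assumes xy: "(x, y) \<in> U"
  shows "(\<Sum>i\<in>UNIV. gmet L p i x y * Gam L i j k x y)
    = 1/2 * (hdel L k (gmet L p j) x y - hdel L p (gmet L j k) x y + hdel L j (gmet L k p) x y)"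
  unfolding Gam_def using lower_ginv[OF xy, of p "\<lambda>s. 1/2 * (hdel L k (gmet L s j) x y - hdel L s (gmet L j k) x y + hdel L j (gmet L k s) x y)"]
  by simp

lemma Gam_sym: "(x, y) \<in> U \<Longrightarrow> Gam L i j k x y = Gam L i k j x y"
  unfolding Gam_def by (intro sum.cong refl arg_cong2[of _ _ _ _ "(*)"])
    (auto simp: hdel_gmet_sym[of x y _ j k] hdel_gmet_sym[of x y j _ k] hdel_gmet_sym[of x y k j])

text \<open>The link between the two descriptions of the nonlinear connection: by the fibre derivative of the
  spray and by contracting the Chern connection with \<open>y\<close>. Both sides are computed after lowering the
  index. The terms with \<open>\<partial>g/\<partial>y\<close> agree because \<open>y\<^sup>j N\<^sup>k\<^sub>j = 1/2 S\<^sup>k\<close> and \<open>\<partial>g/\<partial>y\<close> is totally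
  symmetric and annihilates \<open>y\<close>.\<close>

lemma Nconn_eq_Gam:
  assumes xy: "(x, y) \<in> U"
  shows "Nconn L i m x y = (\<Sum>j\<in>UNIV. Gam L i m j x y * y $ j)"
proof (rule gmet_cancel[of x y "\<lambda>i. Nconn L i m x y" "\<lambda>i. \<Sum>j\<in>UNIV. Gam L i m j x y * y $ j", OF xy])
  fix p
  have rad: "(\<Sum>j\<in>UNIV. dx m (gmet L p j) x y * y $ j) = dx m (ylow p) x y" for m p
  proof -
    have "dx m (ylow p) x y = dx m (\<lambda>x y. \<Sum>k\<in>UNIV. gmet L p k x y * y $ k) x y"
      by (rule dx_cong) (use xy gmet_radial in auto)
    then show ?thesis using xy by simp
  qed
  have hrad: "(\<Sum>j\<in>UNIV. hdel L m (gmet L p j) x y * y $ j) = dx m (ylow p) x y" for m p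
  proof -
    have "(\<Sum>j\<in>UNIV. hdel L m (gmet L p j) x y * y $ j) = dx m (ylow p) x y 
       - (\<Sum>j\<in>UNIV. \<Sum>k\<in>UNIV. Nconn L k m x y * dy k (gmet L p j) x y * y $ j)"
      by (simp add: hdel_def left_diff_distrib sum_subtractf rad sum_distrib_right)
    also have "(\<Sum>j\<in>UNIV. \<Sum>k\<in>UNIV. Nconn L k m x y * dy k (gmet L p j) x y * y $ j) = 
        (\<Sum>k\<in>UNIV. Nconn L k m x y * (\<Sum>j\<in>UNIV. y $ j * dy k (gmet L p j) x y))"
      unfolding sum_distrib_left by (subst sum.swap) (simp add: mult_ac)
    also have "\<dots> = 0" by (simp add: dy_gmet_radial[OF xy])
    finally show ?thesis by simp
  qed
  have trans: "(\<Sum>j\<in>UNIV. hdel L j (gmet L p m) x y * y $ j)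
      = (\<Sum>j\<in>UNIV. y $ j * dx j (gmet L m p) x y) - 1/2 * (\<Sum>k\<in>UNIV. dy m (gmet L p k) x y * spray k x y)"
  proof -
    have "(\<Sum>j\<in>UNIV. \<Sum>k\<in>UNIV. y $ j * (Nconn L k j x y * dy k (gmet L p m) x y))
        = (\<Sum>k\<in>UNIV. (\<Sum>j\<in>UNIV. y $ j * Nconn L k j x y) * dy k (gmet L p m) x y)"
      unfolding sum_distrib_right by (subst sum.swap) (simp add: mult_ac)
    then have "(\<Sum>j\<in>UNIV. hdel L j (gmet L p m) x y * y $ j)
      = (\<Sum>j\<in>UNIV. y $ j * dx j (gmet L p m) x y) - (\<Sum>k\<in>UNIV. (\<Sum>j\<in>UNIV. y $ j * Nconn L k j x y) * dy k (gmet L p m) x y)"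
      by (simp add: hdel_def left_diff_distrib right_diff_distrib sum_subtractf sum_distrib_right sum_distrib_left mult_ac)
    then show ?thesis
      by (simp add: Nconn_radial[OF xy] dx_gmet_sym[OF xy, of _ p m] dy_gmet_sym(1)[OF xy, of _ p m]
          dy_gmet_sym(1)[OF xy, of m p] sum_divide_distrib mult.commute dy_gmet_sym(2)[OF xy, of p m])
  qed
  have "(\<Sum>i\<in>UNIV. gmet L p i x y * (\<Sum>j\<in>UNIV. Gam L i m j x y * y $ j))
      = (\<Sum>j\<in>UNIV. (\<Sum>i\<in>UNIV. gmet L p i x y * Gam L i m j x y) * y $ j)"
    unfolding sum_distrib_left sum_distrib_right by (subst sum.swap) (simp add: mult_ac)
  also have "\<dots> = 1/2 * ((\<Sum>j\<in>UNIV. hdel L j (gmet L p m) x y * y $ j) - (\<Sum>j\<in>UNIV. hdel L p (gmet L m j) x y * y $ j)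
      + (\<Sum>j\<in>UNIV. hdel L m (gmet L p j) x y * y $ j))"
    by (simp add: lower_Gam[OF xy] hdel_gmet_sym[OF xy, of m _ p] sum_divide_distrib[symmetric]
        left_diff_distrib distrib_right sum.distrib sum_subtractf)
  also have "\<dots> = (\<Sum>i\<in>UNIV. gmet L p i x y * Nconn L i m x y)"
    unfolding hrad trans Nconn_spray using lower_dy_spray[OF xy, of p m]
    by (simp add: dy_spray_low[OF xy] sum_divide_distrib[symmetric] field_simps)
  finally show "(\<Sum>i\<in>UNIV. gmet L p i x y * Nconn L i m x y)
      = (\<Sum>i\<in>UNIV. gmet L p i x y * (\<Sum>j\<in>UNIV. Gam L i m j x y * y $ j))" by simp
qed

end

section \<open>Chern and Berwald connection and their curvatures\<close>

context finsler_chart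
begin

lemma berwald_sym: "(x, y) \<in> U \<Longrightarrow> dy k (Nconn L i j) x y = dy j (Nconn L i k) x y"
  unfolding Nconn_spray by (simp add: dy_dy[of "spray i" x y k j])

lemma berwald_radial:
  assumes "(x, y) \<in> U"
  shows "(\<Sum>k\<in>UNIV. y $ k * dy k (Nconn L i j) x y) = Nconn L i j x y"
    "(\<Sum>k\<in>UNIV. y $ k * dy j (Nconn L i k) x y) = Nconn L i j x y"
proof -
  show *: "(\<Sum>k\<in>UNIV. y $ k * dy k (Nconn L i j) x y) = Nconn L i j x y"
    using homogD[OF homog_Nconn assms] by simp
  show "(\<Sum>k\<in>UNIV. y $ k * dy j (Nconn L i k) x y) = Nconn L i j x y"
    using * by (simp only: berwald_sym[OF assms, of j])
qed

text \<open>The Christoffel formula that defines \<open>Gam\<close>, solved for the derivative of the metric: the metric is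
  horizontally parallel.\<close>

lemma hdel_gmet:
  assumes xy: "(x, y) \<in> U"
  shows "hdel L k (gmet L i j) x y = (\<Sum>m\<in>UNIV. gmet L m j x y * Gam L m i k x y)
    + (\<Sum>m\<in>UNIV. gmet L i m x y * Gam L m j k x y)"
  unfolding gmet_sym[OF xy, of _ j] lower_Gam[OF xy]
  by (simp add: hdel_gmet_sym[OF xy, of _ j i] hdel_gmet_sym[OF xy, of _ k i] hdel_gmet_sym[OF xy, of _ k j] field_simps)

lemma hdel_ylow:
  assumes xy: "(x, y) \<in> U"
  shows "hdel L k (ylow i) x y = (\<Sum>m\<in>UNIV. ylow m x y * Gam L m i k x y)"
proof -
  have "hdel L k (ylow i) x y = hdel L k (\<lambda>x y. \<Sum>j\<in>UNIV. gmet L i j x y * y $ j) x y"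
    by (rule hdel_cong) (use xy gmet_radial in auto)
  also have "\<dots> = (\<Sum>j\<in>UNIV. (\<Sum>m\<in>UNIV. gmet L m j x y * Gam L m i k x y) * y $ j)
     + (\<Sum>j\<in>UNIV. (\<Sum>m\<in>UNIV. gmet L i m x y * Gam L m j k x y) * y $ j)
     - (\<Sum>j\<in>UNIV. gmet L i j x y * Nconn L j k x y)"
    using xy by (simp add: hdel_gmet distrib_right sum.distrib sum_subtractf)
  also have "(\<Sum>j\<in>UNIV. (\<Sum>m\<in>UNIV. gmet L m j x y * Gam L m i k x y) * y $ j)
      = (\<Sum>m\<in>UNIV. (\<Sum>j\<in>UNIV. gmet L m j x y * y $ j) * Gam L m i k x y)"
    unfolding sum_distrib_right by (subst sum.swap) (simp add: mult_ac)
  also have "(\<Sum>j\<in>UNIV. (\<Sum>m\<in>UNIV. gmet L i m x y * Gam L m j k x y) * y $ j)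
      = (\<Sum>m\<in>UNIV. gmet L i m x y * (\<Sum>j\<in>UNIV. Gam L m k j x y * y $ j))"
    unfolding sum_distrib_right sum_distrib_left Gam_sym[OF xy, of _ k] 
    by (subst sum.swap) (simp add: mult_ac)
  finally show ?thesis by (simp add: gmet_radial[OF xy] Nconn_eq_Gam[OF xy, of _ k])
qed

lemma hdel_energy:
  assumes xy: "(x, y) \<in> U"
  shows "hdel L k energy x y = 0"
proof -
  have "hdel L k energy x y = hdel L k (\<lambda>x y. \<Sum>i\<in>UNIV. ylow i x y * y $ i) x y"
    by (rule hdel_cong) (use xy ylow_radial in auto)
  also have "\<dots> = (\<Sum>i\<in>UNIV. (\<Sum>m\<in>UNIV. ylow m x y * Gam L m i k x y) * y $ i)
     - (\<Sum>m\<in>UNIV. ylow m x y * Nconn L m k x y)"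
    using xy by (simp add: hdel_ylow sum_subtractf sum.distrib)
  also have "(\<Sum>i\<in>UNIV. (\<Sum>m\<in>UNIV. ylow m x y * Gam L m i k x y) * y $ i)
      = (\<Sum>m\<in>UNIV. ylow m x y * (\<Sum>i\<in>UNIV. Gam L m k i x y * y $ i))"
    unfolding sum_distrib_right sum_distrib_left Gam_sym[OF xy, of _ k] 
    by (subst sum.swap) (simp add: mult_ac)
  finally show ?thesis by (simp add: Nconn_eq_Gam[OF xy, of _ k])
qed

lemma hdel_L:
  assumes xy: "(x, y) \<in> U"
  shows "hdel L k L x y = 0"
  using hdel_energy[OF xy, of k] L_nonzero[OF xy] xy by (simp add: power2_eq_square)

lemma dy_hdel:
  assumes f: "sm f" and xy: "(x, y) \<in> U"
  shows "dy j (hdel L k f) x y = hdel L k (dy j f) x y - (\<Sum>m\<in>UNIV. dy j (Nconn L m k) x y * dy m f x y)"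
  using f xy unfolding hdel_def[abs_def]
  by (simp add: dx_dy[of f _ _ k j] dy_dy[of f _ _ j] sum.distrib)

text \<open>The curvature of the nonlinear connection, that is \<open>L R\<^sup>i\<^sub>k\<^sub>l\<close> in terms of \<open>Rcurv\<close>.\<close>

definition curv3 :: "'n \<Rightarrow> 'n \<Rightarrow> 'n \<Rightarrow> 'n scal" where
  "curv3 i k l x y = hdel L k (Nconn L i l) x y - hdel L l (Nconn L i k) x y"

lemma sm_curv3 [simp]: "sm (curv3 i k l)"
  unfolding curv3_def[abs_def] by simp

lemma curv3_antisym: "curv3 i k l x y = - curv3 i l k x y"
  by (simp add: curv3_def)

lemma hdel_hdel:
  assumes f: "sm f" and xy: "(x, y) \<in> U"
  shows "hdel L k (hdel L l f) x y - hdel L l (hdel L k f) x y = - (\<Sum>m\<in>UNIV. curv3 m k l x y * dy m f x y)"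
proof -
  have expand: "hdel L k (hdel L l f) x y = dx k (dx l f) x y
     - (\<Sum>m\<in>UNIV. Nconn L m l x y * dx k (dy m f) x y) - (\<Sum>m\<in>UNIV. Nconn L m k x y * dx l (dy m f) x y)
     + (\<Sum>m\<in>UNIV. \<Sum>p\<in>UNIV. Nconn L m k x y * Nconn L p l x y * dy m (dy p f) x y)
     - (\<Sum>m\<in>UNIV. hdel L k (Nconn L m l) x y * dy m f x y)" for k l
  proof -
    have 1: "hdel L k (hdel L l f) x y = hdel L k (dx l f) x y
      - (\<Sum>m\<in>UNIV. Nconn L m l x y * hdel L k (dy m f) x y) - (\<Sum>m\<in>UNIV. hdel L k (Nconn L m l) x y * dy m f x y)"
    proof -
      have "hdel L l f = (\<lambda>x y. dx l f x y - (\<Sum>m\<in>UNIV. Nconn L m l x y * dy m f x y))"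
        by (intro ext) (simp add: hdel_def)
      then show ?thesis using f xy by (simp add: sum.distrib)
    qed
    have 2: "hdel L k (dx l f) x y = dx k (dx l f) x y - (\<Sum>m\<in>UNIV. Nconn L m k x y * dx l (dy m f) x y)"
      using f xy by (simp add: hdel_def dx_dy)
    have 3: "(\<Sum>m\<in>UNIV. Nconn L m l x y * hdel L k (dy m f) x y)
      = (\<Sum>m\<in>UNIV. Nconn L m l x y * dx k (dy m f) x y)
      - (\<Sum>p\<in>UNIV. \<Sum>m\<in>UNIV. Nconn L m k x y * Nconn L p l x y * dy m (dy p f) x y)"
      by (simp add: hdel_def right_diff_distrib sum_subtractf sum_distrib_left mult_ac)
    have 4: "(\<Sum>p\<in>UNIV. \<Sum>m\<in>UNIV. Nconn L m k x y * Nconn L p l x y * dy m (dy p f) x y)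
      = (\<Sum>m\<in>UNIV. \<Sum>p\<in>UNIV. Nconn L m k x y * Nconn L p l x y * dy m (dy p f) x y)" by (rule sum.swap)
    show ?thesis unfolding 1 2 3 4 by simp
  qed
  have sw: "(\<Sum>m\<in>UNIV. \<Sum>p\<in>UNIV. Nconn L m l x y * Nconn L p k x y * dy m (dy p f) x y)
      = (\<Sum>m\<in>UNIV. \<Sum>p\<in>UNIV. Nconn L m k x y * Nconn L p l x y * dy m (dy p f) x y)"
    by (subst sum.swap) (simp add: mult_ac dy_dy[OF f xy])
  show ?thesis unfolding expand sw dx_dx[OF f xy, of k l]
    by (simp add: curv3_def left_diff_distrib sum_subtractf)
qed

text \<open>This contraction measures how far the Chern connection is from the Berwald connection with
  coefficients \<open>\<partial>N\<^sup>i\<^sub>j/\<partial>y\<^sup>k\<close>.\<close>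

lemma dy_Gam_radial:
  assumes xy: "(x, y) \<in> U"
  shows "(\<Sum>s\<in>UNIV. y $ s * dy k (Gam L i j s) x y) = dy k (Nconn L i j) x y - Gam L i j k x y"
proof -
  have "dy k (Nconn L i j) x y = dy k (\<lambda>x y. \<Sum>s\<in>UNIV. Gam L i j s x y * y $ s) x y"
    by (rule dy_cong) (use xy Nconn_eq_Gam in auto)
  also have "\<dots> = (\<Sum>s\<in>UNIV. y $ s * dy k (Gam L i j s) x y) + Gam L i j k x y"
    using xy by (simp add: sum.distrib mult.commute if_distrib[where f="\<lambda>c. c * _"] cong: if_cong)
  finally show ?thesis by simp
qed

lemma sm_Cartan_low [simp]: "sm (Cartan_low L i j k)"
  unfolding Cartan_low_def[abs_def] by simp

lemma sm_Cartan [simp]: "sm (Cartan L i j k)"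
  unfolding Cartan_def[abs_def] by simp

lemma sm_hcov12:
  assumes "\<And>i j k. sm (T i j k)"
  shows "sm (hcov12 L T i j k h)"
  unfolding hcov12_def[abs_def] using assms by simp

lemma sm_ell [simp]: "sm (ell L i)"
  unfolding ell_def[abs_def] using L_nonzero by (intro sm_divide) auto

lemma sm_Adot [simp]: "sm (Adot L i j k)"
  unfolding Adot_def[abs_def] by (simp add: sm_hcov12)

lemma lower_Cartan:
  "(x, y) \<in> U \<Longrightarrow> (\<Sum>i\<in>UNIV. gmet L p i x y * Cartan L i j k x y) = Cartan_low L p j k x y"
  unfolding Cartan_def by (rule lower_ginv)

lemma hdel_Cartan_low:
  assumes xy: "(x, y) \<in> U"
  shows "hdel L s (Cartan_low L p j k) x y = L x y / 2 * hdel L s (dy k (gmet L p j)) x y"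
  using xy unfolding Cartan_low_def[abs_def] by (simp add: hdel_L)

lemma lower_hcov12_Cartan:
  assumes xy: "(x, y) \<in> U"
  shows "(\<Sum>i\<in>UNIV. gmet L p i x y * hcov12 L (Cartan L) i j k s x y)
    = hdel L s (Cartan_low L p j k) x y
      - (\<Sum>m\<in>UNIV. Cartan_low L m j k x y * Gam L m p s x y)
      - (\<Sum>m\<in>UNIV. Cartan_low L p m k x y * Gam L m j s x y)
      - (\<Sum>m\<in>UNIV. Cartan_low L p j m x y * Gam L m k s x y)"
proof -
  let ?g = "\<lambda>p i. gmet L p i x y" and ?c = "\<lambda>i j k. Cartan L i j k x y" and ?G = "\<lambda>i j k. Gam L i j k x y"
  have "hdel L s (Cartan_low L p j k) x y = hdel L s (\<lambda>x y. \<Sum>i\<in>UNIV. gmet L p i x y * Cartan L i j k x y) x y"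
    by (rule hdel_cong) (use xy lower_Cartan in auto)
  also have "\<dots> = (\<Sum>i\<in>UNIV. hdel L s (gmet L p i) x y * ?c i j k) + (\<Sum>i\<in>UNIV. ?g p i * hdel L s (Cartan L i j k) x y)"
    using xy by (simp add: sum.distrib)
  also have "(\<Sum>i\<in>UNIV. hdel L s (gmet L p i) x y * ?c i j k)
      = (\<Sum>i\<in>UNIV. \<Sum>m\<in>UNIV. ?g m i * ?G m p s * ?c i j k) + (\<Sum>i\<in>UNIV. \<Sum>m\<in>UNIV. ?g p m * ?G m i s * ?c i j k)"
    by (simp add: hdel_gmet[OF xy] distrib_right sum.distrib sum_distrib_right)
  also have "(\<Sum>i\<in>UNIV. \<Sum>m\<in>UNIV. ?g m i * ?G m p s * ?c i j k)
      = (\<Sum>m\<in>UNIV. Cartan_low L m j k x y * ?G m p s)"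
    unfolding lower_Cartan[OF xy, symmetric] sum_distrib_right by (subst sum.swap) (simp add: mult_ac)
  also have "(\<Sum>i\<in>UNIV. \<Sum>m\<in>UNIV. ?g p m * ?G m i s * ?c i j k)
      = (\<Sum>i\<in>UNIV. ?g p i * (\<Sum>m\<in>UNIV. ?c m j k * ?G i m s))"
    unfolding sum_distrib_left by (subst sum.swap) (simp add: mult_ac)
  finally have 1: "(\<Sum>i\<in>UNIV. ?g p i * hdel L s (Cartan L i j k) x y) + (\<Sum>i\<in>UNIV. ?g p i * (\<Sum>m\<in>UNIV. ?c m j k * ?G i m s))
     = hdel L s (Cartan_low L p j k) x y - (\<Sum>m\<in>UNIV. Cartan_low L m j k x y * ?G m p s)" by simp
  have 2: "(\<Sum>i\<in>UNIV. ?g p i * (\<Sum>m\<in>UNIV. ?c i m k * ?G m j s)) = (\<Sum>m\<in>UNIV. Cartan_low L p m k x y * ?G m j s)"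
    unfolding lower_Cartan[OF xy, symmetric] sum_distrib_right sum_distrib_left
    by (subst sum.swap) (simp add: mult_ac)
  have 3: "(\<Sum>i\<in>UNIV. ?g p i * (\<Sum>m\<in>UNIV. ?c i j m * ?G m k s)) = (\<Sum>m\<in>UNIV. Cartan_low L p j m x y * ?G m k s)"
    unfolding lower_Cartan[OF xy, symmetric] sum_distrib_right sum_distrib_left
    by (subst sum.swap) (simp add: mult_ac)
  show ?thesis unfolding hcov12_def
    using 1 by (simp add: distrib_left right_diff_distrib sum.distrib sum_subtractf 2 3)
qed

lemma lower_Adot:
  assumes xy: "(x, y) \<in> U"
  shows "2 * (\<Sum>i\<in>UNIV. gmet L p i x y * Adot L i j k x y)
    = (\<Sum>s\<in>UNIV. y $ s * hdel L s (dy k (gmet L p j)) x y)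
      - (\<Sum>m\<in>UNIV. dy k (gmet L m j) x y * Nconn L m p x y)
      - (\<Sum>m\<in>UNIV. dy k (gmet L p m) x y * Nconn L m j x y)
      - (\<Sum>m\<in>UNIV. dy m (gmet L p j) x y * Nconn L m k x y)"
proof -
  \<comment> \<open>The factor \<open>L\<close> in the Cartan tensor cancels the one in \<open>ell\<close>, and the contraction of \<open>Gam\<close> with \<open>y\<close> is \<open>Nconn\<close>.\<close>
  have con: "(\<Sum>s\<in>UNIV. y $ s / L x y * (\<Sum>m\<in>UNIV. L x y / 2 * a m * Gam L m q s x y))
      = 1/2 * (\<Sum>m\<in>UNIV. a m * Nconn L m q x y)" for a :: "'n \<Rightarrow> real" and q
  proof -
    have "(\<Sum>s\<in>UNIV. y $ s / L x y * (\<Sum>m\<in>UNIV. L x y / 2 * a m * Gam L m q s x y))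
      = (\<Sum>m\<in>UNIV. 1/2 * a m * (\<Sum>s\<in>UNIV. Gam L m q s x y * y $ s))"
      unfolding sum_distrib_left using L_nonzero[OF xy] by (subst sum.swap) (simp add: field_simps)
    then show ?thesis by (simp add: Nconn_eq_Gam[OF xy, of _ q] sum_distrib_left mult.assoc)
  qed
  have "(\<Sum>i\<in>UNIV. gmet L p i x y * Adot L i j k x y)
      = (\<Sum>s\<in>UNIV. y $ s / L x y * (\<Sum>i\<in>UNIV. gmet L p i x y * hcov12 L (Cartan L) i j k s x y))"
    unfolding Adot_def ell_def sum_distrib_left by (subst sum.swap) (simp add: mult_ac)
  also have "\<dots> = (\<Sum>s\<in>UNIV. y $ s / L x y * (L x y / 2 * hdel L s (dy k (gmet L p j)) x y))
      - 1/2 * (\<Sum>m\<in>UNIV. dy k (gmet L m j) x y * Nconn L m p x y)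
      - 1/2 * (\<Sum>m\<in>UNIV. dy k (gmet L p m) x y * Nconn L m j x y)
      - 1/2 * (\<Sum>m\<in>UNIV. dy m (gmet L p j) x y * Nconn L m k x y)"
    unfolding lower_hcov12_Cartan[OF xy] hdel_Cartan_low[OF xy] Cartan_low_def right_diff_distrib sum_subtractf con ..
  also have "(\<Sum>s\<in>UNIV. y $ s / L x y * (L x y / 2 * hdel L s (dy k (gmet L p j)) x y))
      = 1/2 * (\<Sum>s\<in>UNIV. y $ s * hdel L s (dy k (gmet L p j)) x y)"
    unfolding sum_distrib_left using L_nonzero[OF xy] by simp
  finally show ?thesis by simp
qed

lemma lower_Adot_sym:
  assumes xy: "(x, y) \<in> U"
  shows "(\<Sum>i\<in>UNIV. gmet L p i x y * Adot L i j k x y) = (\<Sum>i\<in>UNIV. gmet L k i x y * Adot L i j p x y)"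
proof -
  have 1: "hdel L s (dy k (gmet L p j)) x y = hdel L s (dy p (gmet L k j)) x y" for s
    by (rule hdel_cong) (use xy dy_gmet_sym in auto)
  have "2 * (\<Sum>i\<in>UNIV. gmet L p i x y * Adot L i j k x y) = 2 * (\<Sum>i\<in>UNIV. gmet L k i x y * Adot L i j p x y)"
    unfolding lower_Adot[OF xy] 1
    by (simp only: dy_gmet_sym(1)[OF xy, of k _ j] dy_gmet_sym(1)[OF xy, of k p] dy_gmet_sym(1)[OF xy, of p _ j])
  then show ?thesis by simp
qed

text \<open>The tensor \<open>Adot\<close> is the difference between the Berwald and the Chern connection. Let \<open>Y\<close> be that
  difference with its upper index lowered to the first place. Differentiating \<open>g\<^sub>i\<^sub>j\<^sub>|\<^sub>s = 0\<close> by \<open>y\<^sup>k\<close> and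
  contracting with \<open>y\<^sup>s\<close> gives \<open>2 A\<^sub>p\<^sub>j\<^sub>k = Y\<^sub>j\<^sub>p\<^sub>k + Y\<^sub>p\<^sub>j\<^sub>k\<close> for the lowered \<open>Adot\<close>. The left side is totally symmetric
  and \<open>Y\<close> is symmetric in its last two indices; together this makes \<open>Y\<close> totally symmetric, whence \<open>A = Y\<close>.\<close>

lemma Adot_eq:
  assumes xy: "(x, y) \<in> U"
  shows "Adot L i j k x y = dy k (Nconn L i j) x y - Gam L i j k x y"
proof -
  \<comment> \<open>\<open>Y\<close> has its upper index first, \<open>Yl\<close> is the lowered version of it.\<close>
  define Y where "Y m j k = dy k (Nconn L m j) x y - Gam L m j k x y" for m j k
  define Yl where "Yl p j k = (\<Sum>m\<in>UNIV. gmet L p m x y * Y m j k)" for p j k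
  have Ysym: "Yl p j k = Yl p k j" for p j k
    by (simp add: Yl_def Y_def berwald_sym[OF xy, of k _ j] Gam_sym[OF xy, of _ k j])
  have main: "2 * (\<Sum>i\<in>UNIV. gmet L p i x y * Adot L i j k x y) = Yl j p k + Yl p j k" for p j k
  proof -
    have con1: "(\<Sum>s\<in>UNIV. y $ s * (\<Sum>m\<in>UNIV. a m * Gam L m q s x y)) = (\<Sum>m\<in>UNIV. a m * Nconn L m q x y)"
      for a :: "'n \<Rightarrow> real" and q
      unfolding Nconn_eq_Gam[OF xy, of _ q] sum_distrib_left by (subst sum.swap) (simp add: mult_ac)
    have con2: "(\<Sum>s\<in>UNIV. y $ s * (\<Sum>m\<in>UNIV. a m * dy k (Gam L m q s) x y)) = (\<Sum>m\<in>UNIV. a m * Y m q k)"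
      for a :: "'n \<Rightarrow> real" and q
      unfolding Y_def dy_Gam_radial[OF xy, symmetric] sum_distrib_left by (subst sum.swap) (simp add: mult_ac)
    have con3: "(\<Sum>s\<in>UNIV. y $ s * (\<Sum>m\<in>UNIV. dy k (Nconn L m s) x y * a m)) = (\<Sum>m\<in>UNIV. a m * Nconn L m k x y)"
      for a :: "'n \<Rightarrow> real"
      unfolding berwald_radial(2)[OF xy, where j=k, symmetric] sum_distrib_left by (subst sum.swap) (simp add: mult_ac)
    have "hdel L s (dy k (gmet L p j)) x y - (\<Sum>m\<in>UNIV. dy k (Nconn L m s) x y * dy m (gmet L p j) x y)
        = (\<Sum>m\<in>UNIV. dy k (gmet L m j) x y * Gam L m p s x y) + (\<Sum>m\<in>UNIV. gmet L m j x y * dy k (Gam L m p s) x y)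
        + (\<Sum>m\<in>UNIV. dy k (gmet L p m) x y * Gam L m j s x y) + (\<Sum>m\<in>UNIV. gmet L p m x y * dy k (Gam L m j s) x y)" for s
    proof -
      have "dy k (hdel L s (gmet L p j)) x y = dy k (\<lambda>x y. (\<Sum>m\<in>UNIV. gmet L m j x y * Gam L m p s x y)
          + (\<Sum>m\<in>UNIV. gmet L p m x y * Gam L m j s x y)) x y"
        by (rule dy_cong) (use xy hdel_gmet in auto)
      then show ?thesis using xy by (simp add: dy_hdel sum.distrib)
    qed
    then have "(\<Sum>s\<in>UNIV. y $ s * (hdel L s (dy k (gmet L p j)) x y - (\<Sum>m\<in>UNIV. dy k (Nconn L m s) x y * dy m (gmet L p j) x y)))
      = (\<Sum>s\<in>UNIV. y $ s * ((\<Sum>m\<in>UNIV. dy k (gmet L m j) x y * Gam L m p s x y) + (\<Sum>m\<in>UNIV. gmet L m j x y * dy k (Gam L m p s) x y)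
        + (\<Sum>m\<in>UNIV. dy k (gmet L p m) x y * Gam L m j s x y) + (\<Sum>m\<in>UNIV. gmet L p m x y * dy k (Gam L m j s) x y)))"
      by simp
    then have "(\<Sum>s\<in>UNIV. y $ s * hdel L s (dy k (gmet L p j)) x y) - (\<Sum>m\<in>UNIV. dy m (gmet L p j) x y * Nconn L m k x y)
      = (\<Sum>m\<in>UNIV. dy k (gmet L m j) x y * Nconn L m p x y) + (\<Sum>m\<in>UNIV. gmet L m j x y * Y m p k)
      + (\<Sum>m\<in>UNIV. dy k (gmet L p m) x y * Nconn L m j x y) + (\<Sum>m\<in>UNIV. gmet L p m x y * Y m j k)"
      unfolding right_diff_distrib distrib_left sum.distrib sum_subtractf con1 con2 con3 .
    then show ?thesis
      unfolding lower_Adot[OF xy] Yl_def gmet_sym[OF xy, of j] by simp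
  qed
  have swap: "Yl p j k = Yl k j p" for p j k
    using main[of p j k] main[of k j p] lower_Adot_sym[OF xy, of p j k] Ysym[of j p k] by simp
  have "Yl j p k = Yl p j k" for p j k
    using swap[of j k p] Ysym[of p k j] Ysym[of j k p] by simp
  then have "(\<Sum>i\<in>UNIV. gmet L p i x y * Adot L i j k x y) = (\<Sum>i\<in>UNIV. gmet L p i x y * Y i j k)" for p
    using main[of p j k] by (simp add: Yl_def)
  then show ?thesis
    using gmet_cancel[of x y "\<lambda>i. Adot L i j k x y" "\<lambda>i. Y i j k", OF xy] by (simp add: Y_def)
qed

lemma Adot_sym: "(x, y) \<in> U \<Longrightarrow> Adot L i j k x y = Adot L i k j x y"
  by (simp add: Adot_eq berwald_sym[of x y k i j] Gam_sym[of x y i k j])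

lemma Adot_radial:
  assumes xy: "(x, y) \<in> U"
  shows "(\<Sum>j\<in>UNIV. y $ j * Adot L i j l x y) = 0"
  unfolding Adot_sym[OF xy, of i _ l]
  by (simp add: Adot_eq[OF xy] right_diff_distrib sum_subtractf berwald_radial[OF xy] Nconn_eq_Gam[OF xy] mult.commute)

lemma dy_Nconn: "(x, y) \<in> U \<Longrightarrow> dy k (Nconn L i j) x y = Gam L i k j x y + Adot L i k j x y"
  by (simp add: Adot_eq berwald_sym[of x y k i j])

lemma hdel_dy_Nconn: 
  "(x, y) \<in> U \<Longrightarrow> hdel L l (dy k (Nconn L i j)) x y = hdel L l (Gam L i k j) x y + hdel L l (Adot L i k j) x y"
  using hdel_cong[of "dy k (Nconn L i j)" "\<lambda>x y. Gam L i k j x y + Adot L i k j x y" x y L l] dy_Nconn by simp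

text \<open>The hh-curvature of the Berwald connection.\<close>

definition berwald_curv :: "'n \<Rightarrow> 'n \<Rightarrow> 'n \<Rightarrow> 'n \<Rightarrow> 'n scal" where
  "berwald_curv i j k l = dy j (curv3 i k l)"

lemma sm_berwald_curv [simp]: "sm (berwald_curv i j k l)"
  by (simp add: berwald_curv_def)

lemma berwald_curv_eq:
  assumes xy: "(x, y) \<in> U"
  shows "berwald_curv i j k l x y = hdel L k (dy j (Nconn L i l)) x y - hdel L l (dy j (Nconn L i k)) x y
    + (\<Sum>m\<in>UNIV. dy j (Nconn L m l) x y * dy m (Nconn L i k) x y)
    - (\<Sum>m\<in>UNIV. dy j (Nconn L m k) x y * dy m (Nconn L i l) x y)"
  using xy unfolding berwald_curv_def curv3_def[abs_def] by (simp add: dy_hdel)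

text \<open>The bracket that is differentiated in the definition of \<open>Dtensor\<close>.\<close>

definition landsberg_part :: "'n \<Rightarrow> 'n \<Rightarrow> 'n \<Rightarrow> 'n \<Rightarrow> 'n scal" where
  "landsberg_part i j k l x y = hcov12 L (Adot L) i j l k x y - hcov12 L (Adot L) i j k l x y
     + (\<Sum>s\<in>UNIV. Adot L s j l x y * Adot L i s k x y)
     - (\<Sum>s\<in>UNIV. Adot L s j k x y * Adot L i s l x y)"

lemma sm_landsberg_part [simp]: "sm (landsberg_part i j k l)"
  unfolding landsberg_part_def[abs_def] by (simp add: sm_hcov12)

lemma sm_hhcurv [simp]: "sm (hhcurv L i j k l)"
  unfolding hhcurv_def[abs_def] by simp

text \<open>Substitute Berwald = Chern + \<open>Adot\<close> in the curvature of the Berwald connection: what is linear in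
  \<open>Adot\<close> combines to covariant derivatives, since the Chern connection has no torsion, and the quadratic
  terms remain.\<close>

lemma berwald_curv_decomp:
  assumes xy: "(x, y) \<in> U"
  shows "berwald_curv i j k l x y = hhcurv L i j k l x y + landsberg_part i j k l x y"
  unfolding berwald_curv_eq[OF xy] hdel_dy_Nconn[OF xy] dy_Nconn[OF xy] hhcurv_def landsberg_part_def hcov12_def
  by (simp add: distrib_left distrib_right sum.distrib mult.commute Gam_sym[OF xy, of _ k l])

text \<open>Every term is contracted through \<open>y\<^sup>j Adot\<^sup>i\<^sub>j\<^sub>l = 0\<close>, and \<open>y\<close> is horizontally parallel.\<close>

lemma landsberg_part_radial:
  assumes xy: "(x, y) \<in> U"
  shows "(\<Sum>j\<in>UNIV. y $ j * landsberg_part i j k l x y) = 0"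
proof -
  have cov: "(\<Sum>j\<in>UNIV. y $ j * hcov12 L (Adot L) i j l k x y) = 0" for k l
  proof -
    have "hdel L k (\<lambda>x y. \<Sum>j\<in>UNIV. y $ j * Adot L i j l x y) x y = hdel L k (\<lambda>x y. 0) x y"
      by (rule hdel_cong) (use xy Adot_radial in auto)
    then have 1: "(\<Sum>j\<in>UNIV. y $ j * hdel L k (Adot L i j l) x y) = (\<Sum>j\<in>UNIV. Nconn L j k x y * Adot L i j l x y)"
      using xy by (simp add: sum.distrib sum_negf sum_subtractf)
    have 2: "(\<Sum>j\<in>UNIV. y $ j * (\<Sum>m\<in>UNIV. Adot L m j l x y * Gam L i m k x y)) = 0"
    proof -
      have "(\<Sum>j\<in>UNIV. y $ j * (\<Sum>m\<in>UNIV. Adot L m j l x y * Gam L i m k x y))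
        = (\<Sum>m\<in>UNIV. (\<Sum>j\<in>UNIV. y $ j * Adot L m j l x y) * Gam L i m k x y)"
        unfolding sum_distrib_left sum_distrib_right by (subst sum.swap) (simp add: mult_ac)
      then show ?thesis by (simp add: Adot_radial[OF xy])
    qed
    have 3: "(\<Sum>j\<in>UNIV. y $ j * (\<Sum>m\<in>UNIV. Adot L i m l x y * Gam L m j k x y)) = (\<Sum>m\<in>UNIV. Nconn L m k x y * Adot L i m l x y)"
      unfolding Nconn_eq_Gam[OF xy] sum_distrib_left sum_distrib_right Gam_sym[OF xy, of _ _ k]
      by (subst sum.swap) (simp add: mult_ac)
    have 4: "(\<Sum>j\<in>UNIV. y $ j * (\<Sum>m\<in>UNIV. Adot L i j m x y * Gam L m l k x y)) = 0"
    proof -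
      have "(\<Sum>j\<in>UNIV. y $ j * (\<Sum>m\<in>UNIV. Adot L i j m x y * Gam L m l k x y))
        = (\<Sum>m\<in>UNIV. (\<Sum>j\<in>UNIV. y $ j * Adot L i j m x y) * Gam L m l k x y)"
        unfolding sum_distrib_left sum_distrib_right by (subst sum.swap) (simp add: mult_ac)
      then show ?thesis by (simp add: Adot_radial[OF xy])
    qed
    show ?thesis unfolding hcov12_def
      by (simp add: distrib_left right_diff_distrib sum.distrib sum_subtractf 1 2 3 4)
  qed
  have quad: "(\<Sum>j\<in>UNIV. y $ j * (\<Sum>s\<in>UNIV. Adot L s j l x y * Adot L i s k x y)) = 0" for k l
  proof -
    have "(\<Sum>j\<in>UNIV. y $ j * (\<Sum>s\<in>UNIV. Adot L s j l x y * Adot L i s k x y))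
      = (\<Sum>s\<in>UNIV. (\<Sum>j\<in>UNIV. y $ j * Adot L s j l x y) * Adot L i s k x y)"
      unfolding sum_distrib_left sum_distrib_right by (subst sum.swap) (simp add: mult_ac)
    then show ?thesis by (simp add: Adot_radial[OF xy])
  qed
  show ?thesis unfolding landsberg_part_def
    by (simp add: distrib_left right_diff_distrib sum.distrib sum_subtractf cov quad)
qed

text \<open>Differentiate \<open>y\<^sup>j landsberg_part\<^sup>i\<^sub>j\<^sub>k\<^sub>l = 0\<close> by \<open>y\<^sup>h\<close>. Hence \<open>D\<close> is
  the Chern curvature minus the Berwald curvature.\<close>

lemma Dtensor_eq:
  assumes xy: "(x, y) \<in> U"
  shows "Dtensor L i h k l x y = - landsberg_part i h k l x y"
proof -
  have "dy h (\<lambda>x y. \<Sum>j\<in>UNIV. y $ j * landsberg_part i j k l x y) x y = dy h (\<lambda>x y. 0) x y"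
    by (rule dy_cong) (use xy landsberg_part_radial in auto)
  then have "landsberg_part i h k l x y + (\<Sum>j\<in>UNIV. y $ j * dy h (landsberg_part i j k l) x y) = 0"
    using xy by (simp add: sum.distrib if_distrib[where f="\<lambda>c. c * _"] cong: if_cong)
  moreover have "(\<lambda>x y. hcov12 L (Adot L) i j l k x y - hcov12 L (Adot L) i j k l x y
     + (\<Sum>s\<in>UNIV. Adot L s j l x y * Adot L i s k x y)
     - (\<Sum>s\<in>UNIV. Adot L s j k x y * Adot L i s l x y)) = landsberg_part i j k l" for j
    by (intro ext) (simp add: landsberg_part_def)
  ultimately show ?thesis unfolding Dtensor_def by simp
qed

lemma sm_Dtensor [simp]: "sm (Dtensor L i h k l)"
  by (rule sm_cong[of "\<lambda>x y. - landsberg_part i h k l x y"]) (auto simp: Dtensor_eq)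

lemma hhcurv_eq_add_Dtensor:
  "(x, y) \<in> U \<Longrightarrow> hhcurv L i j k l x y = berwald_curv i j k l x y + Dtensor L i j k l x y"
  by (simp add: berwald_curv_decomp Dtensor_eq)

lemma hcov13_add:
  assumes "\<And>i j k l x y. (x, y) \<in> U \<Longrightarrow> R i j k l x y = S i j k l x y + T i j k l x y"
    and [simp]: "\<And>i j k l. sm (S i j k l)" "\<And>i j k l. sm (T i j k l)" and xy: "(x, y) \<in> U"
  shows "hcov13 L R i j k l h x y = hcov13 L S i j k l h x y + hcov13 L T i j k l h x y"
proof -
  have "hdel L h (R i j k l) x y = hdel L h (\<lambda>x y. S i j k l x y + T i j k l x y) x y"
    by (rule hdel_cong[symmetric]) (use xy assms(1) in auto)
  then show ?thesis
    unfolding hcov13_def assms(1)[OF xy] using xy by (simp add: distrib_right sum.distrib)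
qed

text \<open>Such a tensor is built from the metric and the identity, both horizontally parallel. The constancy
  of \<open>c\<close> on the whole chart is essential.\<close>

lemma hcov13_constant_curvature:
  assumes xy: "(x, y) \<in> U"
    and T: "\<And>i j k l x y. (x, y) \<in> U \<Longrightarrow> T i j k l x y =
      c * ((if i = k then gmet L j l x y else 0) - (if i = l then gmet L j k x y else 0))"
  shows "hcov13 L T i j k l h x y = 0"
proof -
  have sm': "sm (\<lambda>x y. if P then gmet L a b x y else 0)" for P a b
    by (cases P) auto
  have hd: "hdel L h (\<lambda>x y. if P then gmet L a b x y else 0) x y = (if P then hdel L h (gmet L a b) x y else 0)" for P a b
    using xy by (cases P) auto
  have "hdel L h (T i j k l) x y = hdel L h (\<lambda>x y. c * ((if i = k then gmet L j l x y else 0) - (if i = l then gmet L j k x y else 0))) x y"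
    by (rule hdel_cong[symmetric]) (use xy T sm' in auto)
  also have "\<dots> = c * ((if i = k then hdel L h (gmet L j l) x y else 0) - (if i = l then hdel L h (gmet L j k) x y else 0))"
    using xy sm' by (simp add: hd)
  finally have 1: "hdel L h (T i j k l) x y = c * ((if i = k then hdel L h (gmet L j l) x y else 0) - (if i = l then hdel L h (gmet L j k) x y else 0))" .
  have p: "(if P then a else 0) * b = (if P then a * b else 0)" for P and a b :: real by simp
  have q: "c * (a - b) * d = c * (a * d) - c * (b * d)" for a b d by (simp add: algebra_simps)
  have if_sum: "(\<Sum>m\<in>UNIV. if P then f m else 0) = (if P then (\<Sum>m\<in>UNIV. f m) else (0::real))" for P and f :: "'n \<Rightarrow> real" by simp
  show ?thesis
    unfolding hcov13_def 1 T[OF xy] q sum_subtractf sum_distrib_left[symmetric] p hdel_gmet[OF xy]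
    by (auto simp: if_sum algebra_simps)
qed

text \<open>The heart of the argument. Constant flag curvature enters as the formula for \<open>curv3\<close>;
  differentiating it along the fibre exhibits the Berwald curvature as parallel, and the Chern curvature
  differs from it by \<open>Dtensor\<close>, which is parallel by assumption.\<close>

lemma hcov13_hhcurv_eq_0:
  assumes xy: "(x, y) \<in> U"
    and K: "\<And>i k l x y. (x, y) \<in> U \<Longrightarrow> curv3 i k l x y =
      c * ((if i = k then ylow l x y else 0) - (if i = l then ylow k x y else 0))"
    and D: "hcov13 L (Dtensor L) i j k l h x y = 0"
  shows "hcov13 L (hhcurv L) i j k l h x y = 0"
proof -
  have sm': "sm (\<lambda>x y. if P then ylow a x y else 0)" for P a
    by (cases P) auto
  have hd: "(x, y) \<in> U \<Longrightarrow> dy h (\<lambda>x y. if P then ylow a x y else 0) x y = (if P then gmet L h a x y else 0)" for P h a x y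
    by (cases P) (auto simp: dy_ylow)
  have "berwald_curv i j k l x y = c * ((if i = k then gmet L j l x y else 0) - (if i = l then gmet L j k x y else 0))"
    if xy: "(x, y) \<in> U" for i j k l x y
  proof -
    have "berwald_curv i j k l x y = dy j (\<lambda>x y. c * ((if i = k then ylow l x y else 0) - (if i = l then ylow k x y else 0))) x y"
      unfolding berwald_curv_def by (rule dy_cong) (use xy K in auto)
    also have "\<dots> = c * ((if i = k then gmet L j l x y else 0) - (if i = l then gmet L j k x y else 0))"
      using xy sm' by (simp add: hd)
    finally show ?thesis .
  qed
  then have "hcov13 L berwald_curv i j k l h x y = 0"
    by (intro hcov13_constant_curvature[OF xy, of _ c])
  then show ?thesis
    using hcov13_add[of "hhcurv L" berwald_curv "Dtensor L", OF hhcurv_eq_add_Dtensor _ _ xy] D by simp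
qed

lemma homog_hdel:
  assumes "homog d f"
  shows "homog d (hdel L k f)"
proof -
  have "homog d (\<lambda>x y. \<Sum>m\<in>UNIV. Nconn L m k x y * dy m f x y)"
    using homog_sum[of d "\<lambda>m x y. Nconn L m k x y * dy m f x y"] homog_mult[OF homog_Nconn homog_dy[OF assms]]
    by simp
  from homog_diff[OF homog_dx[OF assms] this] show ?thesis
    by (simp add: hdel_def[abs_def])
qed

lemma homog_curv3: "homog 1 (curv3 i k l)"
  unfolding curv3_def[abs_def] by (intro homog_diff homog_hdel homog_Nconn)

lemma berwald_curv_radial:
  "(x, y) \<in> U \<Longrightarrow> (\<Sum>j\<in>UNIV. y $ j * berwald_curv i j k l x y) = curv3 i k l x y"
  using homogD[OF homog_curv3] by (simp add: berwald_curv_def)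

lemma berwald_curv_antisym:
  assumes "(x, y) \<in> U"
  shows "berwald_curv i j k l x y = - berwald_curv i j l k x y"
  unfolding berwald_curv_eq[OF assms] by simp

text \<open>The first Bianchi identity; it holds since \<open>\<partial>N\<^sup>i\<^sub>j/\<partial>y\<^sup>k\<close> is symmetric in \<open>j\<close> and \<open>k\<close>.\<close>

lemma berwald_curv_cyclic:
  assumes xy: "(x, y) \<in> U"
  shows "berwald_curv i j k l x y + berwald_curv i k l j x y + berwald_curv i l j k x y = 0"
proof -
  have s: "hdel L q (dy b (Nconn L a c)) x y = hdel L q (dy c (Nconn L a b)) x y" for q a b c
    by (rule hdel_cong) (use xy berwald_sym in auto)
  show ?thesis
    unfolding berwald_curv_eq[OF xy] s[of _ k i j] s[of _ l i j] s[of _ l i k]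
      berwald_sym[OF xy, of k _ j] berwald_sym[OF xy, of l _ j] berwald_sym[OF xy, of l _ k]
    by simp
qed

lemma berwald_curv_radial_antisym:
  assumes xy: "(x, y) \<in> U"
  shows "(\<Sum>l\<in>UNIV. y $ l * berwald_curv m j k l x y) - (\<Sum>l\<in>UNIV. y $ l * berwald_curv m k j l x y)
    = - curv3 m j k x y"
proof -
  have "berwald_curv m j k l x y - berwald_curv m k j l x y = - berwald_curv m l j k x y" for l
    using berwald_curv_cyclic[OF xy, of m j k l] berwald_curv_antisym[OF xy, of m k l j] by simp
  then have "(\<Sum>l\<in>UNIV. y $ l * berwald_curv m j k l x y) - (\<Sum>l\<in>UNIV. y $ l * berwald_curv m k j l x y)
    = (\<Sum>l\<in>UNIV. y $ l * - berwald_curv m l j k x y)"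
    unfolding sum_subtractf[symmetric] right_diff_distrib[symmetric] by simp
  then show ?thesis using berwald_curv_radial[OF xy, of m j k] by (simp add: sum_negf)
qed

text \<open>The commutator of two horizontal derivatives is a vertical derivative with coefficients \<open>curv3\<close>; apply
  it to \<open>L\<^sup>2\<close>, whose horizontal derivatives vanish.\<close>

lemma ylow_curv3:
  assumes xy: "(x, y) \<in> U"
  shows "(\<Sum>m\<in>UNIV. ylow m x y * curv3 m k l x y) = 0"
proof -
  have "hdel L k (hdel L l energy) x y = 0" for k l
    using hdel_cong[of "\<lambda>x y. 0" "hdel L l energy" x y L k] hdel_energy xy by simp
  then have "(\<Sum>m\<in>UNIV. curv3 m k l x y * dy m energy x y) = 0"
    using hdel_hdel[OF _ xy, of energy k l] by simp
  then show ?thesis by (simp add: ylow_def sum_divide_distrib[symmetric] mult.commute)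
qed

text \<open>The Jacobi endomorphism (also called Riemann curvature) of the direction \<open>y\<close>; the flag curvatures with flagpole
  \<open>y\<close> are the normalised values of its quadratic form.\<close>

definition jacobi :: "'n \<Rightarrow> 'n \<Rightarrow> 'n scal" where
  "jacobi i k x y = (\<Sum>l\<in>UNIV. curv3 i k l x y * y $ l)"

text \<open>Differentiating \<open>y\<^sub>m curv3\<^sup>m\<^sub>k\<^sub>l = 0\<close> along the fibre replaces the metric by \<open>y\<^sub>m\<close> and \<open>curv3\<close> by
  the Berwald curvature. The Bianchi identity then identifies the antisymmetric part with
  another multiple of \<open>y\<^sub>m curv3\<^sup>m\<^sub>j\<^sub>k = 0\<close>.\<close>

lemma lower_jacobi_sym:
  assumes xy: "(x, y) \<in> U"
  shows "(\<Sum>m\<in>UNIV. gmet L j m x y * jacobi m k x y) = (\<Sum>m\<in>UNIV. gmet L k m x y * jacobi m j x y)"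
proof -
  have low: "(\<Sum>m\<in>UNIV. gmet L j m x y * curv3 m k l x y) = - (\<Sum>m\<in>UNIV. ylow m x y * berwald_curv m j k l x y)" for j k l
  proof -
    have "dy j (\<lambda>x y. \<Sum>m\<in>UNIV. ylow m x y * curv3 m k l x y) x y = dy j (\<lambda>x y. 0) x y"
      by (rule dy_cong) (use xy ylow_curv3 in auto)
    then show ?thesis using xy by (simp add: dy_ylow sum.distrib berwald_curv_def)
  qed
  have J: "(\<Sum>m\<in>UNIV. gmet L j m x y * jacobi m k x y) 
      = - (\<Sum>m\<in>UNIV. ylow m x y * (\<Sum>l\<in>UNIV. y $ l * berwald_curv m j k l x y))" for j k
  proof -
    have "(\<Sum>m\<in>UNIV. gmet L j m x y * jacobi m k x y) = (\<Sum>l\<in>UNIV. y $ l * (\<Sum>m\<in>UNIV. gmet L j m x y * curv3 m k l x y))"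
      unfolding jacobi_def sum_distrib_left by (subst sum.swap) (simp add: mult_ac)
    also have "\<dots> = - (\<Sum>l\<in>UNIV. \<Sum>m\<in>UNIV. y $ l * (ylow m x y * berwald_curv m j k l x y))"
      unfolding low by (simp add: sum_negf sum_distrib_left)
    finally show ?thesis unfolding sum_distrib_left by (subst (asm) sum.swap) (simp add: mult_ac)
  qed
  have "(\<Sum>l\<in>UNIV. y $ l * berwald_curv m k j l x y) = (\<Sum>l\<in>UNIV. y $ l * berwald_curv m j k l x y) + curv3 m j k x y" for m
    using berwald_curv_radial_antisym[OF xy, of m j k] by simp
  then have "(\<Sum>m\<in>UNIV. ylow m x y * (\<Sum>l\<in>UNIV. y $ l * berwald_curv m k j l x y))
      = (\<Sum>m\<in>UNIV. ylow m x y * (\<Sum>l\<in>UNIV. y $ l * berwald_curv m j k l x y))"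
    using ylow_curv3[OF xy, of j k] by (simp add: distrib_left sum.distrib)
  then show ?thesis unfolding J by simp
qed

lemma jacobi_radial: "(\<Sum>k\<in>UNIV. jacobi i k x y * y $ k) = 0"
proof -
  have "(\<Sum>k\<in>UNIV. jacobi i k x y * y $ k) = (\<Sum>k\<in>UNIV. \<Sum>l\<in>UNIV. curv3 i k l x y * y $ l * y $ k)"
    by (simp add: jacobi_def sum_distrib_right)
  also have "\<dots> = - (\<Sum>k\<in>UNIV. \<Sum>l\<in>UNIV. curv3 i l k x y * y $ l * y $ k)"
    by (subst curv3_antisym) (simp add: sum_negf)
  also have "(\<Sum>k\<in>UNIV. \<Sum>l\<in>UNIV. curv3 i l k x y * y $ l * y $ k) = (\<Sum>k\<in>UNIV. jacobi i k x y * y $ k)"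
    unfolding jacobi_def sum_distrib_right by (subst sum.swap) (simp add: mult_ac)
  finally show ?thesis by simp
qed

lemma symmetric_form_eqI:
  fixes a :: "'n \<Rightarrow> 'n \<Rightarrow> real"
  assumes sym: "\<And>j k. a j k = a k j" and zero: "\<And>u :: real^'n. (\<Sum>j\<in>UNIV. \<Sum>k\<in>UNIV. a j k * u $ j * u $ k) = 0"
  shows "a j k = 0"
proof -
  have ax: "(\<Sum>j\<in>UNIV. \<Sum>k\<in>UNIV. a j k * (axis p 1 + c *\<^sub>R axis q 1) $ j * (axis p 1 + c *\<^sub>R axis q 1) $ k)
      = a p p + c * a p q + c * a q p + c * c * a q q" for p q c
  proof -
    have "(\<Sum>m\<in>UNIV. if P then f m else 0) = (if P then (\<Sum>m\<in>UNIV. f m) else (0::real))" for P and f :: "'n \<Rightarrow> real"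
      by simp
    then show ?thesis
      by (simp add: axis_def algebra_simps sum.distrib if_distrib[where f="\<lambda>c. _ * c"] cong: if_cong)
  qed
  have "a j j + 1 * a j k + 1 * a k j + 1 * 1 * a k k = 0" "a j j + -1 * a j k + -1 * a k j + -1 * -1 * a k k = 0"
    using zero[of "axis j 1 + 1 *\<^sub>R axis k 1"] zero[of "axis j 1 + (-1) *\<^sub>R axis k 1"] unfolding ax by simp_all
  then show ?thesis using sym[of j k] by simp
qed

text \<open>Flag curvature only knows the quadratic form of the Jacobi endomorphism. As the endomorphism
  is self-adjoint, polarisation recovers it.\<close>

lemma jacobi_of_quadratic:
  assumes xy: "(x, y) \<in> U"
    and quad: "\<And>u :: real^'n. (\<Sum>j\<in>UNIV. \<Sum>k\<in>UNIV. (\<Sum>m\<in>UNIV. gmet L j m x y * jacobi m k x y) * u $ j * u $ k)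
      = c * (energy x y * (\<Sum>j\<in>UNIV. \<Sum>k\<in>UNIV. gmet L j k x y * u $ j * u $ k) - (\<Sum>j\<in>UNIV. ylow j x y * u $ j)\<^sup>2)"
  shows "jacobi i k x y = c * ((if i = k then energy x y else 0) - y $ i * ylow k x y)"
proof (rule gmet_cancel[of x y "\<lambda>i. jacobi i k x y" "\<lambda>i. c * ((if i = k then energy x y else 0) - y $ i * ylow k x y)", OF xy])
  fix j
  define a where "a j k = (\<Sum>m\<in>UNIV. gmet L j m x y * jacobi m k x y)
    - c * (energy x y * gmet L j k x y - ylow j x y * ylow k x y)" for j k
  have sq: "(\<Sum>j\<in>UNIV. ylow j x y * u $ j)\<^sup>2 = (\<Sum>j\<in>UNIV. \<Sum>k\<in>UNIV. ylow j x y * ylow k x y * u $ j * u $ k)" for u :: "real^'n"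
    unfolding power2_eq_square sum_product by (simp add: mult_ac)
  have "a j k = 0" for j k
  proof (rule symmetric_form_eqI)
    show "a j k = a k j" for j k
      unfolding a_def using lower_jacobi_sym[OF xy, of j k] gmet_sym[OF xy, of j k] by simp
    fix u :: "real^'n"
    have "(\<Sum>j\<in>UNIV. \<Sum>k\<in>UNIV. a j k * u $ j * u $ k)
      = (\<Sum>j\<in>UNIV. \<Sum>k\<in>UNIV. (\<Sum>m\<in>UNIV. gmet L j m x y * jacobi m k x y) * u $ j * u $ k)
       - c * (energy x y * (\<Sum>j\<in>UNIV. \<Sum>k\<in>UNIV. gmet L j k x y * u $ j * u $ k)
         - (\<Sum>j\<in>UNIV. \<Sum>k\<in>UNIV. ylow j x y * ylow k x y * u $ j * u $ k))"
      unfolding sum_distrib_left sum_subtractf[symmetric] a_def by (simp add: algebra_simps)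
    then show "(\<Sum>j\<in>UNIV. \<Sum>k\<in>UNIV. a j k * u $ j * u $ k) = 0"
      using quad[of u] sq[of u] by simp
  qed
  then have "(\<Sum>m\<in>UNIV. gmet L j m x y * jacobi m k x y) = c * (energy x y * gmet L j k x y - ylow j x y * ylow k x y)"
    by (simp add: a_def)
  also have "\<dots> = (\<Sum>i\<in>UNIV. gmet L j i x y * (c * ((if i = k then energy x y else 0) - y $ i * ylow k x y)))"
  proof -
    have "(\<Sum>i\<in>UNIV. gmet L j i x y * (c * ((if i = k then energy x y else 0) - y $ i * ylow k x y)))
      = c * ((\<Sum>i\<in>UNIV. gmet L j i x y * (if i = k then energy x y else 0)) - (\<Sum>i\<in>UNIV. gmet L j i x y * y $ i) * ylow k x y)"
      unfolding sum_distrib_left sum_distrib_right sum_subtractf[symmetric] by (simp add: algebra_simps)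
    then show ?thesis by (simp only: gmet_radial[OF xy]) (simp add: if_distrib[where f="\<lambda>c. _ * c"] mult.commute cong: if_cong)
  qed
  finally show "(\<Sum>i\<in>UNIV. gmet L j i x y * jacobi i k x y)
    = (\<Sum>i\<in>UNIV. gmet L j i x y * (c * ((if i = k then energy x y else 0) - y $ i * ylow k x y)))" .
qed

text \<open>The three-index curvature is recovered from the Jacobi endomorphism of all directions \<open>y\<close>: antisymmetrise
  its fibre derivative and use the Bianchi identity, which yields three times \<open>curv3\<close>.\<close>

lemma curv3_of_jacobi:
  assumes xy: "(x, y) \<in> U"
    and J: "\<And>i k x y. (x, y) \<in> U \<Longrightarrow> jacobi i k x y = c * ((if i = k then energy x y else 0) - y $ i * ylow k x y)"
  shows "curv3 i k l x y = c * ((if i = k then ylow l x y else 0) - (if i = l then ylow k x y else 0))"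
proof -
  have smE: "sm (\<lambda>x y. if P then energy x y else 0)" for P by (cases P) auto
  have dyE: "dy j (\<lambda>x y. if P then energy x y else 0) x y = (if P then 2 * ylow j x y else 0)" for P j
    using xy by (cases P) (auto simp: ylow_def)
  have d: "(\<Sum>l\<in>UNIV. y $ l * berwald_curv i j k l x y) + curv3 i k j x y
      = c * ((if i = k then 2 * ylow j x y else 0) - (if i = j then ylow k x y else 0) - y $ i * gmet L j k x y)" for j k
  proof -
    have "dy j (jacobi i k) x y = dy j (\<lambda>x y. c * ((if i = k then energy x y else 0) - y $ i * ylow k x y)) x y"
      by (rule dy_cong[symmetric]) (use xy J smE in auto)
    moreover have "dy j (jacobi i k) x y = (\<Sum>l\<in>UNIV. y $ l * berwald_curv i j k l x y) + curv3 i k j x y"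
      using xy unfolding jacobi_def[abs_def] berwald_curv_def
      by (simp add: sum.distrib mult.commute if_distrib[where f="\<lambda>c. c * _"] cong: if_cong)
    moreover have "dy j (\<lambda>x y. c * ((if i = k then energy x y else 0) - y $ i * ylow k x y)) x y
       = c * ((if i = k then 2 * ylow j x y else 0) - (if i = j then ylow k x y else 0) - y $ i * gmet L j k x y)"
      using xy smE by (simp add: dyE dy_ylow algebra_simps)
    ultimately show ?thesis by simp
  qed
  have "3 * curv3 i k l x y = c * (3 * (if i = k then ylow l x y else 0) - 3 * (if i = l then ylow k x y else 0))"
    using curv3_antisym[of i k k x y] curv3_antisym[of i l l x y] d[of l k] d[of k l] berwald_curv_radial_antisym[OF xy, of i l k] curv3_antisym[of i l k x y] gmet_sym[OF xy, of l k]
    by (simp add: algebra_simps split: if_splits)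
  then show ?thesis by (simp add: right_diff_distrib)
qed

end

section \<open>The Levi-Civita connection of a geodesic field\<close>

lemma pd_eqI:
  assumes "(g has_derivative g') (at x)"
  shows "pd k g x = g' (axis k 1)"
proof -
  have lin: "linear g'" using assms by (rule has_derivative_linear)
  have line: "((\<lambda>t. x + t *\<^sub>R axis k 1) has_derivative (\<lambda>c. c *\<^sub>R axis k 1)) (at 0)"
    by (auto intro!: derivative_eq_intros)
  have "(g has_derivative g') (at (x + 0 *\<^sub>R axis k 1))" using assms by simp
  from has_derivative_compose[OF line this]
  have "((\<lambda>t. g (x + t *\<^sub>R axis k 1)) has_field_derivative g' (axis k 1)) (at 0)"
    by (simp add: has_field_derivative_def linear_cmul[OF lin] mult.commute[of _ "g' (axis k 1)"])
  then show ?thesis unfolding pd_def by (rule DERIV_imp_deriv)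
qed

lemma pd_frechet: "g differentiable (at x) \<Longrightarrow> pd k g x = frechet_derivative g (at x) (axis k 1)"
  by (rule pd_eqI) (simp add: frechet_derivative_works)

lemma pd_cong:
  assumes "open S" "x \<in> S" "\<And>x. x \<in> S \<Longrightarrow> f x = g x" "f differentiable (at x)"
  shows "pd k f x = pd k g x"
proof -
  have f: "(f has_derivative frechet_derivative f (at x)) (at x)"
    using assms(4) by (simp add: frechet_derivative_works)
  have "(g has_derivative frechet_derivative f (at x)) (at x)"
    by (rule has_derivative_transform_within_open[OF f assms(1,2,3)])
  from pd_eqI[OF this] pd_eqI[OF f] show ?thesis by simp
qed

lemma pd_mult:
  assumes "f differentiable (at x)" "g differentiable (at x)"
  shows "pd k (\<lambda>x. f x * g x) x = f x * pd k g x + pd k f x * g x"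
  using assms by (subst pd_eqI[OF has_derivative_mult]) (auto simp: frechet_derivative_works pd_frechet)

lemma pd_sum:
  assumes "\<And>j. j \<in> S \<Longrightarrow> f j differentiable (at x)"
  shows "pd k (\<lambda>x. \<Sum>j\<in>S. f j x) x = (\<Sum>j\<in>S. pd k (f j) x)"
  using assms by (subst pd_eqI[OF has_derivative_sum]) (auto simp: frechet_derivative_works pd_frechet)

lemma differentiable_cong_open:
  assumes "open S" "x \<in> S" "\<And>x. x \<in> S \<Longrightarrow> f x = g x" "f differentiable (at x)"
  shows "g differentiable (at x)"
proof -
  obtain D where "(f has_derivative D) (at x)" using assms(4) by (auto simp: differentiable_def)
  from has_derivative_transform_within_open[OF this assms(1,2,3)] show ?thesis by (rule differentiableI)
qed

text \<open>A geodesic vector field in coordinates. The last assumption is the geodesic equation of the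
  integral curves, written as an identity for \<open>X\<close>.\<close>

locale geodesic_chart_field = finsler_chart L W
  for L :: "'n::finite scal" and W :: "(real^'n) set" +
  fixes V :: "(real^'n) set" and X :: "real^'n \<Rightarrow> real^'n"
  assumes open_V: "open V" and V_W: "V \<subseteq> W" and smooth_X: "smooth_on V X"
    and X_nonzero: "\<And>x. x \<in> V \<Longrightarrow> X x \<noteq> 0"
    and X_geodesic: "\<And>x i. x \<in> V \<Longrightarrow> frechet_derivative X (at x) (X x) $ i
       = - (\<Sum>j\<in>UNIV. \<Sum>k\<in>UNIV. Gam L i j k x (X x) * X x $ j * X x $ k)"
begin

lemma mem_U_X: "x \<in> V \<Longrightarrow> (x, X x) \<in> U"
  using V_W X_nonzero by (auto simp: mem_U)

lemma has_derivative_X: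
  assumes "x \<in> V"
  shows "(X has_derivative frechet_derivative X (at x)) (at x)"
  using smooth_on_imp_has_derivative[OF smooth_X assms] .

lemma differentiable_X: "x \<in> V \<Longrightarrow> (\<lambda>x. X x $ m) differentiable (at x)"
  by (rule differentiableI[OF bounded_linear.has_derivative[OF bounded_linear_vec_nth has_derivative_X]])

lemma pd_X: "x \<in> V \<Longrightarrow> pd k (\<lambda>x. X x $ m) x = frechet_derivative X (at x) (axis k 1) $ m"
  by (rule pd_eqI[OF bounded_linear.has_derivative[OF bounded_linear_vec_nth has_derivative_X]])

lemma has_derivative_along_X:
  assumes f: "sm f" and x: "x \<in> V"
  shows "((\<lambda>x. f x (X x)) has_derivative
    (\<lambda>v. frechet_derivative (\<lambda>(x, y). f x y) (at (x, X x)) (v, frechet_derivative X (at x) v))) (at x)"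
proof -
  have 1: "((\<lambda>x. (x, X x)) has_derivative (\<lambda>v. (v, frechet_derivative X (at x) v))) (at x)"
    by (intro has_derivative_Pair has_derivative_X[OF x] has_derivative_ident)
  have 2: "((\<lambda>(x, y). f x y) has_derivative frechet_derivative (\<lambda>(x, y). f x y) (at (x, X x))) (at (x, X x))"
    using smooth_on_imp_has_derivative f mem_U_X[OF x] by (auto simp: smooth_scal_def)
  show ?thesis using has_derivative_compose[OF 1 2] by simp
qed

lemma differentiable_along_X: "sm f \<Longrightarrow> x \<in> V \<Longrightarrow> (\<lambda>x. f x (X x)) differentiable (at x)"
  by (rule differentiableI[OF has_derivative_along_X])

text \<open>The covariant derivative of \<open>X\<close> with respect to the nonlinear connection evaluated along \<open>X\<close>.\<close>

definition nabla_X :: "'n \<Rightarrow> 'n \<Rightarrow> real^'n \<Rightarrow> real" where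
  "nabla_X m k x = pd k (\<lambda>x. X x $ m) x + Nconn L m k x (X x)"

lemma pd_along_X:
  assumes f: "sm f" and x: "x \<in> V"
  shows "pd k (\<lambda>x. f x (X x)) x = hdel L k f x (X x) + (\<Sum>m\<in>UNIV. dy m f x (X x) * nabla_X m k x)"
proof -
  let ?f' = "frechet_derivative (\<lambda>(x, y). f x y) (at (x, X x))" and ?X' = "frechet_derivative X (at x)"
  have lin: "linear ?f'"
    using f mem_U_X[OF x] by (intro linear_frechet_derivative smooth_on_imp_differentiable[of U])
      (auto simp: smooth_scal_def)
  have "pd k (\<lambda>x. f x (X x)) x = ?f' (axis k 1, ?X' (axis k 1))"
    by (rule pd_eqI[OF has_derivative_along_X[OF f x]])
  also have "(axis k 1, ?X' (axis k 1)) = (axis k 1, 0) + (\<Sum>m\<in>UNIV. ?X' (axis k 1) $ m *\<^sub>R (0 :: real^'n, axis m 1))"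
    by (auto simp: prod_eq_iff fst_sum snd_sum vec_eq_iff axis_def if_distrib cong: if_cong)
  also have "?f' \<dots> = ?f' (axis k 1, 0) + (\<Sum>m\<in>UNIV. ?X' (axis k 1) $ m * ?f' (0, axis m 1))"
    by (simp only: linear_add[OF lin] linear_sum[OF lin] linear_cmul[OF lin] real_scaleR_def)
  also have "\<dots> = dx k f x (X x) + (\<Sum>m\<in>UNIV. pd k (\<lambda>x. X x $ m) x * dy m f x (X x))"
    using directional_dx[of U k] directional_dy[of U] f mem_U_X[OF x] by (simp add: directional_def pd_X[OF x])
  finally show ?thesis
    by (simp add: hdel_def nabla_X_def distrib_left sum.distrib mult.commute)
qed

text \<open>The geodesic equation.\<close>

lemma nabla_X_X:
  assumes x: "x \<in> V"
  shows "(\<Sum>k\<in>UNIV. nabla_X m k x * X x $ k) = 0"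
proof -
  let ?X' = "frechet_derivative X (at x)"
  have lin: "linear ?X'" by (rule has_derivative_linear[OF has_derivative_X[OF x]])
  have "X x = (\<Sum>k\<in>UNIV. X x $ k *\<^sub>R axis k 1)"
    by (simp add: vec_eq_iff axis_def if_distrib cong: if_cong)
  then have "?X' (X x) = ?X' (\<Sum>k\<in>UNIV. X x $ k *\<^sub>R axis k 1)"
    by (rule arg_cong)
  then have "?X' (X x) $ m = (\<Sum>k\<in>UNIV. pd k (\<lambda>x. X x $ m) x * X x $ k)"
    by (simp add: linear_sum[OF lin] linear_cmul[OF lin] pd_X[OF x] mult.commute)
  moreover have "(\<Sum>k\<in>UNIV. Nconn L m k x (X x) * X x $ k) = (\<Sum>j\<in>UNIV. \<Sum>k\<in>UNIV. Gam L m j k x (X x) * X x $ j * X x $ k)"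
    by (simp add: Nconn_eq_Gam[OF mem_U_X[OF x]] sum_distrib_right sum_distrib_left mult_ac)
  ultimately show ?thesis
    using X_geodesic[OF x, of m] by (simp add: nabla_X_def distrib_right sum.distrib)
qed

definition field_gmet :: "'n \<Rightarrow> 'n \<Rightarrow> real^'n \<Rightarrow> real" where
  "field_gmet i j x = gmet L i j x (X x)"

text \<open>The difference between the Levi-Civita connection of \<open>g(x, X(x))\<close> and the Chern connection along
  \<open>X\<close>.\<close>

definition chris_diff :: "'n \<Rightarrow> 'n \<Rightarrow> 'n \<Rightarrow> real^'n \<Rightarrow> real" where
  "chris_diff i j k x = (\<Sum>s\<in>UNIV. ginv L i s x (X x) / 2 *
     (\<Sum>m\<in>UNIV. dy m (gmet L s j) x (X x) * nabla_X m k x - dy m (gmet L j k) x (X x) * nabla_X m s x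
       + dy m (gmet L k s) x (X x) * nabla_X m j x))"

lemma christoffel_field:
  assumes x: "x \<in> V"
  shows "christoffel field_gmet i j k x = Gam L i j k x (X x) + chris_diff i j k x"
proof -
  have "christoffel field_gmet i j k x = (\<Sum>s\<in>UNIV. ginv L i s x (X x) / 2 *
      (pd k (\<lambda>x. gmet L s j x (X x)) x - pd s (\<lambda>x. gmet L j k x (X x)) x + pd j (\<lambda>x. gmet L k s x (X x)) x))"
    by (simp add: christoffel_def ginv_def field_gmet_def[abs_def])
  then show ?thesis
    unfolding Gam_def chris_diff_def pd_along_X[OF sm_gmet x] sum.distrib[symmetric]
    by (simp add: distrib_left right_diff_distrib sum.distrib sum_subtractf)
qed

lemma christoffel_field_sym:
  assumes x: "x \<in> V"
  shows "christoffel field_gmet i j k x = christoffel field_gmet i k j x"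
proof -
  have "chris_diff i j k x = chris_diff i k j x"
    unfolding chris_diff_def
    by (intro sum.cong refl arg_cong2[of _ _ _ _ "(*)"])
      (simp add: dy_gmet_sym(2)[OF mem_U_X[OF x], of _ k j] dy_gmet_sym(2)[OF mem_U_X[OF x], of _ _ j] dy_gmet_sym(2)[OF mem_U_X[OF x], of _ k])
  then show ?thesis by (simp add: christoffel_field[OF x] Gam_sym[OF mem_U_X[OF x], of i j k])
qed

text \<open>Contracted with \<open>X\<close>, two of the three terms of \<open>chris_diff\<close> vanish since the Cartan tensor annihilates the flagpole,
  and the third one since \<open>X\<close> is geodesic.\<close>

lemma christoffel_field_X:
  assumes x: "x \<in> V"
  shows "(\<Sum>j\<in>UNIV. christoffel field_gmet i j k x * X x $ j) = Nconn L i k x (X x)"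
    and "(\<Sum>j\<in>UNIV. christoffel field_gmet i k j x * X x $ j) = Nconn L i k x (X x)"
proof -
  note U = mem_U_X[OF x]
  have a: "(\<Sum>j\<in>UNIV. Gam L i j k x (X x) * X x $ j) = Nconn L i k x (X x)"
    by (simp add: Gam_sym[OF U, of i _ k] Nconn_eq_Gam[OF U])
  have "(\<Sum>j\<in>UNIV. chris_diff i j k x * X x $ j) = (\<Sum>s\<in>UNIV. ginv L i s x (X x) / 2 * 
     (\<Sum>m\<in>UNIV. (\<Sum>j\<in>UNIV. X x $ j * dy m (gmet L s j) x (X x)) * nabla_X m k x
       - (\<Sum>j\<in>UNIV. X x $ j * dy m (gmet L j k) x (X x)) * nabla_X m s x
       + dy m (gmet L k s) x (X x) * (\<Sum>j\<in>UNIV. nabla_X m j x * X x $ j)))"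
  proof -
    have sw: "(\<Sum>j\<in>UNIV. (\<Sum>s\<in>UNIV. b s * (\<Sum>m\<in>UNIV. p s m j)) * z j) = (\<Sum>s\<in>UNIV. b s * (\<Sum>m\<in>UNIV. \<Sum>j\<in>UNIV. p s m j * z j))"
      for b z :: "'n \<Rightarrow> real" and p :: "'n \<Rightarrow> 'n \<Rightarrow> 'n \<Rightarrow> real"
    proof -
      have "(\<Sum>j\<in>UNIV. (\<Sum>s\<in>UNIV. b s * (\<Sum>m\<in>UNIV. p s m j)) * z j) = (\<Sum>s\<in>UNIV. \<Sum>j\<in>UNIV. \<Sum>m\<in>UNIV. b s * (p s m j * z j))"
        unfolding sum_distrib_left sum_distrib_right by (subst sum.swap) (simp add: mult.assoc)
      also have "\<dots> = (\<Sum>s\<in>UNIV. \<Sum>m\<in>UNIV. \<Sum>j\<in>UNIV. b s * (p s m j * z j))"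
        by (intro sum.cong refl sum.swap)
      finally show ?thesis by (simp add: sum_distrib_left)
    qed
    show ?thesis unfolding chris_diff_def sw
      by (intro sum.cong refl arg_cong2[of _ _ _ _ "(*)"])
        (simp add: sum_distrib_left sum_distrib_right sum.distrib sum_subtractf algebra_simps)
  qed
  then have "(\<Sum>j\<in>UNIV. chris_diff i j k x * X x $ j) = 0"
    by (simp add: dy_gmet_radial[OF U] nabla_X_X[OF x])
  with a show *: "(\<Sum>j\<in>UNIV. christoffel field_gmet i j k x * X x $ j) = Nconn L i k x (X x)"
    by (simp add: christoffel_field[OF x] distrib_right sum.distrib)
  show "(\<Sum>j\<in>UNIV. christoffel field_gmet i k j x * X x $ j) = Nconn L i k x (X x)"
    using * by (simp only: christoffel_field_sym[OF x, of i _ k])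
qed

lemma differentiable_nabla_X:
  assumes x: "x \<in> V"
  shows "nabla_X m k differentiable (at x)"
proof -
  have "smooth_on V (\<lambda>x. frechet_derivative X (at x) (axis k 1) $ m)"
    by (rule smooth_on_bounded_linear_compose[OF open_V bounded_linear_vec_nth smooth_on_frechet[OF smooth_X]])
  then have "(\<lambda>x. frechet_derivative X (at x) (axis k 1) $ m + Nconn L m k x (X x)) differentiable (at x)"
    using x by (intro differentiable_add differentiable_along_X smooth_on_imp_differentiable[of V]) auto
  then show ?thesis
    by (rule differentiable_cong_open[OF open_V x, rotated]) (simp add: nabla_X_def pd_X)
qed

lemma differentiable_christoffel_field:
  assumes x: "x \<in> V"
  shows "christoffel field_gmet i j k differentiable (at x)"
proof -
  have "(\<lambda>x. Gam L i j k x (X x) + chris_diff i j k x) differentiable (at x)"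
    unfolding chris_diff_def using x
    by (intro differentiable_add differentiable_sum ballI finite differentiable_mult differentiable_diff differentiable_divide
        differentiable_const differentiable_along_X differentiable_nabla_X sm_Gam sm_ginv sm_dy sm_gmet) simp_all
  then show ?thesis
    by (rule differentiable_cong_open[OF open_V x, rotated]) (simp add: christoffel_field)
qed

text \<open>The bridge from the definition of flag curvature to Finsler geometry. After one
  contraction of the Riemannian curvature with \<open>X\<close> the derivatives of \<open>X\<close> enter only through \<open>nabla_X\<close>. A second
  contraction removes them, because \<open>X\<close> is geodesic and because the Levi-Civita and the Berwald
  connection both contract with \<open>X\<close> to \<open>N\<close>.\<close>

lemma riem_curv_field_eq_jacobi:
  assumes x: "x \<in> V"
  shows "(\<Sum>l\<in>UNIV. (\<Sum>j\<in>UNIV. riem_curv field_gmet i j k l x * X x $ j) * X x $ l) = jacobi i k x (X x)"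
proof -
  note U = mem_U_X[OF x]
  let ?c = "christoffel field_gmet"
  have der: "(\<Sum>j\<in>UNIV. pd k (?c i j l) x * X x $ j) = hdel L k (Nconn L i l) x (X x)
      + (\<Sum>m\<in>UNIV. dy m (Nconn L i l) x (X x) * nabla_X m k x) - (\<Sum>j\<in>UNIV. ?c i j l x * pd k (\<lambda>x. X x $ j) x)" for k l
  proof -
    have dif: "(\<lambda>x. ?c i j l x * X x $ j) differentiable (at x)" for j
      using x by (intro differentiable_mult differentiable_christoffel_field differentiable_X)
    have "pd k (\<lambda>x. \<Sum>j\<in>UNIV. ?c i j l x * X x $ j) x = pd k (\<lambda>x. Nconn L i l x (X x)) x"
      by (rule pd_cong[OF open_V x]) (use christoffel_field_X dif in \<open>auto intro!: differentiable_sum\<close>)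
    then have "(\<Sum>j\<in>UNIV. ?c i j l x * pd k (\<lambda>x. X x $ j) x + pd k (?c i j l) x * X x $ j) = pd k (\<lambda>x. Nconn L i l x (X x)) x"
      by (simp add: pd_sum dif pd_mult[OF differentiable_christoffel_field[OF x] differentiable_X[OF x]])
    then show ?thesis by (simp add: sum.distrib pd_along_X[OF sm_Nconn x])
  qed
  have quad: "(\<Sum>j\<in>UNIV. (\<Sum>m\<in>UNIV. ?c i m k x * ?c m j l x) * X x $ j) = (\<Sum>m\<in>UNIV. ?c i m k x * Nconn L m l x (X x))" for k l
    unfolding christoffel_field_X(1)[OF x, symmetric] sum_distrib_left sum_distrib_right
    by (subst sum.swap) (simp add: mult.assoc)
  have Z: "(\<Sum>m\<in>UNIV. ?c i m l x * nabla_X m k x) = (\<Sum>m\<in>UNIV. ?c i m l x * pd k (\<lambda>x. X x $ m) x) + (\<Sum>m\<in>UNIV. ?c i m l x * Nconn L m k x (X x))" for k l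
    by (simp add: nabla_X_def distrib_left sum.distrib)
  have "(\<Sum>j\<in>UNIV. riem_curv field_gmet i j k l x * X x $ j)
     = curv3 i k l x (X x) + (\<Sum>m\<in>UNIV. dy m (Nconn L i l) x (X x) * nabla_X m k x) - (\<Sum>m\<in>UNIV. dy m (Nconn L i k) x (X x) * nabla_X m l x)
       - (\<Sum>m\<in>UNIV. ?c i m l x * nabla_X m k x) + (\<Sum>m\<in>UNIV. ?c i m k x * nabla_X m l x)" for l
    unfolding riem_curv_def curv3_def left_diff_distrib distrib_right sum.distrib sum_subtractf der quad Z by simp
  moreover have "(\<Sum>l\<in>UNIV. (\<Sum>m\<in>UNIV. dy m (Nconn L i l) x (X x) * nabla_X m k x) * X x $ l) = (\<Sum>m\<in>UNIV. Nconn L i m x (X x) * nabla_X m k x)"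
    unfolding berwald_radial(2)[OF U, where i=i, symmetric] sum_distrib_left sum_distrib_right
    by (subst sum.swap) (simp add: mult_ac)
  moreover have "(\<Sum>l\<in>UNIV. (\<Sum>m\<in>UNIV. ?c i m l x * nabla_X m k x) * X x $ l) = (\<Sum>m\<in>UNIV. Nconn L i m x (X x) * nabla_X m k x)"
    unfolding christoffel_field_X(2)[OF x, of i, symmetric] sum_distrib_left sum_distrib_right
    by (subst sum.swap) (simp add: mult_ac)
  moreover have "(\<Sum>l\<in>UNIV. (\<Sum>m\<in>UNIV. b m * nabla_X m l x) * X x $ l) = 0" for b :: "'n \<Rightarrow> real"
  proof -
    have "(\<Sum>l\<in>UNIV. (\<Sum>m\<in>UNIV. b m * nabla_X m l x) * X x $ l) = (\<Sum>m\<in>UNIV. b m * (\<Sum>l\<in>UNIV. nabla_X m l x * X x $ l))"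
      unfolding sum_distrib_left sum_distrib_right by (subst sum.swap) (simp add: mult_ac)
    then show ?thesis by (simp add: nabla_X_X[OF x])
  qed
  ultimately show ?thesis
    unfolding jacobi_def by (simp only: left_diff_distrib distrib_right sum.distrib sum_subtractf)
qed

end

section \<open>Local existence of integral curves\<close>

lemma smooth_on_imp_lipschitz_cball:
  fixes f :: "'a::euclidean_space \<Rightarrow> 'a"
  assumes f: "smooth_on S f" and sub: "cball x0 r \<subseteq> S"
  obtains B where "B > 0" "\<And>x y. x \<in> cball x0 r \<Longrightarrow> y \<in> cball x0 r \<Longrightarrow> dist (f x) (f y) \<le> B * dist x y"
proof -
  let ?D = "\<lambda>x. frechet_derivative f (at x)"
  have "\<exists>M. \<forall>x\<in>cball x0 r. norm (?D x b) \<le> M" for b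
  proof -
    have "continuous_on (cball x0 r) (\<lambda>x. ?D x b)"
      using continuous_on_subset[OF smooth_on_imp_continuous_on[OF smooth_on_frechet[OF f]] sub] .
    then have "bounded ((\<lambda>x. ?D x b) ` cball x0 r)"
      by (intro compact_imp_bounded compact_continuous_image) auto
    then show ?thesis by (auto simp: bounded_iff)
  qed
  then obtain M where M: "\<And>b x. x \<in> cball x0 r \<Longrightarrow> norm (?D x b) \<le> M b" by metis
  define B where "B = (\<Sum>b\<in>Basis. \<bar>M b\<bar>) + 1"
  have "B > 0" unfolding B_def by (intro add_nonneg_pos sum_nonneg) auto
  moreover have "norm (f x - f y) \<le> B * norm (x - y)" if "x \<in> cball x0 r" "y \<in> cball x0 r" for x y
  proof (rule differentiable_bound[OF convex_cball _ _ that])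
    fix z assume z: "z \<in> cball x0 r"
    have d: "(f has_derivative ?D z) (at z)" using smooth_on_imp_has_derivative[OF f] z sub by blast
    then show "(f has_derivative ?D z) (at z within cball x0 r)" by (rule has_derivative_at_withinI)
    have lin: "linear (?D z)" using d by (rule has_derivative_linear)
    show "onorm (?D z) \<le> B"
    proof (rule onorm_le)
      fix v
      have "?D z v = ?D z (\<Sum>b\<in>Basis. (v \<bullet> b) *\<^sub>R b)" by (simp add: euclidean_representation)
      also have "\<dots> = (\<Sum>b\<in>Basis. (v \<bullet> b) *\<^sub>R ?D z b)"
        by (simp add: linear_sum[OF lin] linear_cmul[OF lin])
      also have "norm \<dots> \<le> (\<Sum>b\<in>Basis. norm v * \<bar>M b\<bar>)"
      proof (rule sum_norm_le)
        fix b :: 'a assume "b \<in> Basis"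
        then have "\<bar>v \<bullet> b\<bar> \<le> norm v" by (rule Basis_le_norm)
        moreover have "norm (?D z b) \<le> \<bar>M b\<bar>" using M[OF z, of b] by linarith
        ultimately show "norm ((v \<bullet> b) *\<^sub>R ?D z b) \<le> norm v * \<bar>M b\<bar>" by (simp add: mult_mono)
      qed
      also have "\<dots> \<le> B * norm v" by (simp add: B_def sum_distrib_left distrib_left mult.commute)
      finally show "norm (?D z v) \<le> B * norm v" .
    qed
  qed
  ultimately show ?thesis by (intro that[of B]) (auto simp: dist_norm)
qed

text \<open>The Picard operator, made into a contraction of the space of bounded continuous functions on the
  whole line by freezing the upper limit of integration outside \<open>[-e, e]\<close>. The integral from \<open>0\<close> is
  written as a difference of two integrals from \<open>-e\<close>, which accounts for the factors \<open>4 * e\<close>.\<close>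

lemma picard_global:
  fixes f :: "'a::euclidean_space \<Rightarrow> 'a"
  assumes lip: "\<And>x y. dist (f x) (f y) \<le> B * dist x y" and bd: "\<And>x. norm (f x) \<le> M"
    and "e > 0" "4 * e * B \<le> 1/2" "B > 0"
  obtains z where "z 0 = x0" "\<And>t. dist (z t) x0 \<le> 4 * e * M"
    "\<And>t. t \<in> {-e<..<e} \<Longrightarrow> (z has_vector_derivative f (z t)) (at t)"
proof -
  define c where "c t = max (-e) (min e t)" for t
  have c: "c t \<in> {-e..e}" for t using \<open>e > 0\<close> by (auto simp: c_def)
  have cont_f: "continuous_on T f" for T
    by (rule lipschitz_on_continuous_on[of B], rule lipschitz_onI) (use lip \<open>B > 0\<close> in auto)
  have cont: "continuous_on T (\<lambda>s. f (apply_bcontfun \<phi> s))" for \<phi> :: "real \<Rightarrow>\<^sub>C 'a" and T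
    by (rule continuous_on_compose2[OF cont_f]) auto
  define P where "P \<phi> t = x0 + (integral {-e..c t} (\<lambda>s. f (apply_bcontfun \<phi> s)) - integral {-e..0} (\<lambda>s. f (apply_bcontfun \<phi> s)))"
    for \<phi> :: "real \<Rightarrow>\<^sub>C 'a" and t
  have M: "M \<ge> 0" by (rule order_trans[OF norm_ge_zero bd[of x0]])
  have bound: "norm (integral {-e..t} g) \<le> K * (2 * e)"
    if "t \<in> {-e..e}" "continuous_on {-e..t} g" "\<And>s. norm (g s) \<le> K" for t K and g :: "real \<Rightarrow> 'a"
  proof -
    have "K \<ge> 0" by (rule order_trans[OF norm_ge_zero that(3)[of 0]])
    have "norm (integral {-e..t} g) \<le> K * (t - (-e))"
      using that by (intro integral_bound) auto
    also have "\<dots> \<le> K * (2 * e)" using that \<open>K \<ge> 0\<close> by (intro mult_left_mono) auto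
    finally show ?thesis .
  qed
  have near: "dist (P \<phi> t) x0 \<le> 4 * e * M" for \<phi> t
  proof -
    have "norm (P \<phi> t - x0) \<le> norm (integral {-e..c t} (\<lambda>s. f (apply_bcontfun \<phi> s))) + norm (integral {-e..0} (\<lambda>s. f (apply_bcontfun \<phi> s)))"
      unfolding P_def using norm_triangle_ineq4 by simp
    also have "\<dots> \<le> M * (2 * e) + M * (2 * e)"
      by (intro add_mono bound cont bd c) (use \<open>e > 0\<close> in simp)
    finally show ?thesis by (simp add: dist_norm mult_ac)
  qed
  have "P \<phi> \<in> bcontfun" for \<phi>
  proof -
    have c1: "continuous_on UNIV c" unfolding c_def by (intro continuous_intros)
    have c2: "continuous_on {-e..e} (\<lambda>t. integral {-e..t} (\<lambda>s. f (apply_bcontfun \<phi> s)))"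
      by (intro indefinite_integral_continuous_1 integrable_continuous_real cont)
    have "continuous_on UNIV (\<lambda>t. integral {-e..c t} (\<lambda>s. f (apply_bcontfun \<phi> s)))"
      by (rule continuous_on_compose2[OF c2 c1]) (use c in blast)
    then have "continuous_on UNIV (P \<phi>)" unfolding P_def by (intro continuous_intros)
    moreover have "bounded (range (P \<phi>))"
      by (rule bounded_subset[OF bounded_cball[of x0 "4 * e * M"]]) (use near in \<open>auto simp: dist_commute\<close>)
    ultimately show ?thesis by (simp add: bcontfun_def)
  qed
  then have P: "apply_bcontfun (Bcontfun (P \<phi>)) = P \<phi>" for \<phi> by (rule Bcontfun_inverse)
  have "\<exists>!\<phi>. Bcontfun (P \<phi>) = \<phi>"
  proof (rule banach_fix_type)
    show "0 \<le> (1/2::real)" "1/2 < (1::real)" by auto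
    show "\<forall>\<phi> \<psi>. dist (Bcontfun (P \<phi>)) (Bcontfun (P \<psi>)) \<le> 1/2 * dist \<phi> \<psi>"
    proof (intro allI dist_bound)
      fix \<phi> \<psi> :: "real \<Rightarrow>\<^sub>C 'a" and t
      let ?g = "\<lambda>s. f (apply_bcontfun \<phi> s) - f (apply_bcontfun \<psi> s)"
      have gb: "norm (?g s) \<le> B * dist \<phi> \<psi>" for s
      proof -
        have "dist (f (apply_bcontfun \<phi> s)) (f (apply_bcontfun \<psi> s)) \<le> B * dist (apply_bcontfun \<phi> s) (apply_bcontfun \<psi> s)"
          by (rule lip)
        also have "\<dots> \<le> B * dist \<phi> \<psi>" using \<open>B > 0\<close> by (intro mult_left_mono dist_bounded) simp
        finally show ?thesis by (simp only: dist_norm)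
      qed
      have split: "integral {-e..u} ?g = integral {-e..u} (\<lambda>s. f (apply_bcontfun \<phi> s)) - integral {-e..u} (\<lambda>s. f (apply_bcontfun \<psi> s))" for u
        by (intro integral_diff integrable_continuous_real cont)
      have "dist (P \<phi> t) (P \<psi> t) = norm (integral {-e..c t} ?g - integral {-e..0} ?g)"
        unfolding split P_def dist_norm by (simp add: algebra_simps)
      also have "\<dots> \<le> norm (integral {-e..c t} ?g) + norm (integral {-e..0} ?g)"
        by (rule norm_triangle_ineq4)
      also have "\<dots> \<le> (B * dist \<phi> \<psi>) * (2 * e) + (B * dist \<phi> \<psi>) * (2 * e)"
        by (intro add_mono bound continuous_on_diff cont gb c) (use \<open>e > 0\<close> in simp)
      also have "\<dots> = (4 * e * B) * dist \<phi> \<psi>" by simp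
      also have "\<dots> \<le> 1/2 * dist \<phi> \<psi>" using assms(4) by (intro mult_right_mono) auto
      finally show "dist (apply_bcontfun (Bcontfun (P \<phi>)) t) (apply_bcontfun (Bcontfun (P \<psi>)) t) \<le> 1/2 * dist \<phi> \<psi>"
        unfolding P .
    qed
  qed
  then obtain \<phi> where "Bcontfun (P \<phi>) = \<phi>" by blast
  with P[of \<phi>] have fix_P: "apply_bcontfun \<phi> = P \<phi>" by (simp only:)
  show ?thesis
  proof (rule that[of "apply_bcontfun \<phi>"])
    show "apply_bcontfun \<phi> 0 = x0" 
    proof -
      have "P \<phi> 0 = x0" using \<open>e > 0\<close> by (simp add: P_def c_def)
      then show ?thesis using fun_cong[OF fix_P, of 0] by simp
    qed
    show "dist (apply_bcontfun \<phi> t) x0 \<le> 4 * e * M" for t unfolding fix_P by (rule near)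
    fix t assume t: "t \<in> {-e<..<e}"
    have "((\<lambda>u. integral {-e..u} (\<lambda>s. f (apply_bcontfun \<phi> s))) has_vector_derivative f (apply_bcontfun \<phi> t)) (at t within {-e..e})"
      by (rule integral_has_vector_derivative[OF cont]) (use t in auto)
    then have "((\<lambda>u. integral {-e..u} (\<lambda>s. f (apply_bcontfun \<phi> s))) has_vector_derivative f (apply_bcontfun \<phi> t)) (at t within {-e<..<e})"
      by (rule has_vector_derivative_within_subset) auto
    then have "((\<lambda>u. integral {-e..u} (\<lambda>s. f (apply_bcontfun \<phi> s))) has_vector_derivative f (apply_bcontfun \<phi> t)) (at t)"
      unfolding at_within_open[OF t open_greaterThanLessThan] .
    then have "((\<lambda>u. x0 + (integral {-e..u} (\<lambda>s. f (apply_bcontfun \<phi> s)) - integral {-e..0} (\<lambda>s. f (apply_bcontfun \<phi> s))))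
        has_vector_derivative f (apply_bcontfun \<phi> t)) (at t)"
      using has_vector_derivative_add[OF has_vector_derivative_const has_vector_derivative_diff[OF _ has_vector_derivative_const]]
      by fastforce
    then have "(P \<phi> has_vector_derivative f (apply_bcontfun \<phi> t)) (at t)"
      by (rule has_vector_derivative_transform_within_open[OF _ _ t]) (auto simp: P_def c_def)
    then show "(apply_bcontfun \<phi> has_vector_derivative f (apply_bcontfun \<phi> t)) (at t)"
      unfolding fix_P[symmetric] .
  qed
qed

text \<open>Precomposing with the projection onto a closed ball makes the field globally bounded and Lipschitz; a
  solution for a short time does not leave the ball and therefore never meets the modification.\<close>

lemma picard_local:
  fixes f :: "'a::euclidean_space \<Rightarrow> 'a"
  assumes "open S" "smooth_on S f" "x0 \<in> S"
  obtains e z where "e > 0" "z 0 = x0" "\<And>t. t \<in> {-e<..<e} \<Longrightarrow> z t \<in> S"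
    "\<And>t. t \<in> {-e<..<e} \<Longrightarrow> (z has_vector_derivative f (z t)) (at t)"
proof -
  obtain r where r: "r > 0" "cball x0 r \<subseteq> S" using assms(1,3) open_contains_cball by metis
  let ?C = "cball x0 r" and ?p = "closest_point (cball x0 r)"
  have ne: "?C \<noteq> {}" using r by auto
  have p_in: "?p x \<in> ?C" for x by (rule closest_point_in_set[OF closed_cball ne])
  obtain B where B: "B > 0" "\<And>x y. x \<in> ?C \<Longrightarrow> y \<in> ?C \<Longrightarrow> dist (f x) (f y) \<le> B * dist x y"
    using smooth_on_imp_lipschitz_cball[OF assms(2) r(2)] by metis
  have "continuous_on ?C f"
    by (rule continuous_on_subset[OF smooth_on_imp_continuous_on[OF assms(2)] r(2)])
  then have "bounded (f ` ?C)" by (intro compact_imp_bounded compact_continuous_image) auto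
  then obtain M where M: "M > 0" "\<And>x. x \<in> ?C \<Longrightarrow> norm (f x) \<le> M" by (auto simp: bounded_pos)
  \<comment> \<open>The first bound makes the Picard operator a contraction, the second keeps the solution in the ball.\<close>
  define e where "e = min (1 / (8 * B)) (r / (4 * M))"
  have e: "e > 0" "4 * e * B \<le> 1/2" "4 * e * M \<le> r"
  proof -
    show "e > 0" using B M r by (simp add: e_def)
    have "e \<le> 1 / (8 * B)" "e \<le> r / (4 * M)" by (auto simp: e_def)
    then show "4 * e * B \<le> 1/2" "4 * e * M \<le> r" using B(1) M(1) by (simp_all add: field_simps)
  qed
  have "dist (f (?p x)) (f (?p y)) \<le> B * dist x y" for x y
  proof -
    have "dist (f (?p x)) (f (?p y)) \<le> B * dist (?p x) (?p y)" by (intro B p_in)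
    also have "\<dots> \<le> B * dist x y"
      using B(1) closest_point_lipschitz[OF convex_cball closed_cball ne] by (intro mult_left_mono) auto
    finally show ?thesis .
  qed
  then obtain z where z: "z 0 = x0" "\<And>t. dist (z t) x0 \<le> 4 * e * M"
    "\<And>t. t \<in> {-e<..<e} \<Longrightarrow> (z has_vector_derivative f (?p (z t))) (at t)"
    using picard_global[of "\<lambda>x. f (?p x)" B M e x0, OF _ M(2)[OF p_in] e(1,2) B(1)] by metis
  have in_C: "z t \<in> ?C" for t using z(2)[of t] e(3) by (auto simp: dist_commute)
  have self: "?p (z t) = z t" for t using in_C by (rule closest_point_self)
  show ?thesis
  proof (rule that[of e z, OF e(1) z(1)])
    show "z t \<in> S" for t using in_C r(2) by blast
    show "(z has_vector_derivative f (z t)) (at t)" if "t \<in> {-e<..<e}" for t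
      using z(3)[OF that] unfolding self .
  qed
qed

section \<open>From the manifold to charts\<close>

locale smooth_mfd =
  fixes M :: "'m topology" and A :: "('m, 'n::finite) chart set"
  assumes mfd: "smooth_manifold M A"
begin

lemma chart: "c \<in> A \<Longrightarrow> is_chart M c"
  and compat: "c \<in> A \<Longrightarrow> d \<in> A \<Longrightarrow> compatible c d"
  using mfd by (auto simp: smooth_manifold_def)

lemma openin_dom: "c \<in> A \<Longrightarrow> openin M (dom_ch c)"
  and open_img: "c \<in> A \<Longrightarrow> open (img_ch c)"
  and homeo: "c \<in> A \<Longrightarrow> homeomorphic_map (subtopology M (dom_ch c)) (top_of_set (img_ch c)) (map_ch c)"
  using chart by (auto simp: is_chart_def)

lemma dom_subset: "c \<in> A \<Longrightarrow> dom_ch c \<subseteq> topspace M"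
  by (rule openin_subset[OF openin_dom])

lemma inj_chart:
  assumes "c \<in> A"
  shows "inj_on (map_ch c) (dom_ch c)"
  using homeomorphic_imp_injective_map[OF homeo[OF assms]] dom_subset[OF assms] by (simp add: Int_absorb1)

lemma inv_map [simp]: "c \<in> A \<Longrightarrow> p \<in> dom_ch c \<Longrightarrow> inv_ch c (map_ch c p) = p"
  by (rule inv_into_f_f[OF inj_chart])

lemma map_inv [simp]: "x \<in> img_ch c \<Longrightarrow> map_ch c (inv_ch c x) = x"
  by (rule f_inv_into_f)

lemma inv_in_dom: "x \<in> img_ch c \<Longrightarrow> inv_ch c x \<in> dom_ch c"
  by (rule inv_into_into)

lemma open_map_image:
  assumes c: "c \<in> A" and V: "openin M V"
  shows "open (map_ch c ` (V \<inter> dom_ch c))"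
proof -
  have "openin (subtopology M (dom_ch c)) (V \<inter> dom_ch c)"
    using V by (auto simp: openin_subtopology)
  then have "openin (top_of_set (img_ch c)) (map_ch c ` (V \<inter> dom_ch c))"
    using homeomorphic_map_openness[OF homeo[OF c]] openin_subset by blast
  then show ?thesis using openin_open_trans open_img[OF c] by blast
qed

lemma continuous_inv:
  assumes c: "c \<in> A"
  shows "continuous_map (top_of_set (img_ch c)) M (inv_ch c)"
proof -
  have "openin (top_of_set (img_ch c)) {x \<in> img_ch c. inv_ch c x \<in> V}" if V: "openin M V" for V
  proof -
    have "{x \<in> img_ch c. inv_ch c x \<in> V} = map_ch c ` (V \<inter> dom_ch c)"
      using c inv_in_dom[of _ c] map_inv[of _ c] by (force simp: image_iff)
    moreover have "map_ch c ` (V \<inter> dom_ch c) \<subseteq> img_ch c" by blast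
    ultimately show ?thesis
      using open_map_image[OF c V] open_openin_trans[OF open_img[OF c]] by metis
  qed
  then show ?thesis
    using inv_in_dom[of _ c] dom_subset[OF c] by (auto simp: continuous_map_def Pi_iff subset_iff)
qed

lemma transition:
  assumes c: "c \<in> A" and d: "d \<in> A"
  shows "open (map_ch d ` (dom_ch c \<inter> dom_ch d))"
    "smooth_on (map_ch d ` (dom_ch c \<inter> dom_ch d)) (map_ch c \<circ> inv_ch d)"
  using open_map_image[OF d openin_dom[OF c]] compat[OF c d] by (auto simp: compatible_def)

lemma smooth_near_coord:
  assumes c: "c \<in> A" and p: "p \<in> dom_ch c"
  shows "smooth_near M A p (\<lambda>q. map_ch c q $ i)"
  unfolding smooth_near_def
proof (intro exI conjI ballI)
  show "openin M (dom_ch c)" by (rule openin_dom[OF c])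
  show "p \<in> dom_ch c" by (rule p)
  fix d assume d: "d \<in> A"
  show "smooth_on (map_ch d ` (dom_ch c \<inter> dom_ch d)) ((\<lambda>q. map_ch c q $ i) \<circ> inv_ch d)"
    using smooth_on_bounded_linear_compose[OF transition(1)[OF c d] bounded_linear_vec_nth transition(2)[OF c d]]
    by (simp add: o_def)
qed

lemma smooth_near_in_chart:
  assumes "smooth_near M A p f" and c: "c \<in> A" and p: "p \<in> dom_ch c"
  obtains S where "open S" "map_ch c p \<in> S" "smooth_on S (f \<circ> inv_ch c)"
proof -
  obtain V where V: "openin M V" "p \<in> V" "\<And>c. c \<in> A \<Longrightarrow> smooth_on (map_ch c ` (V \<inter> dom_ch c)) (f \<circ> inv_ch c)"
    using assms(1) unfolding smooth_near_def by blast
  show ?thesis using V p by (intro that[OF open_map_image[OF c V(1)] _ V(3)[OF c]]) auto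
qed

lemma has_derivative_in_chart:
  assumes "smooth_near M A p f" and c: "c \<in> A" and p: "p \<in> dom_ch c"
  shows "((f \<circ> inv_ch c) has_derivative frechet_derivative (f \<circ> inv_ch c) (at (map_ch c p))) (at (map_ch c p))"
  using smooth_near_in_chart[OF assms] smooth_on_imp_has_derivative by metis

lemma tvec_eq:
  assumes f: "smooth_near M A p f" and c: "c \<in> A" and p: "p \<in> dom_ch c"
  shows "tvec M A c p y f = frechet_derivative (f \<circ> inv_ch c) (at (map_ch c p)) y"
proof -
  note D = has_derivative_in_chart[OF assms]
  have lin: "linear (frechet_derivative (f \<circ> inv_ch c) (at (map_ch c p)))" using D by (rule has_derivative_linear)
  have "y = (\<Sum>k\<in>UNIV. y $ k *\<^sub>R axis k 1)"
    by (simp add: vec_eq_iff axis_def if_distrib cong: if_cong)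
  then have "frechet_derivative (f \<circ> inv_ch c) (at (map_ch c p)) y
      = frechet_derivative (f \<circ> inv_ch c) (at (map_ch c p)) (\<Sum>k\<in>UNIV. y $ k *\<^sub>R axis k 1)"
    by (rule arg_cong)
  then show ?thesis
    using f by (simp add: tvec_def pd_eqI[OF D] linear_sum[OF lin] linear_cmul[OF lin])
qed

lemma comps_tvec:
  assumes c: "c \<in> A" and d: "d \<in> A" and p: "p \<in> dom_ch c" "p \<in> dom_ch d"
  shows "comps c (tvec M A d p y) = frechet_derivative (map_ch c \<circ> inv_ch d) (at (map_ch d p)) y"
proof -
  have D: "((map_ch c \<circ> inv_ch d) has_derivative frechet_derivative (map_ch c \<circ> inv_ch d) (at (map_ch d p))) (at (map_ch d p))"
    by (rule smooth_on_imp_has_derivative[OF transition(2)[OF c d]]) (use p in blast)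
  have "frechet_derivative ((\<lambda>q. map_ch c q $ i) \<circ> inv_ch d) (at (map_ch d p))
      = (\<lambda>v. frechet_derivative (map_ch c \<circ> inv_ch d) (at (map_ch d p)) v $ i)" for i
    using bounded_linear.has_derivative[OF bounded_linear_vec_nth D]
    by (intro frechet_derivative_eqI) (simp add: o_def)
  then show ?thesis
    by (simp add: comps_def tvec_eq[OF smooth_near_coord[OF c p(1)] d p(2)] vec_eq_iff)
qed

lemma comps_tvec_same:
  assumes c: "c \<in> A" and p: "p \<in> dom_ch c"
  shows "comps c (tvec M A c p y) = y"
proof -
  have "((map_ch c \<circ> inv_ch c) has_derivative (\<lambda>v. v)) (at (map_ch c p))"
    by (rule has_derivative_transform_within_open[OF has_derivative_ident open_img[OF c]]) (use p in auto)
  then show ?thesis by (simp add: comps_tvec[OF c c p p] frechet_derivative_eqI)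
qed

text \<open>A tangent vector may be given by another chart; the chain rule for the transition map says that
  its components transform as they should.\<close>

lemma tvec_comps:
  assumes c: "c \<in> A" and p: "p \<in> dom_ch c" and v: "v \<in> tangent_space M A p"
  shows "tvec M A c p (comps c v) = v"
proof
  fix f
  obtain d y where d: "d \<in> A" "p \<in> dom_ch d" and v: "v = tvec M A d p y"
    using v by (auto simp: tangent_space_def)
  show "tvec M A c p (comps c v) f = v f"
  proof (cases "smooth_near M A p f")
    case True
    let ?T = "map_ch c \<circ> inv_ch d" and ?S = "map_ch d ` (dom_ch c \<inter> dom_ch d)"
    have T: "(?T has_derivative frechet_derivative ?T (at (map_ch d p))) (at (map_ch d p))"
      by (rule smooth_on_imp_has_derivative[OF transition(2)[OF c d(1)]]) (use p d in blast)
    have Tp: "?T (map_ch d p) = map_ch c p" using d by simp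
    have "((f \<circ> inv_ch c) has_derivative frechet_derivative (f \<circ> inv_ch c) (at (map_ch c p))) (at (?T (map_ch d p)))"
      unfolding Tp by (rule has_derivative_in_chart[OF True c p])
    from has_derivative_compose[OF T this]
    have "((\<lambda>x. (f \<circ> inv_ch c) (?T x)) has_derivative
      (\<lambda>v. frechet_derivative (f \<circ> inv_ch c) (at (map_ch c p)) (frechet_derivative ?T (at (map_ch d p)) v))) (at (map_ch d p))" .
    then have "((f \<circ> inv_ch d) has_derivative
      (\<lambda>v. frechet_derivative (f \<circ> inv_ch c) (at (map_ch c p)) (frechet_derivative ?T (at (map_ch d p)) v))) (at (map_ch d p))"
      by (rule has_derivative_transform_within_open[OF _ transition(1)[OF c d(1)]]) (use c d p in auto)
    then show ?thesis
      unfolding v tvec_eq[OF True c p] tvec_eq[OF True d] comps_tvec[OF c d(1) p d(2)]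
      by (simp add: frechet_derivative_eqI)
  next
    case False
    then show ?thesis by (simp add: v tvec_def)
  qed
qed

lemma tvec_0: "tvec M A c p 0 = (\<lambda>f. 0)"
  by (simp add: tvec_def fun_eq_iff)

lemma finsler_chart_local_expr:
  assumes F: "finsler_structure M A F" and c: "c \<in> A"
  shows "finsler_chart (local_expr M A F c) (img_ch c)"
proof
  show "open (img_ch c)" by (rule open_img[OF c])
  show "smooth_on {(x, y). x \<in> img_ch c \<and> y \<noteq> 0} (\<lambda>(x, y). local_expr M A F c x y)"
    using F c by (simp add: finsler_structure_def)
  show "local_expr M A F c x (r *\<^sub>R y) = r * local_expr M A F c x y" if x: "x \<in> img_ch c" and "r > 0" for x y r
  proof -
    let ?p = "inv_ch c x"
    have p: "?p \<in> dom_ch c" by (rule inv_in_dom[OF x])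
    have "tvec M A c ?p (r *\<^sub>R y) = (\<lambda>f. r * tvec M A c ?p y f)"
      by (simp add: tvec_def fun_eq_iff sum_distrib_left mult.assoc)
    moreover have "tvec M A c ?p y \<in> tangent_space M A ?p" using c p unfolding tangent_space_def by blast
    ultimately show ?thesis
      using F p dom_subset[OF c] \<open>r > 0\<close> by (auto simp: finsler_structure_def local_expr_def)
  qed
  show "0 < (\<Sum>i\<in>UNIV. \<Sum>j\<in>UNIV. gmet (local_expr M A F c) i j x y * u $ i * u $ j)"
    if "x \<in> img_ch c" "y \<noteq> 0" "u \<noteq> 0" for x y u
    using F c that unfolding finsler_structure_def by blast
qed

text \<open>That \<open>X\<close> is a geodesic field is known of its integral curves only. Existence of an integral curve through
  every point turns it into a differential equation for \<open>X\<close>: differentiate the velocity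
  \<open>\<xi> \<circ> z\<close> of the curve \<open>z\<close> once by the chain rule and once by the geodesic equation.\<close>

lemma geodesic_field_in_chart:
  assumes X: "geodesic_field_on M A F V X" and V: "openin M V" and c: "c \<in> A"
    and x: "x \<in> map_ch c ` (V \<inter> dom_ch c)"
  defines "\<xi> \<equiv> \<lambda>x. comps c (X (inv_ch c x))"
  shows "\<xi> x \<noteq> 0"
    and "frechet_derivative \<xi> (at x) (\<xi> x) $ i
      = - (\<Sum>j\<in>UNIV. \<Sum>k\<in>UNIV. Gam (local_expr M A F c) i j k x (\<xi> x) * \<xi> x $ j * \<xi> x $ k)"
proof -
  let ?W = "map_ch c ` (V \<inter> dom_ch c)"
  have vf: "vector_field_on M A V X" and ne: "\<And>p. p \<in> V \<Longrightarrow> X p \<noteq> (\<lambda>f. 0)"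
    and geo: "\<And>I \<gamma>. integral_curve M A V X I \<gamma> \<Longrightarrow> geodesic M A F I \<gamma>"
    using X by (auto simp: geodesic_field_on_def)
  have W: "open ?W" by (rule open_map_image[OF c V])
  have sm: "smooth_on ?W \<xi>" using vf c by (simp add: vector_field_on_def \<xi>_def)
  have inV: "inv_ch c x \<in> V \<inter> dom_ch c" if "x \<in> ?W" for x using that c by auto
  have img: "x \<in> img_ch c" if "x \<in> ?W" for x using that by auto
  have X_eq: "X (inv_ch c x) = tvec M A c (inv_ch c x) (\<xi> x)" if "x \<in> ?W" for x
    using tvec_comps[OF c, of "inv_ch c x" "X (inv_ch c x)"] inV[OF that] vf
    by (auto simp: vector_field_on_def \<xi>_def)
  show "\<xi> x \<noteq> 0"
  proof
    assume "\<xi> x = 0"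
    then have "X (inv_ch c x) = (\<lambda>f. 0)" using X_eq[OF x] tvec_0[of c "inv_ch c x"] by simp
    then show False using ne[of "inv_ch c x"] inV[OF x] by blast
  qed
  obtain e z where e: "e > 0" and z0: "z 0 = x" and zW: "\<And>t. t \<in> {-e<..<e} \<Longrightarrow> z t \<in> ?W"
    and z': "\<And>t. t \<in> {-e<..<e} \<Longrightarrow> (z has_vector_derivative \<xi> (z t)) (at t)"
    using picard_local[OF W sm x] by metis
  define I where "I = {-e<..<e}"
  define \<gamma> where "\<gamma> = inv_ch c \<circ> z"
  have oI: "open I" and I0: "0 \<in> I" using e by (auto simp: I_def)
  have cz: "continuous_on I z"
    using z' unfolding I_def
    by (intro continuous_at_imp_continuous_on ballI) (blast intro: has_vector_derivative_continuous)
  have "integral_curve M A V X I \<gamma>"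
    unfolding integral_curve_def
  proof (intro conjI ballI allI impI)
    show "open I" by (rule oI)
    show "is_interval I" by (simp add: I_def is_interval_oo)
    have "continuous_map (top_of_set I) (top_of_set (img_ch c)) z"
      using cz zW img by (auto simp: I_def)
    then show "continuous_map (top_of_set I) M \<gamma>"
      unfolding \<gamma>_def by (rule continuous_map_compose[OF _ continuous_inv[OF c]])
    show "\<gamma> ` I \<subseteq> V" using zW inV by (auto simp: I_def \<gamma>_def)
    fix t f assume t: "t \<in> I" and f: "smooth_near M A (\<gamma> t) f"
    have zt: "z t \<in> ?W" using zW t by (simp add: I_def)
    have p: "\<gamma> t \<in> dom_ch c" using inV[OF zt] by (simp add: \<gamma>_def)
    have m: "map_ch c (\<gamma> t) = z t" using img[OF zt] by (simp add: \<gamma>_def)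
    have D: "((f \<circ> inv_ch c) has_derivative frechet_derivative (f \<circ> inv_ch c) (at (z t))) (at (z t))"
      using has_derivative_in_chart[OF f c p] unfolding m .
    have lin: "linear (frechet_derivative (f \<circ> inv_ch c) (at (z t)))" using D by (rule has_derivative_linear)
    have zd: "(z has_derivative (\<lambda>s. s *\<^sub>R \<xi> (z t))) (at t)"
      using z' t by (simp add: I_def has_vector_derivative_def)
    have "((\<lambda>s. (f \<circ> inv_ch c) (z s)) has_derivative (\<lambda>s. frechet_derivative (f \<circ> inv_ch c) (at (z t)) (s *\<^sub>R \<xi> (z t)))) (at t)"
      using has_derivative_compose[OF zd D] .
    moreover have "X (\<gamma> t) f = frechet_derivative (f \<circ> inv_ch c) (at (z t)) (\<xi> (z t))"
      using X_eq[OF zt] tvec_eq[OF f c p] m by (simp add: \<gamma>_def)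
    moreover have "f \<circ> \<gamma> = (\<lambda>s. (f \<circ> inv_ch c) (z s))" by (simp add: \<gamma>_def fun_eq_iff)
    moreover have "(\<lambda>s. frechet_derivative (f \<circ> inv_ch c) (at (z t)) (s *\<^sub>R \<xi> (z t)))
        = (*) (frechet_derivative (f \<circ> inv_ch c) (at (z t)) (\<xi> (z t)))"
      by (simp add: fun_eq_iff linear_cmul[OF lin])
    ultimately show "((f \<circ> \<gamma>) has_real_derivative X (\<gamma> t) f) (at t)"
      by (simp only: has_field_derivative_def)
  qed
  then have "geodesic M A F I \<gamma>" by (rule geo)
  moreover have "\<gamma> 0 \<in> dom_ch c" using inV[OF x] by (simp add: \<gamma>_def z0)
  ultimately have g: "((\<lambda>s. vector_derivative (map_ch c \<circ> \<gamma>) (at s)) has_vector_derivative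
      (\<chi> i. - (\<Sum>j\<in>UNIV. \<Sum>k\<in>UNIV. Gam (local_expr M A F c) i j k ((map_ch c \<circ> \<gamma>) 0) (vector_derivative (map_ch c \<circ> \<gamma>) (at 0))
        * vector_derivative (map_ch c \<circ> \<gamma>) (at 0) $ j * vector_derivative (map_ch c \<circ> \<gamma>) (at 0) $ k))) (at 0)"
    using c I0 unfolding geodesic_def Let_def by blast
  have zg: "(map_ch c \<circ> \<gamma>) s = z s" if "s \<in> I" for s
    using img[OF zW] that by (simp add: \<gamma>_def I_def)
  have vd: "vector_derivative (map_ch c \<circ> \<gamma>) (at s) = \<xi> (z s)" if s: "s \<in> I" for s
  proof (rule vector_derivative_at)
    show "((map_ch c \<circ> \<gamma>) has_vector_derivative \<xi> (z s)) (at s)"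
      by (rule has_vector_derivative_transform_within_open[OF _ oI s])
        (use z' s zg in \<open>auto simp: I_def\<close>)
  qed
  let ?acc = "\<chi> i. - (\<Sum>j\<in>UNIV. \<Sum>k\<in>UNIV. Gam (local_expr M A F c) i j k x (\<xi> x) * \<xi> x $ j * \<xi> x $ k)"
  \<comment> \<open>The same derivative, computed from the geodesic equation and from the chain rule.\<close>
  have g1: "((\<lambda>s. vector_derivative (map_ch c \<circ> \<gamma>) (at s)) has_vector_derivative ?acc) (at 0)"
    using g unfolding vd[OF I0] zg[OF I0] z0 .
  have g1': "((\<lambda>s. \<xi> (z s)) has_vector_derivative ?acc) (at 0)"
    by (rule has_vector_derivative_transform_within_open[OF g1 oI I0]) (rule vd)
  have zd: "(z has_derivative (\<lambda>s. s *\<^sub>R \<xi> x)) (at 0)"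
    using z'[of 0] e by (simp add: has_vector_derivative_def z0)
  have xd: "(\<xi> has_derivative frechet_derivative \<xi> (at x)) (at (z 0))"
    unfolding z0 by (rule smooth_on_imp_has_derivative[OF sm x])
  have "((\<lambda>s. \<xi> (z s)) has_derivative (\<lambda>s. frechet_derivative \<xi> (at x) (s *\<^sub>R \<xi> x))) (at 0)"
    using has_derivative_compose[OF zd xd] .
  then have g2: "((\<lambda>s. \<xi> (z s)) has_vector_derivative frechet_derivative \<xi> (at x) (\<xi> x)) (at 0)"
    using has_derivative_linear[OF xd] by (simp add: has_vector_derivative_def linear_cmul)
  have "frechet_derivative \<xi> (at x) (\<xi> x) = ?acc"
    by (rule vector_derivative_unique_at[OF g2 g1'])
  then show "frechet_derivative \<xi> (at x) (\<xi> x) $ i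
      = - (\<Sum>j\<in>UNIV. \<Sum>k\<in>UNIV. Gam (local_expr M A F c) i j k x (\<xi> x) * \<xi> x $ j * \<xi> x $ k)"
    by simp
qed

end

section \<open>Constant flag curvature\<close>

context finsler_chart
begin

text \<open>The strict Cauchy-Schwarz inequality: the denominator of the flag curvature is positive.\<close>

lemma flag_gram_pos:
  assumes xy: "(x, y) \<in> U" and ind: "\<And>t. u \<noteq> t *\<^sub>R y"
  shows "0 < energy x y * (\<Sum>i\<in>UNIV. \<Sum>j\<in>UNIV. gmet L i j x y * u $ i * u $ j) - (\<Sum>i\<in>UNIV. ylow i x y * u $ i)\<^sup>2"
proof -
  define E where "E = energy x y"
  define b where "b = (\<Sum>i\<in>UNIV. ylow i x y * u $ i)"
  let ?q = "\<Sum>i\<in>UNIV. \<Sum>j\<in>UNIV. gmet L i j x y * u $ i * u $ j"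
  have E: "E > 0" unfolding E_def by (rule energy_pos[OF xy])
  \<comment> \<open>\<open>E\<close> times the component of \<open>u\<close> orthogonal to \<open>y\<close>.\<close>
  let ?w = "E *\<^sub>R u - b *\<^sub>R y"
  have "?w \<noteq> 0"
  proof
    assume "?w = 0"
    then have w: "E *\<^sub>R u = b *\<^sub>R y" by simp
    have "u = inverse E *\<^sub>R (E *\<^sub>R u)" using E by simp
    then have "u = (inverse E * b) *\<^sub>R y" unfolding w by simp
    then show False using ind by blast
  qed
  then have "0 < (\<Sum>i\<in>UNIV. \<Sum>j\<in>UNIV. gmet L i j x y * ?w $ i * ?w $ j)"
    using gmet_pos[of x y ?w] xy by (simp add: mem_U)
  also have "\<dots> = E * E * ?q
      - E * b * (\<Sum>i\<in>UNIV. u $ i * (\<Sum>j\<in>UNIV. gmet L i j x y * y $ j))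
      - E * b * (\<Sum>i\<in>UNIV. \<Sum>j\<in>UNIV. gmet L i j x y * y $ i * u $ j)
      + b * b * (\<Sum>i\<in>UNIV. y $ i * (\<Sum>j\<in>UNIV. gmet L i j x y * y $ j))"
    unfolding sum_distrib_left sum.distrib[symmetric] sum_subtractf[symmetric]
    by (intro sum.cong refl) (simp add: algebra_simps)
  also have "(\<Sum>i\<in>UNIV. \<Sum>j\<in>UNIV. gmet L i j x y * y $ i * u $ j) = (\<Sum>j\<in>UNIV. u $ j * (\<Sum>i\<in>UNIV. gmet L i j x y * y $ i))"
    unfolding sum_distrib_left by (subst sum.swap) (simp add: mult_ac)
  also have "\<dots> = b" by (simp only: gmet_radial[OF xy]) (simp only: b_def mult.commute)
  also have "(\<Sum>i\<in>UNIV. u $ i * (\<Sum>j\<in>UNIV. gmet L i j x y * y $ j)) = b"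
    by (simp only: gmet_radial[OF xy]) (simp only: b_def mult.commute)
  also have "(\<Sum>i\<in>UNIV. y $ i * (\<Sum>j\<in>UNIV. gmet L i j x y * y $ j)) = E"
    unfolding E_def ylow_radial[OF xy, symmetric]
    by (simp only: gmet_radial[OF xy]) (simp only: mult.commute)
  finally have "0 < E * (E * ?q - b\<^sup>2)" by (simp add: algebra_simps power2_eq_square)
  then show ?thesis using E by (simp add: zero_less_mult_iff E_def b_def)
qed

lemma jacobi_quadratic_dependent:
  assumes xy: "(x, y) \<in> U" and u: "u = t *\<^sub>R y"
  shows "(\<Sum>j\<in>UNIV. \<Sum>k\<in>UNIV. (\<Sum>m\<in>UNIV. gmet L j m x y * jacobi m k x y) * u $ j * u $ k)
      = c * (energy x y * (\<Sum>j\<in>UNIV. \<Sum>k\<in>UNIV. gmet L j k x y * u $ j * u $ k) - (\<Sum>j\<in>UNIV. ylow j x y * u $ j)\<^sup>2)"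
proof -
  have 1: "(\<Sum>k\<in>UNIV. (\<Sum>m\<in>UNIV. gmet L j m x y * jacobi m k x y) * y $ k) = 0" for j
  proof -
    have "(\<Sum>k\<in>UNIV. (\<Sum>m\<in>UNIV. gmet L j m x y * jacobi m k x y) * y $ k)
       = (\<Sum>m\<in>UNIV. gmet L j m x y * (\<Sum>k\<in>UNIV. jacobi m k x y * y $ k))"
      unfolding sum_distrib_left sum_distrib_right by (subst sum.swap) (simp add: mult_ac)
    then show ?thesis by (simp add: jacobi_radial)
  qed
  have "(\<Sum>j\<in>UNIV. \<Sum>k\<in>UNIV. (\<Sum>m\<in>UNIV. gmet L j m x y * jacobi m k x y) * u $ j * u $ k)
      = (\<Sum>j\<in>UNIV. t * t * y $ j * (\<Sum>k\<in>UNIV. (\<Sum>m\<in>UNIV. gmet L j m x y * jacobi m k x y) * y $ k))"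
    unfolding u sum_distrib_left by (intro sum.cong refl) (simp add: mult_ac)
  moreover have "(\<Sum>j\<in>UNIV. ylow j x y * u $ j) = t * energy x y"
    unfolding u ylow_radial[OF xy, symmetric] sum_distrib_left by (simp add: mult_ac)
  moreover have "(\<Sum>j\<in>UNIV. \<Sum>k\<in>UNIV. gmet L j k x y * u $ j * u $ k) = t * t * energy x y"
  proof -
    have "(\<Sum>j\<in>UNIV. \<Sum>k\<in>UNIV. gmet L j k x y * u $ j * u $ k) = t * t * (\<Sum>j\<in>UNIV. (\<Sum>k\<in>UNIV. gmet L j k x y * y $ k) * y $ j)"
      unfolding u sum_distrib_left sum_distrib_right by (simp add: mult_ac)
    then show ?thesis by (simp only: gmet_radial[OF xy] ylow_radial[OF xy])
  qed
  ultimately show ?thesis by (simp add: 1 power2_eq_square)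
qed

end

text \<open>For \<open>u\<close> independent of \<open>y\<close> the quadratic form of the Jacobi endomorphism at \<open>u\<close> is the sectional
  curvature of the plane they span, up to the Gram determinant. For dependent \<open>u\<close> both sides vanish.\<close>

lemma (in smooth_mfd) jacobi_of_flag_curvature:
  assumes F: "finsler_structure M A F" and c: "c \<in> A"
    and flag: "\<And>p P v. p \<in> dom_ch c \<Longrightarrow> subspace P \<Longrightarrow> dim P = 2 \<Longrightarrow> v \<in> P \<Longrightarrow> v \<noteq> 0 \<Longrightarrow> has_flag_curvature M A F c p P v K"
    and x: "x \<in> img_ch c" and y: "y \<noteq> 0"
  shows "finsler_chart.jacobi (local_expr M A F c) i k x y
    = K * ((if i = k then (local_expr M A F c x y)\<^sup>2 else 0) - y $ i * finsler_chart.ylow (local_expr M A F c) k x y)"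
proof -
  let ?L = "local_expr M A F c"
  interpret C: finsler_chart ?L "img_ch c" by (rule finsler_chart_local_expr[OF F c])
  have U: "(x, y) \<in> C.U" using x y by (simp add: C.mem_U)
  show ?thesis
  proof (rule C.jacobi_of_quadratic[OF U])
    fix u :: "real^'n"
    show "(\<Sum>j\<in>UNIV. \<Sum>k\<in>UNIV. (\<Sum>m\<in>UNIV. gmet ?L j m x y * C.jacobi m k x y) * u $ j * u $ k)
      = K * ((?L x y)\<^sup>2 * (\<Sum>j\<in>UNIV. \<Sum>k\<in>UNIV. gmet ?L j k x y * u $ j * u $ k) - (\<Sum>j\<in>UNIV. C.ylow j x y * u $ j)\<^sup>2)"
    proof (cases "\<exists>t. u = t *\<^sub>R y")
      case True
      then show ?thesis using C.jacobi_quadratic_dependent[OF U] by blast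
    next
      case False
      let ?p = "inv_ch c x"
      have p: "?p \<in> dom_ch c" by (rule inv_in_dom[OF x])
      have uy: "u \<noteq> y" using False by (metis scaleR_one)
      have ind: "independent {u, y}"
        using False y uy by (auto simp: independent_insert span_singleton)
      have "dim (span {u, y}) = 2" using ind uy by (simp add: dim_eq_card_independent)
      then have "has_flag_curvature M A F c ?p (span {u, y}) y K"
        using y by (intro flag[OF p]) (auto intro: span_base)
      then obtain V X where V: "openin M V" "?p \<in> V" and X: "geodesic_field_on M A F V X" "X ?p = tvec M A c ?p y"
        and sec: "has_sectional_curvature (field_metric M A F c X) (map_ch c ?p) (span {u, y}) K"
        unfolding has_flag_curvature_def by blast
      let ?W = "map_ch c ` (V \<inter> dom_ch c)" and ?\<xi> = "\<lambda>x. comps c (X (inv_ch c x))"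
      interpret G: geodesic_chart_field ?L "img_ch c" ?W ?\<xi>
      proof
        show "open ?W" by (rule open_map_image[OF c V(1)])
        show "?W \<subseteq> img_ch c" by auto
        show "smooth_on ?W ?\<xi>"
          using X(1) c by (simp add: geodesic_field_on_def vector_field_on_def)
      qed (use geodesic_field_in_chart[OF X(1) V(1) c] in auto)
      have xW: "x \<in> ?W" using V(2) p map_inv[OF x] by (metis IntI imageI)
      have xi: "?\<xi> x = y" using X(2) comps_tvec_same[OF c p] by simp
      let ?h = "field_metric M A F c X"
      have h: "?h = G.field_gmet" by (intro ext) (simp add: field_metric_def G.field_gmet_def)
      have inner: "riem_inner ?h x a b = (\<Sum>i\<in>UNIV. \<Sum>j\<in>UNIV. gmet ?L i j x y * a $ i * b $ j)" for a b
        by (simp add: riem_inner_def field_metric_def xi)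
      have "sec_quot ?h x u y = K"
        using sec uy ind map_inv[OF x] unfolding has_sectional_curvature_def by simp
      moreover have "(\<chi> i. \<Sum>j\<in>UNIV. \<Sum>k\<in>UNIV. \<Sum>l\<in>UNIV. riem_curv ?h i j k l x * y $ j * u $ k * y $ l)
          = (\<chi> i. \<Sum>k\<in>UNIV. C.jacobi i k x y * u $ k)"
      proof -
        have "(\<Sum>j\<in>UNIV. \<Sum>k\<in>UNIV. \<Sum>l\<in>UNIV. riem_curv ?h i j k l x * y $ j * u $ k * y $ l) = (\<Sum>k\<in>UNIV. C.jacobi i k x y * u $ k)" for i
        proof -
          have "(\<Sum>j\<in>UNIV. \<Sum>k\<in>UNIV. \<Sum>l\<in>UNIV. riem_curv ?h i j k l x * y $ j * u $ k * y $ l)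
            = (\<Sum>k\<in>UNIV. \<Sum>j\<in>UNIV. \<Sum>l\<in>UNIV. riem_curv ?h i j k l x * y $ j * u $ k * y $ l)" by (rule sum.swap)
          also have "\<dots> = (\<Sum>k\<in>UNIV. \<Sum>l\<in>UNIV. \<Sum>j\<in>UNIV. riem_curv ?h i j k l x * y $ j * u $ k * y $ l)"
            by (intro sum.cong refl sum.swap)
          also have "\<dots> = (\<Sum>k\<in>UNIV. (\<Sum>l\<in>UNIV. (\<Sum>j\<in>UNIV. riem_curv ?h i j k l x * y $ j) * y $ l) * u $ k)"
            unfolding sum_distrib_right by (simp add: mult_ac)
          also have "\<dots> = (\<Sum>k\<in>UNIV. C.jacobi i k x y * u $ k)"
            using G.riem_curv_field_eq_jacobi[OF xW] unfolding xi h by simp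
          finally show ?thesis .
        qed
        then show ?thesis by simp
      qed
      ultimately have quot: "riem_inner ?h x (\<chi> i. \<Sum>k\<in>UNIV. C.jacobi i k x y * u $ k) u
          / (riem_inner ?h x u u * riem_inner ?h x y y - (riem_inner ?h x u y)\<^sup>2) = K"
        by (simp add: sec_quot_def)
      have yy: "riem_inner ?h x y y = (?L x y)\<^sup>2"
        unfolding inner C.ylow_radial[OF U, symmetric] C.gmet_radial(1)[OF U, symmetric] sum_distrib_right
        by (simp add: mult_ac)
      have u_y: "riem_inner ?h x u y = (\<Sum>i\<in>UNIV. C.ylow i x y * u $ i)"
        unfolding inner C.gmet_radial(1)[OF U, symmetric] sum_distrib_right by (simp add: mult_ac)
      have num: "riem_inner ?h x (\<chi> i. \<Sum>k\<in>UNIV. C.jacobi i k x y * u $ k) u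
          = (\<Sum>j\<in>UNIV. \<Sum>k\<in>UNIV. (\<Sum>m\<in>UNIV. gmet ?L j m x y * C.jacobi m k x y) * u $ j * u $ k)"
      proof -
        have "riem_inner ?h x (\<chi> i. \<Sum>k\<in>UNIV. C.jacobi i k x y * u $ k) u
            = (\<Sum>m\<in>UNIV. \<Sum>j\<in>UNIV. \<Sum>k\<in>UNIV. gmet ?L j m x y * C.jacobi m k x y * u $ j * u $ k)"
          unfolding inner by (simp add: sum_distrib_left sum_distrib_right C.gmet_sym[OF U, of _ ] mult_ac)
        also have "\<dots> = (\<Sum>j\<in>UNIV. \<Sum>m\<in>UNIV. \<Sum>k\<in>UNIV. gmet ?L j m x y * C.jacobi m k x y * u $ j * u $ k)"
          by (rule sum.swap)
        also have "\<dots> = (\<Sum>j\<in>UNIV. \<Sum>k\<in>UNIV. \<Sum>m\<in>UNIV. gmet ?L j m x y * C.jacobi m k x y * u $ j * u $ k)"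
          by (intro sum.cong refl sum.swap)
        finally show ?thesis by (simp add: sum_distrib_right)
      qed
      have "0 < (?L x y)\<^sup>2 * riem_inner ?h x u u - (\<Sum>i\<in>UNIV. C.ylow i x y * u $ i)\<^sup>2"
        unfolding inner using False by (intro C.flag_gram_pos[OF U]) blast
      then show ?thesis
        using quot unfolding yy u_y num inner[of u u] by (simp add: field_simps)
    qed
  qed
qed

theorem theorem3p7:
  fixes M :: "'m topology"
    and A :: "('m, 'n::finite) chart set"
    and F :: "'m \<Rightarrow> 'm tangent \<Rightarrow> real"
  assumes "smooth_manifold M A"
    and "connected_space M"
    and "CARD('n) \<ge> 3"
    and "finsler_structure M A F"
    and "constant_flag_curvature M A F"
    and "\<And>c x y i h k l p. c \<in> A \<Longrightarrow> x \<in> img_ch c \<Longrightarrow> y \<noteq> 0 \<Longrightarrow>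
           hcov13 (local_expr M A F c) (Dtensor (local_expr M A F c)) i h k l p x y = 0"
    and "\<And>c L x y i k l h p. c \<in> A \<Longrightarrow> L = local_expr M A F c \<Longrightarrow> x \<in> img_ch c \<Longrightarrow> y \<noteq> 0 \<Longrightarrow>
           (\<Sum>m\<in>UNIV. dy m (Rcurv L i k l) x y * Adot L m h p x y)
         + (\<Sum>m\<in>UNIV. Rcurv L m k l x y * dGam L i m p h x y)
         - (\<Sum>m\<in>UNIV. Rcurv L i m l x y * dGam L m k p h x y)
         - (\<Sum>m\<in>UNIV. Rcurv L i k m x y * dGam L m l p h x y) = 0"
  shows "finsler_symmetric M A F"
proof -
  interpret smooth_mfd M A by unfold_locales (rule assms(1))
  obtain K where K: "\<And>c p P v. c \<in> A \<Longrightarrow> p \<in> dom_ch c \<Longrightarrow> subspace P \<Longrightarrow> dim P = 2 \<Longrightarrow> v \<in> P \<Longrightarrow> v \<noteq> 0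
      \<Longrightarrow> has_flag_curvature M A F c p P v K"
    using assms(5) unfolding constant_flag_curvature_def by blast
  show ?thesis
    unfolding finsler_symmetric_def
  proof (intro ballI impI allI)
    fix c x y i j k h l assume c: "c \<in> A" and x: "x \<in> img_ch c" and y: "y \<noteq> (0 :: real^'n)"
    interpret C: finsler_chart "local_expr M A F c" "img_ch c"
      by (rule finsler_chart_local_expr[OF assms(4) c])
    have J: "C.jacobi i k x y = K * ((if i = k then (local_expr M A F c x y)\<^sup>2 else 0) - y $ i * C.ylow k x y)"
      if "(x, y) \<in> C.U" for i k x y
      using that unfolding C.mem_U by (intro jacobi_of_flag_curvature[OF assms(4) c K[OF c]]) auto
    have curv: "C.curv3 i k l x y = K * ((if i = k then C.ylow l x y else 0) - (if i = l then C.ylow k x y else 0))"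
      if "(x, y) \<in> C.U" for i k l x y
      by (rule C.curv3_of_jacobi[OF that J])
    have "(x, y) \<in> C.U" using x y unfolding C.mem_U by blast
    then show "hcov13 (local_expr M A F c) (hhcurv (local_expr M A F c)) i j k h l x y = 0"
      by (rule C.hcov13_hhcurv_eq_0[of x y K, OF _ curv assms(6)[OF c x y]])
  qed
qed

end
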